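(* Let $k$ be a field of characteristic zero, $n$ a natural number, and $(q_{11},\dots,q_{1n},q_{21},\dots,q_{2n})\in k^{2n}$. Let $S(T_n)$ be the symmetric algebra on $n$-coloured trees with the graded connected Hopf algebra structure defined by this sequence (see context). \begin{enumerate} \item[(i)] For every $n$-coloured forest $t$ the coproduct is given by \[ \Delta(t)=\sum_{s\subset t} q(s,t)\; s\otimes s^c , \] where the sum is over all subforests $s$ of $t$ (all subsets of the vertex set of $t$, including the empty set and the whole of $t$). \item[(ii)] The antipode $S$ of this Hopf algebra is given, for every nonempty $n$-coloured forest $t$, by \[ S(t)=\sum_{m=1}^{|t|}\ \sum_{s_1\cup\dots\cup s_m=t}(-1)^m\, s_1\cdots s_m\prod_{1\le j<m} q(s_j,\,s_j\cup\dots\cup s_m), \] where the inner sum is over ordered partitions $t=s_1\cup\dots\cup s_m$ of (the vertex set of) the forest $t$ into pairwise disjoint nonempty subforests $s_i$. \end{enumerate}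
   Context: A rooted tree is an isomorphism class of finite posets which have a minimum element (the root), and in which $y\neq z$, $y<x$, $z<x$ imply $y<z$ or $z<y$. Elements are called vertices; a pair $v<w$ with no $x$ satisfying $v<x<w$ is called an edge, with lower vertex $v$. An $n$-coloured tree is an isomorphism class of such posets equipped with a function from the set of edges to $\{1,\dots,n\}$. $T_n$ is the $k$-vector space with basis the set of $n$-coloured trees. An $n$-coloured forest is a finite, possibly empty, multiset of $n$-coloured trees. $S(T_n)$ has as basis the $n$-coloured forests, with product the disjoint union and unit the empty forest. $|f|$ is the number of vertices of a forest $f$. The linear map $\lambda:S(T_n)^{\otimes n}\to S(T_n)$ sends forests $(f_1,\dots,f_n)$ to the tree obtained by adding a new root and connecting it to each root of each tree of $f_i$ by an edge of colour $i$. The Hopf algebra structure defined by $(q_{11},\dots,q_{2n})$: the product is that of $S(T_n)$, the grading is by the number of vertices, the counit sends every nonempty forest to $0$ and the empty forest to $1$, and the coproduct $\Delta$ is the algebra homomorphism determined inductively by \[ \Delta(\lambda(f_1,\dots,f_n))=\sum \Big(\prod_j q_{1j}^{|f_j'|}\Big) f_1'\cdots f_n'\otimes\lambda(f_1'',\dots,f_n'')+\sum \lambda(f_1',\dots,f_n')\otimes \Big(\prod_j q_{2j}^{|f_j''|}\Big) f_1''\cdots f_n'', \] where $\Delta(f_i)=\sum f_i'\otimes f_i''$ in Sweedler notation (homogeneous terms) and $f_1,\dots,f_n$ are forests. Convention: $q^0=1$ for all $q\in k$, including $q=0$. A subforest $s$ of a forest $t$ is a subset of the vertices with the induced partial order,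 coloured as follows: an edge $v<w$ of $s$ gets the colour of the first edge (the one with lower vertex $v$) on the upward path from $v$ to $w$ in $t$. $s^c$ denotes the complementary subforest of $s$ in $t$. For a tree $t$, a subforest $s\subset t$ and $v\in s$, $p_j(v,s,t)$ is the number of edges of colour $j$ in the path in $t$ from $v$ to the root of $t$ whose lower vertex lies in $s^c$. For a forest $t$, $p_j(v,s,t):=p_j(v,s\cap t',t')$ with $t'$ the connected component (tree) of $t$ containing $v$. Finally \[ q(s,t):=\prod_{j=1}^n\Big(\prod_{v\in s}q_{1j}^{\,p_j(v,s,t)}\cdot\prod_{v\in s^c}q_{2j}^{\,p_j(v,s^c,t)}\Big). \] *)

theory Defs
  imports
    Complex_Main
    "HOL-Library.Poly_Mapping"
    "HOL-Library.Product_Plus"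
    "HOL-Library.Multiset"
    "HOL-Library.FuncSet"
    "HOL-Library.Nat_Bijection"
begin

section \<open>Coloured posets, trees and forests\<close>

text \<open>
  Every finite poset is isomorphic to one whose elements are natural numbers, so isomorphism classes
  of finite posets are formed from posets on sets of natural numbers. Colours are natural numbers;
  the restriction to \<open>{1..n}\<close> is imposed by \<open>n_coloured\<close> below. The values of \<open>colour\<close> matter
  on edges only.
\<close>

datatype cposet =
  CPoset (verts: "nat set") (ord: "(nat \<times> nat) set") (colour: "nat \<Rightarrow> nat \<Rightarrow> nat")

definition lt :: "cposet \<Rightarrow> nat \<Rightarrow> nat \<Rightarrow> bool" where
  "lt P x y \<longleftrightarrow> (x, y) \<in> ord P \<and> x \<noteq> y"

definition edge :: "cposet \<Rightarrow> nat \<Rightarrow> nat \<Rightarrow> bool" where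
  "edge P v w \<longleftrightarrow> lt P v w \<and> \<not> (\<exists>x. lt P v x \<and> lt P x w)"

definition is_forest :: "cposet \<Rightarrow> bool" where
  "is_forest P \<longleftrightarrow> finite (verts P) \<and> partial_order_on (verts P) (ord P) \<and>
     (\<forall>x y z. y \<noteq> z \<and> lt P y x \<and> lt P z x \<longrightarrow> lt P y z \<or> lt P z y)"

definition is_tree :: "cposet \<Rightarrow> bool" where
  "is_tree P \<longleftrightarrow> is_forest P \<and> (\<exists>r\<in>verts P. \<forall>v\<in>verts P. (r, v) \<in> ord P)"

definition n_coloured :: "nat \<Rightarrow> cposet \<Rightarrow> bool" where
  "n_coloured n P \<longleftrightarrow> (\<forall>v w. edge P v w \<longrightarrow> colour P v w \<in> {1..n})"

definition iso_via :: "(nat \<Rightarrow> nat) \<Rightarrow> cposet \<Rightarrow> cposet \<Rightarrow> bool" where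
  "iso_via \<phi> P Q \<longleftrightarrow> bij_betw \<phi> (verts P) (verts Q) \<and>
     (\<forall>x\<in>verts P. \<forall>y\<in>verts P. (x, y) \<in> ord P \<longleftrightarrow> (\<phi> x, \<phi> y) \<in> ord Q) \<and>
     (\<forall>x\<in>verts P. \<forall>y\<in>verts P. edge P x y \<longrightarrow> colour P x y = colour Q (\<phi> x) (\<phi> y))"

definition iso :: "cposet \<Rightarrow> cposet \<Rightarrow> bool" where
  "iso P Q \<longleftrightarrow> (\<exists>\<phi>. iso_via \<phi> P Q)"

lemma forest_ordD:
  assumes "is_forest P"
  shows "(x, y) \<in> ord P \<Longrightarrow> x \<in> verts P \<and> y \<in> verts P"
    and "x \<in> verts P \<Longrightarrow> (x, x) \<in> ord P"
    and "(x, y) \<in> ord P \<Longrightarrow> (y, z) \<in> ord P \<Longrightarrow> (x, z) \<in> ord P"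
    and "(x, y) \<in> ord P \<Longrightarrow> (y, x) \<in> ord P \<Longrightarrow> x = y"
    and "(y, x) \<in> ord P \<Longrightarrow> (z, x) \<in> ord P \<Longrightarrow> (y, z) \<in> ord P \<or> (z, y) \<in> ord P"
proof -
  have po: "partial_order_on (verts P) (ord P)" and
    ch: "\<And>x y z. y \<noteq> z \<Longrightarrow> lt P y x \<Longrightarrow> lt P z x \<Longrightarrow> lt P y z \<or> lt P z y"
    using assms unfolding is_forest_def by blast+
  note D = partial_order_onD[OF po]
  show 1: "(x, y) \<in> ord P \<Longrightarrow> x \<in> verts P \<and> y \<in> verts P" for x y using D(4) by auto
  show 2: "x \<in> verts P \<Longrightarrow> (x, x) \<in> ord P" for x using D(1) by (auto simp: refl_on_def)
  show "(x, y) \<in> ord P \<Longrightarrow> (y, z) \<in> ord P \<Longrightarrow> (x, z) \<in> ord P" using D(2) by (meson transD)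
  show "(x, y) \<in> ord P \<Longrightarrow> (y, x) \<in> ord P \<Longrightarrow> x = y" using D(3) by (meson antisymD)
  show "(y, x) \<in> ord P \<Longrightarrow> (z, x) \<in> ord P \<Longrightarrow> (y, z) \<in> ord P \<or> (z, y) \<in> ord P"
    using ch[of y z x] 1 2 unfolding lt_def by (cases "y = z"; cases "y = x"; cases "z = x") auto
qed

lemma edgeD:
  assumes "edge P v w" shows "(v, w) \<in> ord P" "v \<noteq> w"
  using assms unfolding edge_def lt_def by auto

lemma iso_via_edge:
  assumes P: "is_forest P" and Q: "is_forest Q" and i: "iso_via \<phi> P Q"
    and x: "x \<in> verts P" and y: "y \<in> verts P"
  shows "edge Q (\<phi> x) (\<phi> y) \<longleftrightarrow> edge P x y"
proof -
  have b: "bij_betw \<phi> (verts P) (verts Q)"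
    and o: "\<And>x y. x \<in> verts P \<Longrightarrow> y \<in> verts P \<Longrightarrow> (x, y) \<in> ord P \<longleftrightarrow> (\<phi> x, \<phi> y) \<in> ord Q"
    using i unfolding iso_via_def by auto
  have inj: "\<And>x y. x \<in> verts P \<Longrightarrow> y \<in> verts P \<Longrightarrow> \<phi> x = \<phi> y \<longleftrightarrow> x = y"
    using b by (meson bij_betw_def inj_on_eq_iff)
  have l: "lt Q (\<phi> x) (\<phi> y) \<longleftrightarrow> lt P x y" if "x \<in> verts P" "y \<in> verts P" for x y
    using that o inj unfolding lt_def by simp
  have "(\<exists>z. lt Q (\<phi> x) z \<and> lt Q z (\<phi> y)) \<longleftrightarrow> (\<exists>z. lt P x z \<and> lt P z y)"
  proof
    assume "\<exists>z. lt Q (\<phi> x) z \<and> lt Q z (\<phi> y)"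
    then obtain z where z: "lt Q (\<phi> x) z" "lt Q z (\<phi> y)" by auto
    then have "z \<in> verts Q" using forest_ordD(1)[OF Q] unfolding lt_def by blast
    then obtain u where "u \<in> verts P" "z = \<phi> u" using b unfolding bij_betw_def by auto
    then show "\<exists>z. lt P x z \<and> lt P z y" using z l x y by auto
  next
    assume "\<exists>z. lt P x z \<and> lt P z y"
    then obtain z where z: "lt P x z" "lt P z y" by auto
    then have "z \<in> verts P" using forest_ordD(1)[OF P] unfolding lt_def by blast
    then show "\<exists>z. lt Q (\<phi> x) z \<and> lt Q z (\<phi> y)" using z l x y by auto
  qed
  then show ?thesis unfolding edge_def using l[OF x y] by simp
qed

lemma iso_refl: "iso P P"
  unfolding iso_def iso_via_def by (intro exI[of _ id]) auto

lemma iso_sym: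
  assumes P: "is_forest P" and Q: "is_forest Q" and "iso P Q"
  shows "iso Q P"
proof -
  obtain \<phi> where i: "iso_via \<phi> P Q" using assms(3) unfolding iso_def by auto
  define \<psi> where "\<psi> = inv_into (verts P) \<phi>"
  have b: "bij_betw \<phi> (verts P) (verts Q)" using i unfolding iso_via_def by auto
  have b': "bij_betw \<psi> (verts Q) (verts P)" unfolding \<psi>_def by (rule bij_betw_inv_into[OF b])
  have m: "\<psi> x \<in> verts P" and e: "\<phi> (\<psi> x) = x" if "x \<in> verts Q" for x
    using that b b' unfolding \<psi>_def
    by (auto simp: bij_betw_inv_into_right[OF b] intro: bij_betwE[OF b', unfolded \<psi>_def, rule_format])
  have "iso_via \<psi> Q P"
    unfolding iso_via_def
  proof (intro conjI ballI impI)
    fix x y assume x: "x \<in> verts Q" and y: "y \<in> verts Q"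
    show "(x, y) \<in> ord Q \<longleftrightarrow> (\<psi> x, \<psi> y) \<in> ord P"
      using i m[OF x] m[OF y] e[OF x] e[OF y] unfolding iso_via_def by auto
    assume "edge Q x y"
    then have "edge P (\<psi> x) (\<psi> y)"
      using iso_via_edge[OF P Q i m[OF x] m[OF y]] e x y by simp
    then show "colour Q x y = colour P (\<psi> x) (\<psi> y)"
      using i m[OF x] m[OF y] e[OF x] e[OF y] unfolding iso_via_def by auto
  qed (rule b')
  then show ?thesis unfolding iso_def by auto
qed

lemma iso_trans:
  assumes P: "is_forest P" and Q: "is_forest Q" and "iso P Q" "iso Q R"
  shows "iso P R"
proof -
  obtain \<phi> \<psi> where i: "iso_via \<phi> P Q" and j: "iso_via \<psi> Q R" using assms unfolding iso_def by auto
  have m: "\<phi> x \<in> verts Q" if "x \<in> verts P" for x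
    using i that unfolding iso_via_def by (auto dest: bij_betwE)
  have "iso_via (\<psi> \<circ> \<phi>) P R"
    using i j m iso_via_edge[OF P Q i]
    unfolding iso_via_def by (auto intro: bij_betw_trans)
  then show ?thesis unfolding iso_def by auto
qed

quotient_type ctree = cposet / partial: "\<lambda>P Q. is_tree P \<and> is_tree Q \<and> iso P Q"
proof (rule part_equivpI)
  have "is_tree (CPoset {0} {(0, 0)} (\<lambda>_ _. 1))"
    unfolding is_tree_def is_forest_def lt_def
    by (auto simp: partial_order_on_def preorder_on_def refl_on_def trans_def antisym_def)
  then show "\<exists>P. is_tree P \<and> is_tree P \<and> iso P P" using iso_refl by blast
  show "symp (\<lambda>P Q. is_tree P \<and> is_tree Q \<and> iso P Q)"
    by (auto simp: is_tree_def intro!: sympI iso_sym)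
  show "transp (\<lambda>P Q. is_tree P \<and> is_tree Q \<and> iso P Q)"
    by (auto simp: is_tree_def intro!: transpI elim: iso_trans)
qed

type_synonym cforest = "ctree multiset"

definition ntrees :: "nat \<Rightarrow> ctree set" where
  "ntrees n = abs_ctree ` {P. is_tree P \<and> n_coloured n P}"

definition nforests :: "nat \<Rightarrow> cforest set" where
  "nforests n = {f. set_mset f \<subseteq> ntrees n}"

definition tree_size :: "ctree \<Rightarrow> nat" where
  "tree_size t = card (verts (rep_ctree t))"

definition forest_size :: "cforest \<Rightarrow> nat" where
  "forest_size f = (\<Sum>t\<in>#f. tree_size t)"


section \<open>Subforests\<close>

text \<open>
  In a forest poset the edge \<open>v < x\<close> with \<open>x \<le> w\<close> is unique for given \<open>v < w\<close>: it is the
  first edge on the upward path from \<open>v\<close> to \<open>w\<close>.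
\<close>

definition induced :: "cposet \<Rightarrow> nat set \<Rightarrow> cposet" where
  "induced P s = CPoset s (ord P \<inter> s \<times> s)
     (\<lambda>v w. colour P v (THE x. edge P v x \<and> (x, w) \<in> ord P))"

definition connected_rel :: "cposet \<Rightarrow> (nat \<times> nat) set" where
  "connected_rel P = (ord P \<union> (ord P)\<inverse>)\<^sup>+"

definition forest_of :: "cposet \<Rightarrow> cforest" where
  "forest_of P =
     image_mset (\<lambda>C. abs_ctree (induced P C)) (mset_set (verts P // connected_rel P))"

definition nforest_posets :: "nat \<Rightarrow> cposet set" where
  "nforest_posets n = {P. is_forest P \<and> n_coloured n P}"

text \<open>In a tree, the edges on the path from \<open>v\<close> to the root are the edges whose upper vertex is
  below or equal to \<open>v\<close>.\<close>

definition p_tree :: "nat \<Rightarrow> nat \<Rightarrow> nat set \<Rightarrow> cposet \<Rightarrow> nat" where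
  "p_tree j v s T =
     card {(x, y). edge T x y \<and> (y, v) \<in> ord T \<and> colour T x y = j \<and> x \<in> verts T - s}"

definition p_forest :: "nat \<Rightarrow> nat \<Rightarrow> nat set \<Rightarrow> cposet \<Rightarrow> nat" where
  "p_forest j v s P = (let C = connected_rel P `` {v} in p_tree j v (s \<inter> C) (induced P C))"

text \<open>The parameters are given by \<open>q :: nat \<Rightarrow> nat \<Rightarrow> 'k\<close>, of which only \<open>q 1 j\<close> and \<open>q 2 j\<close>
  with \<open>1 \<le> j \<le> n\<close> are used.\<close>

definition qcoeff :: "nat \<Rightarrow> (nat \<Rightarrow> nat \<Rightarrow> 'k::comm_ring_1) \<Rightarrow> nat set \<Rightarrow> cposet \<Rightarrow> 'k" where
  "qcoeff n q s P = (\<Prod>j=1..n.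
     (\<Prod>v\<in>s. q 1 j ^ p_forest j v s P) *
     (\<Prod>v\<in>verts P - s. q 2 j ^ p_forest j v (verts P - s) P))"

definition ordered_partitions :: "'a set \<Rightarrow> nat \<Rightarrow> 'a set list set" where
  "ordered_partitions A m = {ss. length ss = m \<and> (\<forall>i<m. ss ! i \<noteq> {}) \<and>
     (\<forall>i<m. \<forall>j<m. i \<noteq> j \<longrightarrow> ss ! i \<inter> ss ! j = {}) \<and> (\<Union>i<m. ss ! i) = A}"


section \<open>Every forest is the forest of a forest poset\<close>

lemma edge_cover_unique:
  assumes P: "is_forest P" and e: "edge P x y"
  shows "(THE z. edge P x z \<and> (z, y) \<in> ord P) = y"
proof (rule the_equality)
  have "y \<in> verts P" using forest_ordD(1)[OF P edgeD(1)[OF e]] by simp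
  then show "edge P x y \<and> (y, y) \<in> ord P" using e forest_ordD(2)[OF P] by simp
next
  fix z assume z: "edge P x z \<and> (z, y) \<in> ord P"
  then have "lt P x z" unfolding edge_def by simp
  then show "z = y" using z e unfolding edge_def lt_def by blast
qed

lemma is_forest_induced:
  assumes "is_forest P" "s \<subseteq> verts P"
  shows "is_forest (induced P s)"
proof -
  note D = forest_ordD[OF assms(1)]
  show ?thesis
    unfolding is_forest_def
  proof (intro conjI allI impI)
    show "finite (verts (induced P s))"
      using assms finite_subset unfolding is_forest_def induced_def by auto
    show "partial_order_on (verts (induced P s)) (ord (induced P s))"
      unfolding partial_order_on_def preorder_on_def refl_on_def trans_def antisym_def induced_def
      using D(2-4) assms(2) by (auto; blast)
    fix x y z
    assume "y \<noteq> z \<and> lt (induced P s) y x \<and> lt (induced P s) z x"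
    then show "lt (induced P s) y z \<or> lt (induced P s) z y"
      using D(5)[of y x z] unfolding lt_def induced_def by auto
  qed
qed

lemma connected_rel_iff:
  assumes P: "is_forest P"
  shows "(x, y) \<in> connected_rel P \<longleftrightarrow> (\<exists>u. (u, x) \<in> ord P \<and> (u, y) \<in> ord P)"
proof
  note D = forest_ordD[OF P]
  assume "(x, y) \<in> connected_rel P"
  then have "(x, y) \<in> (ord P \<union> (ord P)\<inverse>)\<^sup>+" unfolding connected_rel_def .
  then show "\<exists>u. (u, x) \<in> ord P \<and> (u, y) \<in> ord P"
  proof (induction rule: trancl_induct)
    case (base y)
    then show ?case using D(1,2) by blast
  next
    case (step y z)
    then obtain u where u: "(u, x) \<in> ord P" "(u, y) \<in> ord P" by auto
    from step(2) show ?case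
    proof
      assume "(y, z) \<in> ord P" then show ?case using u D(3) by blast
    next
      assume "(y, z) \<in> (ord P)\<inverse>"
      then have "(z, y) \<in> ord P" by simp
      then have "(u, z) \<in> ord P \<or> (z, u) \<in> ord P" using u D(5) by blast
      then show ?case using u D(1-3) by blast
    qed
  qed
next
  assume "\<exists>u. (u, x) \<in> ord P \<and> (u, y) \<in> ord P"
  then obtain u where "(u, x) \<in> ord P" "(u, y) \<in> ord P" by auto
  then have "(x, u) \<in> ord P \<union> (ord P)\<inverse>" "(u, y) \<in> ord P \<union> (ord P)\<inverse>" by auto
  then show "(x, y) \<in> connected_rel P"
    unfolding connected_rel_def by (meson trancl.r_into_trancl trancl_trans)
qed

lemma equiv_connected_rel:
  assumes P: "is_forest P"
  shows "equiv (verts P) (connected_rel P)"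
proof (rule equivI)
  note D = forest_ordD[OF P]
  show "connected_rel P \<subseteq> verts P \<times> verts P" using connected_rel_iff[OF P] D(1) by auto
  show "refl_on (verts P) (connected_rel P)"
    unfolding refl_on_def connected_rel_iff[OF P] using D(2) by blast
  show "sym (connected_rel P)" using connected_rel_iff[OF P] by (auto simp: sym_def)
  show "trans (connected_rel P)" unfolding connected_rel_def by simp
qed

lemma component_tree:
  assumes P: "is_forest P" and C: "C \<in> verts P // connected_rel P"
  shows "is_tree (induced P C)" and "n_coloured n P \<Longrightarrow> n_coloured n (induced P C)"
proof -
  note D = forest_ordD[OF P]
  note E = equiv_connected_rel[OF P]
  have sub: "C \<subseteq> verts P" using C E by (meson in_quotient_imp_subset)
  have fin: "finite C" using sub P finite_subset unfolding is_forest_def by auto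
  have ne: "C \<noteq> {}" using C E by (meson in_quotient_imp_non_empty)
  have cc: "(x, y) \<in> connected_rel P" if "x \<in> C" "y \<in> C" for x y
    using that C E in_quotient_imp_in_rel by fastforce
  have cl: "y \<in> C" if "x \<in> C" "(x, y) \<in> ord P \<or> (y, x) \<in> ord P" for x y
  proof -
    have "(x, y) \<in> connected_rel P" unfolding connected_rel_iff[OF P] using that D(1,2) by blast
    then show ?thesis using that(1) C E in_quotient_imp_closed by fastforce
  qed
  have "\<exists>r\<in>C. \<forall>x\<in>C. (x, r) \<in> ord P \<longrightarrow> x = r"
  proof -
    define h where "h x = card {y. (y, x) \<in> ord P}" for x
    obtain r where r: "r \<in> C" "\<And>x. x \<in> C \<Longrightarrow> h r \<le> h x"
      using ex_min_if_finite[of "h ` C"] fin ne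
      by (metis arg_min_if_finite(1) arg_min_least)
    have "x = r" if "x \<in> C" "(x, r) \<in> ord P" for x
    proof (rule ccontr)
      assume "x \<noteq> r"
      have "r \<notin> {y. (y, x) \<in> ord P}" using \<open>x \<noteq> r\<close> that D(4) by blast
      moreover have "r \<in> {y. (y, r) \<in> ord P}" using r(1) sub D(2) by auto
      moreover have "{y. (y, x) \<in> ord P} \<subseteq> {y. (y, r) \<in> ord P}" using that D(3) by auto
      ultimately have "{y. (y, x) \<in> ord P} \<subset> {y. (y, r) \<in> ord P}" by blast
      moreover have "finite {y. (y, r) \<in> ord P}"
        by (rule finite_subset[of _ "verts P"]) (use D(1) P in \<open>auto simp: is_forest_def\<close>)
      ultimately have "h x < h r" unfolding h_def by (rule psubset_card_mono[rotated])
      then show False using r(2)[OF that(1)] by simp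
    qed
    then show ?thesis using r(1) by auto
  qed
  then obtain r where r: "r \<in> C" "\<And>x. x \<in> C \<Longrightarrow> (x, r) \<in> ord P \<Longrightarrow> x = r" by auto
  have "(r, v) \<in> ord P" if v: "v \<in> C" for v
  proof -
    obtain u where u: "(u, r) \<in> ord P" "(u, v) \<in> ord P"
      using cc[OF r(1) v] connected_rel_iff[OF P] by auto
    then show ?thesis using r(2)[of u] cl[OF r(1)] by auto
  qed
  then show "is_tree (induced P C)"
    using is_forest_induced[OF P sub] r(1) unfolding is_tree_def induced_def by auto
  have lts: "lt (induced P C) x y \<longleftrightarrow> lt P x y \<and> x \<in> C \<and> y \<in> C" for x y
    unfolding lt_def induced_def by auto
  have eq: "edge P x y" if "edge (induced P C) x y" for x y
    using that cl unfolding edge_def lts by (meson lt_def)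
  show "n_coloured n (induced P C)" if n: "n_coloured n P"
    unfolding n_coloured_def
  proof (intro allI impI)
    fix v w assume "edge (induced P C) v w"
    then have "edge P v w" by (rule eq)
    then show "colour (induced P C) v w \<in> {1..n}"
      using n edge_cover_unique[OF P] unfolding n_coloured_def induced_def by simp
  qed
qed

definition disjoint_union :: "nat \<Rightarrow> (nat \<Rightarrow> cposet) \<Rightarrow> cposet" where
  "disjoint_union k T = CPoset
     {prod_encode (i, v) | i v. i < k \<and> v \<in> verts (T i)}
     {(prod_encode (i, v), prod_encode (i, w)) | i v w. i < k \<and> (v, w) \<in> ord (T i)}
     (\<lambda>x y. colour (T (fst (prod_decode x))) (snd (prod_decode x)) (snd (prod_decode y)))"

lemma forest_of_disjoint_union:
  assumes T: "\<And>i. i < k \<Longrightarrow> is_tree (T i)"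
  shows "is_forest (disjoint_union k T)"
    and "(\<And>i. i < k \<Longrightarrow> n_coloured n (T i)) \<Longrightarrow> n_coloured n (disjoint_union k T)"
    and "forest_of (disjoint_union k T) = mset (map (\<lambda>i. abs_ctree (T i)) [0..<k])"
proof -
  define U where "U = disjoint_union k T"
  define e where "e i v = prod_encode (i, v)" for i v :: nat
  have F: "is_forest (T i)" if "i < k" for i using T[OF that] unfolding is_tree_def by auto
  have einj [simp]: "e i v = e j w \<longleftrightarrow> i = j \<and> v = w" for i v j w unfolding e_def by simp
  have V: "verts U = {e i v | i v. i < k \<and> v \<in> verts (T i)}"
    unfolding U_def disjoint_union_def e_def by simp
  have O: "ord U = {(e i v, e i w) | i v w. i < k \<and> (v, w) \<in> ord (T i)}"
    unfolding U_def disjoint_union_def e_def by simp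
  have Cc: "colour U (e i v) (e i w) = colour (T i) v w" for i v w
    unfolding U_def disjoint_union_def e_def by simp
  have O': "(e i v, e j w) \<in> ord U \<longleftrightarrow> i = j \<and> i < k \<and> (v, w) \<in> ord (T i)" for i v j w
    unfolding O by auto
  have OE: "\<exists>i v w. x = e i v \<and> y = e i w \<and> i < k \<and> (v, w) \<in> ord (T i)" if "(x, y) \<in> ord U" for x y
    using that unfolding O by auto
  have fin: "finite (verts U)"
  proof -
    have "verts U = (\<Union>i\<in>{..<k}. e i ` verts (T i))" unfolding V by auto
    then show ?thesis using F unfolding is_forest_def by auto
  qed
  show FU: "is_forest (disjoint_union k T)"
    unfolding U_def[symmetric] is_forest_def
  proof (intro conjI allI impI fin)
    show "partial_order_on (verts U) (ord U)"
      unfolding partial_order_on_def preorder_on_def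
    proof (intro conjI)
      show "ord U \<subseteq> verts U \<times> verts U"
      proof (clarify)
        fix x y assume "(x, y) \<in> ord U"
        then obtain i v w where "x = e i v" "y = e i w" "i < k" "(v, w) \<in> ord (T i)" using OE by blast
        moreover from this have "v \<in> verts (T i) \<and> w \<in> verts (T i)" using forest_ordD(1)[OF F] by blast
        ultimately show "x \<in> verts U \<and> y \<in> verts U" unfolding V by blast
      qed
      show "refl_on (verts U) (ord U)"
        unfolding refl_on_def
      proof
        fix x assume "x \<in> verts U"
        then obtain i v where "x = e i v" "i < k" "v \<in> verts (T i)" unfolding V by blast
        then show "(x, x) \<in> ord U" using forest_ordD(2)[OF F] O' by blast
      qed
      show "trans (ord U)"
      proof (rule transI)
        fix x y z assume xy: "(x, y) \<in> ord U" and yz: "(y, z) \<in> ord U"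
        obtain i v w where 1: "x = e i v" "y = e i w" "i < k" "(v, w) \<in> ord (T i)"
          using OE[OF xy] by blast
        obtain i' v' w' where 2: "y = e i' v'" "z = e i' w'" "(v', w') \<in> ord (T i')"
          using OE[OF yz] by blast
        have "i' = i" "v' = w" using 1(2) 2(1) by auto
        then have "(v, w') \<in> ord (T i)" using 1 2 forest_ordD(3)[OF F] by blast
        then show "(x, z) \<in> ord U" using 1 2 \<open>i' = i\<close> O' by blast
      qed
      show "antisym (ord U)"
      proof (rule antisymI)
        fix x y assume xy: "(x, y) \<in> ord U" and yx: "(y, x) \<in> ord U"
        obtain i v w where 1: "x = e i v" "y = e i w" "i < k" "(v, w) \<in> ord (T i)"
          using OE[OF xy] by blast
        then have "(w, v) \<in> ord (T i)" using yx O' by blast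
        then show "x = y" using 1 forest_ordD(4)[OF F] by blast
      qed
    qed
    fix x y z assume "y \<noteq> z \<and> lt U y x \<and> lt U z x"
    then have "y \<noteq> z" and yx: "(y, x) \<in> ord U" and zx: "(z, x) \<in> ord U" unfolding lt_def by auto
    obtain i v w where 1: "y = e i v" "x = e i w" "i < k" "(v, w) \<in> ord (T i)"
      using OE[OF yx] by blast
    obtain i' v' w' where 2: "z = e i' v'" "x = e i' w'" "(v', w') \<in> ord (T i')"
      using OE[OF zx] by blast
    have "i' = i" "w' = w" using 1(2) 2(2) by auto
    then have "(v, v') \<in> ord (T i) \<or> (v', v) \<in> ord (T i)" using 1 2 forest_ordD(5)[OF F] by blast
    then have "(y, z) \<in> ord U \<or> (z, y) \<in> ord U" using 1 2 \<open>i' = i\<close> O' by blast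
    then show "lt U y z \<or> lt U z y" using \<open>y \<noteq> z\<close> unfolding lt_def by auto
  qed
  have L: "lt U (e i v) (e j w) \<longleftrightarrow> i = j \<and> i < k \<and> lt (T i) v w" for i v j w
    unfolding lt_def O' by auto
  have LE: "\<exists>i v w. x = e i v \<and> y = e i w \<and> i < k \<and> lt (T i) v w" if "lt U x y" for x y
    using that OE unfolding lt_def by blast
  have Ed: "edge U (e i v) (e i w) \<longleftrightarrow> edge (T i) v w" if i: "i < k" for i v w
  proof -
    have "(\<exists>x. lt U (e i v) x \<and> lt U x (e i w)) \<longleftrightarrow> (\<exists>x. lt (T i) v x \<and> lt (T i) x w)"
    proof
      assume "\<exists>x. lt U (e i v) x \<and> lt U x (e i w)"
      then obtain x where x: "lt U (e i v) x" "lt U x (e i w)" by auto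
      obtain u where "x = e i u" using LE[OF x(1)] by auto
      then show "\<exists>x. lt (T i) v x \<and> lt (T i) x w" using x L by auto
    next
      assume "\<exists>x. lt (T i) v x \<and> lt (T i) x w"
      then show "\<exists>x. lt U (e i v) x \<and> lt U x (e i w)" using L i by blast
    qed
    then show ?thesis unfolding edge_def using L i by simp
  qed
  show "n_coloured n (disjoint_union k T)" if n: "\<And>i. i < k \<Longrightarrow> n_coloured n (T i)"
    unfolding U_def[symmetric] n_coloured_def
  proof (intro allI impI)
    fix x y assume xy: "edge U x y"
    then obtain i v w where i: "x = e i v" "y = e i w" "i < k" using LE unfolding edge_def by blast
    then have "edge (T i) v w" using Ed xy by simp
    then show "colour U x y \<in> {1..n}" using n[OF i(3)] i Cc unfolding n_coloured_def by simp
  qed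
  note FU = FU[folded U_def]
  define K where "K i = e i ` verts (T i)" for i
  have KE: "connected_rel U `` {e i v} = K i" if i: "i < k" and v: "v \<in> verts (T i)" for i v
  proof -
    obtain r where r: "r \<in> verts (T i)" "\<And>v. v \<in> verts (T i) \<Longrightarrow> (r, v) \<in> ord (T i)"
      using T[OF i] unfolding is_tree_def by auto
    have "x \<in> K i" if "(u, e i v) \<in> ord U" "(u, x) \<in> ord U" for u x
      using OE[OF that(1)] OE[OF that(2)] forest_ordD(1)[OF F[OF i]] unfolding K_def by auto
    moreover have "(e i r, e i v) \<in> ord U" "x \<in> K i \<Longrightarrow> (e i r, x) \<in> ord U" for x
      using r v i unfolding K_def by (auto simp: O')
    ultimately show ?thesis using connected_rel_iff[OF FU] by blast
  qed
  have ne: "verts (T i) \<noteq> {}" if "i < k" for i using T[OF that] unfolding is_tree_def by auto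
  have Q: "verts U // connected_rel U = K ` {..<k}"
  proof
    show "verts U // connected_rel U \<subseteq> K ` {..<k}"
      using KE by (auto simp: quotient_def V)
    show "K ` {..<k} \<subseteq> verts U // connected_rel U"
    proof
      fix C assume "C \<in> K ` {..<k}"
      then obtain i where i: "i < k" "C = K i" by auto
      then obtain v where "v \<in> verts (T i)" using ne by blast
      then show "C \<in> verts U // connected_rel U"
        using KE[OF i(1)] i V by (auto intro!: quotientI simp flip: KE)
    qed
  qed
  have Kinj: "inj_on K {..<k}"
  proof (rule inj_onI)
    fix i j assume ij: "i \<in> {..<k}" "j \<in> {..<k}" "K i = K j"
    then obtain v where "v \<in> verts (T i)" using ne by blast
    then have "e i v \<in> K j" using ij(3) unfolding K_def by blast
    then show "i = j" unfolding K_def by auto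
  qed
  have "abs_ctree (induced U (K i)) = abs_ctree (T i)" if i: "i < k" for i
  proof -
    have "K i \<in> verts U // connected_rel U" using Q i by auto
    then have tr: "is_tree (induced U (K i))" using component_tree(1)[OF FU] by simp
    have "iso_via (e i) (T i) (induced U (K i))"
      unfolding iso_via_def
    proof (intro conjI ballI impI)
      show "bij_betw (e i) (verts (T i)) (verts (induced U (K i)))"
        unfolding bij_betw_def induced_def K_def by (auto simp: inj_on_def)
      fix x y assume x: "x \<in> verts (T i)" and y: "y \<in> verts (T i)"
      then show "((x, y) \<in> ord (T i)) = ((e i x, e i y) \<in> ord (induced U (K i)))"
        using i unfolding induced_def K_def by (auto simp: O')
      assume "edge (T i) x y"
      then have "edge U (e i x) (e i y)" using Ed i by simp
      then show "colour (T i) x y = colour (induced U (K i)) (e i x) (e i y)"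
        using edge_cover_unique[OF FU] Cc unfolding induced_def by simp
    qed
    then have "iso (induced U (K i)) (T i)"
      using iso_sym F[OF i] tr unfolding iso_def is_tree_def by blast
    then show ?thesis using tr T[OF i] by (simp add: Quotient3_rel_abs[OF Quotient3_ctree])
  qed
  then have "image_mset (\<lambda>i. abs_ctree (induced U (K i))) (mset_set {..<k}) =
      image_mset (\<lambda>i. abs_ctree (T i)) (mset_set {..<k})"
    by (intro image_mset_cong) auto
  then have "forest_of U = image_mset (\<lambda>i. abs_ctree (T i)) (mset_set {..<k})"
    unfolding forest_of_def Q image_mset_mset_set[OF Kinj, symmetric] by (simp add: multiset.map_comp comp_def)
  also have "\<dots> = mset (map (\<lambda>i. abs_ctree (T i)) [0..<k])"
    by (simp add: atLeast0LessThan)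
  finally show "forest_of (disjoint_union k T) = mset (map (\<lambda>i. abs_ctree (T i)) [0..<k])"
    unfolding U_def .
qed

theorem forest_of_image: "forest_of ` nforest_posets n = nforests n"
proof
  show "forest_of ` nforest_posets n \<subseteq> nforests n"
  proof
    fix f assume "f \<in> forest_of ` nforest_posets n"
    then obtain P where P: "is_forest P" "n_coloured n P" "f = forest_of P"
      unfolding nforest_posets_def by auto
    have "finite (verts P // connected_rel P)"
      using P(1) finite_quotient equiv_connected_rel[OF P(1)] unfolding is_forest_def equiv_def by blast
    then show "f \<in> nforests n"
      using component_tree[OF P(1)] P unfolding nforests_def ntrees_def forest_of_def by auto
  qed
  show "nforests n \<subseteq> forest_of ` nforest_posets n"
  proof
    fix f assume f: "f \<in> nforests n"
    obtain ts where ts: "mset ts = f" using ex_mset by auto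
    have "\<forall>i<length ts. \<exists>T. is_tree T \<and> n_coloured n T \<and> ts ! i = abs_ctree T"
    proof (intro allI impI)
      fix i assume "i < length ts"
      then have "ts ! i \<in> ntrees n" using f ts unfolding nforests_def by auto
      then show "\<exists>T. is_tree T \<and> n_coloured n T \<and> ts ! i = abs_ctree T"
        unfolding ntrees_def by auto
    qed
    then obtain T where T: "\<And>i. i < length ts \<Longrightarrow> is_tree (T i)"
      "\<And>i. i < length ts \<Longrightarrow> n_coloured n (T i)" "\<And>i. i < length ts \<Longrightarrow> ts ! i = abs_ctree (T i)"
      by metis
    let ?U = "disjoint_union (length ts) T"
    have "map (\<lambda>i. abs_ctree (T i)) [0..<length ts] = ts"
      using T(3) by (auto intro: nth_equalityI)
    then have "forest_of ?U = f" using forest_of_disjoint_union(3)[of "length ts" T, OF T(1)] ts by simp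
    moreover have "?U \<in> nforest_posets n"
      unfolding nforest_posets_def using forest_of_disjoint_union(1,2)[of "length ts" T] T by simp
    ultimately show "f \<in> forest_of ` nforest_posets n" by auto
  qed
qed


section \<open>The grafting map\<close>

definition forest_rep :: "cforest \<Rightarrow> cposet" where
  "forest_rep f = (SOME P. is_forest P \<and> forest_of P = f)"

text \<open>
  The new root is \<open>0\<close>; a vertex \<open>v\<close> of the forest \<open>F i\<close> becomes \<open>Suc (prod_encode (i, v))\<close>.
  The edges at \<open>0\<close> lead to the roots of the components of the \<open>F i\<close>, and such an edge into
  \<open>F i\<close> gets colour \<open>i\<close>.
\<close>

definition graft_poset :: "nat \<Rightarrow> (nat \<Rightarrow> cposet) \<Rightarrow> cposet" where
  "graft_poset n F = (let e = (\<lambda>i v. Suc (prod_encode (i, v))) in CPoset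
     ({0} \<union> {e i v | i v. i \<in> {1..n} \<and> v \<in> verts (F i)})
     ({(0, 0)} \<union> {(0, e i v) | i v. i \<in> {1..n} \<and> v \<in> verts (F i)} \<union>
      {(e i v, e i w) | i v w. i \<in> {1..n} \<and> (v, w) \<in> ord (F i)})
     (\<lambda>x y. let (i, w) = prod_decode (y - 1) in
        if x = 0 then i else colour (F i) (snd (prod_decode (x - 1))) w))"

definition graft :: "nat \<Rightarrow> (nat \<Rightarrow> cforest) \<Rightarrow> ctree" where
  "graft n f = abs_ctree (graft_poset n (\<lambda>i. forest_rep (f i)))"


section \<open>The Hopf algebra\<close>

text \<open>
  The algebra \<open>S(T\<^sub>n)\<close> consists of the finitely supported functions on forests with convolution
  product; since addition of multisets is disjoint union, the product is disjoint union of
  forests on the basis and \<open>1\<close> is the empty forest. In the same way the tensor square has basis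
  the pairs of forests, and multiplication of pairs is componentwise. As the type of forests
  does not fix \<open>n\<close>, both are carved out as sets.
\<close>

definition ST :: "nat \<Rightarrow> (cforest \<Rightarrow>\<^sub>0 'k::field_char_0) set" where
  "ST n = {x. Poly_Mapping.keys x \<subseteq> nforests n}"

definition ST2 :: "nat \<Rightarrow> (cforest \<times> cforest \<Rightarrow>\<^sub>0 'k::field_char_0) set" where
  "ST2 n = {x. Poly_Mapping.keys x \<subseteq> nforests n \<times> nforests n}"

abbreviation basis :: "'a \<Rightarrow> ('a \<Rightarrow>\<^sub>0 'k::field_char_0)" where
  "basis a \<equiv> Poly_Mapping.single a 1"

definition scale :: "'k::field_char_0 \<Rightarrow> ('a \<Rightarrow>\<^sub>0 'k) \<Rightarrow> ('a \<Rightarrow>\<^sub>0 'k)" where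
  "scale c x = Poly_Mapping.map ((*) c) x"

definition linear_map_on ::
    "('a \<Rightarrow>\<^sub>0 'k::field_char_0) set \<Rightarrow> (('a \<Rightarrow>\<^sub>0 'k) \<Rightarrow> ('b \<Rightarrow>\<^sub>0 'k)) \<Rightarrow> bool" where
  "linear_map_on A f \<longleftrightarrow> (\<forall>x\<in>A. \<forall>y\<in>A. f (x + y) = f x + f y) \<and> (\<forall>c. \<forall>x\<in>A. f (scale c x) = scale c (f x))"

text \<open>
  The right-hand side of the recursion for the coproduct of \<open>graft n f\<close>. Since
  \<open>\<Delta>(f\<^sub>i)\<close> is the sum over the pairs \<open>p\<close> in its support of \<open>lookup (\<Delta>(f\<^sub>i)) p\<close> times
  \<open>fst p \<otimes> snd p\<close>, the Sweedler sums run over the families \<open>p\<close> choosing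
  \<open>p i = (f\<^sub>i', f\<^sub>i'')\<close> from these supports.
\<close>

definition coproduct_step ::
    "nat \<Rightarrow> (nat \<Rightarrow> nat \<Rightarrow> 'k::field_char_0) \<Rightarrow> ((cforest \<Rightarrow>\<^sub>0 'k) \<Rightarrow> (cforest \<times> cforest \<Rightarrow>\<^sub>0 'k)) \<Rightarrow>
     (nat \<Rightarrow> cforest) \<Rightarrow> (cforest \<times> cforest \<Rightarrow>\<^sub>0 'k)" where
  "coproduct_step n q D f =
     (let choices = (\<Pi>\<^sub>E i\<in>{1..n}. Poly_Mapping.keys (D (basis (f i))));
          coeff = (\<lambda>p. \<Prod>i=1..n. Poly_Mapping.lookup (D (basis (f i))) (p i))
      in (\<Sum>p\<in>choices. scale (coeff p * (\<Prod>j=1..n. q 1 j ^ forest_size (fst (p j))))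
            (basis (\<Sum>i=1..n. fst (p i), {#graft n (\<lambda>i. snd (p i))#}))) +
         (\<Sum>p\<in>choices. scale (coeff p * (\<Prod>j=1..n. q 2 j ^ forest_size (snd (p j))))
            (basis ({#graft n (\<lambda>i. fst (p i))#}, \<Sum>i=1..n. snd (p i)))))"

definition is_coproduct ::
    "nat \<Rightarrow> (nat \<Rightarrow> nat \<Rightarrow> 'k::field_char_0) \<Rightarrow>
     ((cforest \<Rightarrow>\<^sub>0 'k) \<Rightarrow> (cforest \<times> cforest \<Rightarrow>\<^sub>0 'k)) \<Rightarrow> bool" where
  "is_coproduct n q D \<longleftrightarrow>
     D \<in> ST n \<rightarrow>\<^sub>E ST2 n \<and> linear_map_on (ST n) D \<and>
     D 1 = 1 \<and> (\<forall>x\<in>ST n. \<forall>y\<in>ST n. D (x * y) = D x * D y) \<and>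
     (\<forall>f. (\<forall>i\<in>{1..n}. f i \<in> nforests n) \<longrightarrow>
        D (basis {#graft n f#}) = coproduct_step n q D f)"

definition coproduct ::
    "nat \<Rightarrow> (nat \<Rightarrow> nat \<Rightarrow> 'k::field_char_0) \<Rightarrow>
     (cforest \<Rightarrow>\<^sub>0 'k) \<Rightarrow> (cforest \<times> cforest \<Rightarrow>\<^sub>0 'k)" where
  "coproduct n q = (THE D. is_coproduct n q D)"

definition counit :: "(cforest \<Rightarrow>\<^sub>0 'k::field_char_0) \<Rightarrow> 'k" where
  "counit x = Poly_Mapping.lookup x {#}"

text \<open>The convolution product \<open>mult \<circ> (A \<otimes> B) \<circ> D\<close> of two linear maps.\<close>

definition convolution ::
    "((cforest \<Rightarrow>\<^sub>0 'k::field_char_0) \<Rightarrow> (cforest \<times> cforest \<Rightarrow>\<^sub>0 'k)) \<Rightarrow>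
     ((cforest \<Rightarrow>\<^sub>0 'k) \<Rightarrow> (cforest \<Rightarrow>\<^sub>0 'k)) \<Rightarrow> ((cforest \<Rightarrow>\<^sub>0 'k) \<Rightarrow> (cforest \<Rightarrow>\<^sub>0 'k)) \<Rightarrow>
     (cforest \<Rightarrow>\<^sub>0 'k) \<Rightarrow> (cforest \<Rightarrow>\<^sub>0 'k)" where
  "convolution D A B x =
     (\<Sum>(a, b)\<in>Poly_Mapping.keys (D x).
        scale (Poly_Mapping.lookup (D x) (a, b)) (A (basis a) * B (basis b)))"

definition is_antipode ::
    "nat \<Rightarrow> (nat \<Rightarrow> nat \<Rightarrow> 'k::field_char_0) \<Rightarrow> ((cforest \<Rightarrow>\<^sub>0 'k) \<Rightarrow> (cforest \<Rightarrow>\<^sub>0 'k)) \<Rightarrow> bool" where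
  "is_antipode n q S \<longleftrightarrow>
     S \<in> ST n \<rightarrow>\<^sub>E ST n \<and> linear_map_on (ST n) S \<and>
     (\<forall>x\<in>ST n. convolution (coproduct n q) S id x = scale (counit x) 1) \<and>
     (\<forall>x\<in>ST n. convolution (coproduct n q) id S x = scale (counit x) 1)"

definition antipode ::
    "nat \<Rightarrow> (nat \<Rightarrow> nat \<Rightarrow> 'k::field_char_0) \<Rightarrow> (cforest \<Rightarrow>\<^sub>0 'k) \<Rightarrow> (cforest \<Rightarrow>\<^sub>0 'k)" where
  "antipode n q = (THE S. is_antipode n q S)"

end

theory Submission
  imports Defs "HOL-Library.Disjoint_Sets"
begin

text \<open>A forest poset is governed by its order and by the colours \<open>c(w, v)\<close> of the first edges on the
  upward paths from \<open>w\<close> to \<open>v\<close>; both restrict to subforests. In these terms \<open>q(s, t)\<close> is a product over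
  the comparable pairs \<open>w < v\<close>, with factor \<open>q\<^sub>1\<close> at \<open>c(w, v)\<close> if only \<open>v\<close> lies in \<open>s\<close> and \<open>q\<^sub>2\<close> at
  \<open>c(w, v)\<close> if only \<open>w\<close> lies in \<open>s\<close>. Hence the sum in (i) is multiplicative over disjoint unions, and on a
  tree the pairs containing the root contribute exactly the powers in the recursion for the coproduct;
  the two sums of the recursion correspond to the subforests avoiding and containing the root.
  For (ii), the sums over ordered partitions form a right convolution inverse of the identity, by
  splitting off the first block. The weights satisfy a cocycle identity, so convolution over
  the subsets of a fixed forest is associative, and the right inverse is the unique two-sided one.\<close>

section \<open>First edges of upward paths\<close>

text \<open>The algebra knows a forest only as a multiset of isomorphism classes, while both
  formulas sum over subsets of one vertex set. Every sum is therefore formed on a representing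
  poset, and two facts carry it over to classes: isomorphic forest posets have the same class, and
  equal classes give an isomorphism. Edges of a subforest need not be edges of the forest, which is
  why colours are compared on all comparable pairs. Different subsets may give the same pair of
  subforests, and their coefficients may cancel. The supports over which
  \<open>coproduct_step\<close> sums thus do not correspond to subsets, and the Sweedler sums have
  to be re-indexed. \<open>coproduct\<close> and \<open>antipode\<close> are definite descriptions,
  so each needs existence and uniqueness. For the coproduct one identity serves both: the recursion,
  fed with the subforest sums of the branches, returns the subforest sum of the tree. For the
  antipode no tensor cube is formed; all convolutions live on the subsets of one poset. That the
  right inverse is also a left inverse follows there by induction on the size of the subset.\<close>

definition first_colour :: "cposet \<Rightarrow> nat \<Rightarrow> nat \<Rightarrow> nat" where
  "first_colour P v w = colour P v (THE x. edge P v x \<and> (x, w) \<in> ord P)"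

text \<open>\<open>induced\<close> colours by exactly the expression \<open>first_colour\<close>, so
  \<open>colour_induced\<close> equates functions, also on pairs that are no edges.\<close>

lemma verts_induced [simp]: "verts (induced P s) = s"
  and ord_induced: "ord (induced P s) = ord P \<inter> s \<times> s"
  and colour_induced: "colour (induced P s) = first_colour P"
  by (simp_all add: induced_def first_colour_def fun_eq_iff)

lemma lt_induced: "lt (induced P s) x y \<longleftrightarrow> lt P x y \<and> x \<in> s \<and> y \<in> s"
  by (auto simp: lt_def ord_induced)

lemma lt_verts: "is_forest P \<Longrightarrow> lt P x y \<Longrightarrow> x \<in> verts P \<and> y \<in> verts P"
  using forest_ordD(1) lt_def by blast

lemma finite_verts: "is_forest P \<Longrightarrow> finite (verts P)"
  by (simp add: is_forest_def)

lemma lt_trans: "is_forest P \<Longrightarrow> lt P x y \<Longrightarrow> lt P y z \<Longrightarrow> lt P x z"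
  unfolding lt_def using forest_ordD(3,4) by blast

lemma lt_le_trans: "is_forest P \<Longrightarrow> lt P x y \<Longrightarrow> (y, z) \<in> ord P \<Longrightarrow> lt P x z"
  unfolding lt_def using forest_ordD(3,4) by blast

text \<open>Vertices below \<open>w\<close> form a chain, so \<open>x\<close> and \<open>y\<close>
  are comparable; if distinct, the lower one would lie strictly between \<open>v\<close> and the
  upper one.\<close>

lemma first_edge_unique:
  assumes "is_forest P" "edge P v x" "(x, w) \<in> ord P" "edge P v y" "(y, w) \<in> ord P"
  shows "x = y"
  using forest_ordD(5)[OF assms(1,3,5)] assms(2,4) unfolding edge_def lt_def by blast

text \<open>If \<open>v < w\<close> is no edge, a vertex \<open>y\<close> strictly between them has
  fewer vertices between itself and \<open>v\<close>, and the first edge towards \<open>y\<close>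
  also leads towards \<open>w\<close>.\<close>

lemma first_edge_exists:
  assumes P: "is_forest P" and "lt P v w"
  shows "\<exists>x. edge P v x \<and> (x, w) \<in> ord P"
  using assms(2)
proof (induction "card {x. lt P v x \<and> lt P x w}" arbitrary: w rule: less_induct)
  case less
  show ?case
  proof (cases "edge P v w")
    case True
    then show ?thesis using forest_ordD(2)[OF P] lt_verts[OF P less.prems] by blast
  next
    case False
    then obtain y where y: "lt P v y" "lt P y w" using less.prems unfolding edge_def by blast
    have "finite {x. lt P v x \<and> lt P x w}"
      by (rule finite_subset[OF _ finite_verts[OF P]]) (use lt_verts[OF P] in blast)
    moreover have "{x. lt P v x \<and> lt P x y} \<subset> {x. lt P v x \<and> lt P x w}"
    proof
      show "{x. lt P v x \<and> lt P x y} \<subseteq> {x. lt P v x \<and> lt P x w}"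
        using lt_trans[OF P _ y(2)] by blast
      show "{x. lt P v x \<and> lt P x y} \<noteq> {x. lt P v x \<and> lt P x w}"
        using y lt_def by blast
    qed
    ultimately have "card {x. lt P v x \<and> lt P x y} < card {x. lt P v x \<and> lt P x w}"
      by (rule psubset_card_mono)
    then obtain x where "edge P v x" "(x, y) \<in> ord P" using less.hyps y(1) by blast
    then show ?thesis using y(2) forest_ordD(3)[OF P] unfolding lt_def by blast
  qed
qed

lemma first_colour_eq:
  assumes P: "is_forest P" and "edge P v x" "(x, w) \<in> ord P"
  shows "first_colour P v w = colour P v x"
proof -
  have "(THE y. edge P v y \<and> (y, w) \<in> ord P) = x"
    by (rule the_equality) (use assms first_edge_unique[OF P] in blast)+
  then show ?thesis by (simp add: first_colour_def)
qed

lemma first_colour_edge: "is_forest P \<Longrightarrow> edge P v w \<Longrightarrow> first_colour P v w = colour P v w"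
  by (simp add: first_colour_def edge_cover_unique)

text \<open>Extending a path at its upper end leaves its first edge unchanged. Both the restriction
  of colours to subforests and the separation of branches rest on this.\<close>

lemma first_colour_mono:
  assumes P: "is_forest P" and "lt P v x" "(x, w) \<in> ord P"
  shows "first_colour P v w = first_colour P v x"
proof -
  obtain y where y: "edge P v y" "(y, x) \<in> ord P" using first_edge_exists[OF P assms(2)] by blast
  then have "(y, w) \<in> ord P" using forest_ordD(3)[OF P] assms(3) by blast
  then show ?thesis using y first_colour_eq[OF P] by metis
qed

text \<open>The first edge \<open>v < x\<close> in the subforest is coloured by the first edge
  towards \<open>x\<close> in \<open>P\<close>, which is also the first edge towards
  \<open>w\<close>.\<close>

lemma first_colour_induced:
  assumes P: "is_forest P" and s: "s \<subseteq> verts P" and vw: "lt (induced P s) v w"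
  shows "first_colour (induced P s) v w = first_colour P v w"
proof -
  note F = is_forest_induced[OF P s]
  obtain x where x: "edge (induced P s) v x" "(x, w) \<in> ord (induced P s)"
    using first_edge_exists[OF F vw] by blast
  have "first_colour (induced P s) v w = first_colour P v x"
    using first_colour_eq[OF F x] by (simp add: colour_induced)
  also have "\<dots> = first_colour P v w"
    using first_colour_mono[OF P, of v x w] x by (auto simp: edge_def lt_induced ord_induced)
  finally show ?thesis .
qed

text \<open>On comparable pairs, unlike on edges, the colour condition passes directly to
  subforests.\<close>

lemma n_coloured_iff_first_colour:
  assumes P: "is_forest P"
  shows "n_coloured n P \<longleftrightarrow> (\<forall>v w. lt P v w \<longrightarrow> first_colour P v w \<in> {1..n})"
proof
  assume n: "n_coloured n P"
  show "\<forall>v w. lt P v w \<longrightarrow> first_colour P v w \<in> {1..n}"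
  proof (intro allI impI)
    fix v w assume "lt P v w"
    then obtain x where x: "edge P v x" "(x, w) \<in> ord P" using first_edge_exists[OF P] by blast
    then show "first_colour P v w \<in> {1..n}"
      using n first_colour_eq[OF P x] unfolding n_coloured_def by auto
  qed
next
  assume "\<forall>v w. lt P v w \<longrightarrow> first_colour P v w \<in> {1..n}"
  then show "n_coloured n P"
    unfolding n_coloured_def using first_colour_edge[OF P] by (metis edge_def)
qed

lemma n_coloured_induced:
  assumes "is_forest P" "n_coloured n P" "s \<subseteq> verts P"
  shows "n_coloured n (induced P s)"
  using assms(2) first_colour_induced[OF assms(1,3)]
  by (auto simp: n_coloured_iff_first_colour[OF assms(1)] lt_induced
      n_coloured_iff_first_colour[OF is_forest_induced[OF assms(1,3)]])

text \<open>Isomorphisms can be checked on first colours of comparable pairs, the form in which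
  colours restrict and glue.\<close>

lemma iso_viaI:
  assumes P: "is_forest P" and Q: "is_forest Q" and b: "bij_betw \<phi> (verts P) (verts Q)"
    and o: "\<And>x y. x \<in> verts P \<Longrightarrow> y \<in> verts P \<Longrightarrow> (x, y) \<in> ord P \<longleftrightarrow> (\<phi> x, \<phi> y) \<in> ord Q"
    and c: "\<And>x y. lt P x y \<Longrightarrow> first_colour P x y = first_colour Q (\<phi> x) (\<phi> y)"
  shows "iso_via \<phi> P Q"
proof -
  \<comment> \<open>\<open>iso_via_edge\<close> presupposes matching colours. Since
    \<open>edge\<close> ignores colours, it is applied to copies with constant colour, for which
    \<phi> already is an isomorphism.\<close>
  define P' Q' where "P' = CPoset (verts P) (ord P) (\<lambda>_ _. 0)"
    and "Q' = CPoset (verts Q) (ord Q) (\<lambda>_ _. 0)"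
  have l: "lt P' = lt P" "lt Q' = lt Q" unfolding lt_def P'_def Q'_def by (simp_all add: fun_eq_iff)
  have e: "edge P' = edge P" "edge Q' = edge Q" unfolding edge_def l by (simp_all add: fun_eq_iff)
  have F: "is_forest P'" "is_forest Q'"
    using P Q unfolding is_forest_def l unfolding P'_def Q'_def cposet.sel by blast+
  have "iso_via \<phi> P' Q'" using b o unfolding iso_via_def by (simp add: P'_def Q'_def)
  then have "edge Q (\<phi> x) (\<phi> y) \<longleftrightarrow> edge P x y" if "x \<in> verts P" "y \<in> verts P" for x y
    using iso_via_edge[OF F, of \<phi> x y] that e by (simp add: P'_def)
  then have "colour P x y = colour Q (\<phi> x) (\<phi> y)"
    if "x \<in> verts P" "y \<in> verts P" "edge P x y" for x y
    using that c[of x y] first_colour_edge[OF P that(3)] first_colour_edge[OF Q, of "\<phi> x" "\<phi> y"]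
    unfolding edge_def by auto
  then show ?thesis unfolding iso_via_def using b o by blast
qed

lemma iso_viaD:
  assumes P: "is_forest P" and Q: "is_forest Q" and i: "iso_via \<phi> P Q"
  shows "bij_betw \<phi> (verts P) (verts Q)"
    and "x \<in> verts P \<Longrightarrow> y \<in> verts P \<Longrightarrow> (x, y) \<in> ord P \<longleftrightarrow> (\<phi> x, \<phi> y) \<in> ord Q"
    and "x \<in> verts P \<Longrightarrow> y \<in> verts P \<Longrightarrow> lt P x y \<longleftrightarrow> lt Q (\<phi> x) (\<phi> y)"
    and "lt P x y \<Longrightarrow> first_colour P x y = first_colour Q (\<phi> x) (\<phi> y)"
proof -
  show b: "bij_betw \<phi> (verts P) (verts Q)" using i unfolding iso_via_def by simp
  show o: "x \<in> verts P \<Longrightarrow> y \<in> verts P \<Longrightarrow> (x, y) \<in> ord P \<longleftrightarrow> (\<phi> x, \<phi> y) \<in> ord Q" for x y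
    using i unfolding iso_via_def by simp
  show "x \<in> verts P \<Longrightarrow> y \<in> verts P \<Longrightarrow> lt P x y \<longleftrightarrow> lt Q (\<phi> x) (\<phi> y)"
    using o b unfolding lt_def by (metis bij_betw_def inj_on_eq_iff)
  assume "lt P x y"
  then obtain z where z: "edge P x z" "(z, y) \<in> ord P" using first_edge_exists[OF P] by blast
  then have V: "x \<in> verts P" "y \<in> verts P" "z \<in> verts P"
    using forest_ordD(1)[OF P] edgeD(1) by blast+
  have "edge Q (\<phi> x) (\<phi> z)" "(\<phi> z, \<phi> y) \<in> ord Q"
    using iso_via_edge[OF P Q i] z V o by auto
  then have "first_colour Q (\<phi> x) (\<phi> y) = colour Q (\<phi> x) (\<phi> z)" by (rule first_colour_eq[OF Q])
  also have "\<dots> = colour P x z" using i V z unfolding iso_via_def by auto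
  finally show "first_colour P x y = first_colour Q (\<phi> x) (\<phi> y)" using first_colour_eq[OF P z] by simp
qed

lemma iso_n_coloured:
  assumes "is_forest P" "is_forest Q" "iso P Q" "n_coloured n Q"
  shows "n_coloured n P"
proof -
  obtain \<phi> where i: "iso_via \<phi> P Q" using assms(3) unfolding iso_def by auto
  note D = iso_viaD(3,4)[OF assms(1,2) i]
  show ?thesis
    unfolding n_coloured_iff_first_colour[OF assms(1)]
  proof (intro allI impI)
    fix v w assume vw: "lt P v w"
    then have "lt Q (\<phi> v) (\<phi> w)" using D(1) lt_verts[OF assms(1) vw] by simp
    then show "first_colour P v w \<in> {1..n}"
      using assms(4) D(2)[OF vw] n_coloured_iff_first_colour[OF assms(2)] by auto
  qed
qed

lemma iso_via_induced:
  assumes P: "is_forest P" and Q: "is_forest Q" and i: "iso_via \<phi> P Q" and s: "s \<subseteq> verts P"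
  shows "iso_via \<phi> (induced P s) (induced Q (\<phi> ` s))"
proof -
  note D = iso_viaD[OF P Q i]
  have s': "\<phi> ` s \<subseteq> verts Q" using D(1) s unfolding bij_betw_def by blast
  have inj: "inj_on \<phi> s" using D(1) s unfolding bij_betw_def by (blast intro: inj_on_subset)
  show ?thesis
  proof (rule iso_viaI[OF is_forest_induced[OF P s] is_forest_induced[OF Q s']])
    show "bij_betw \<phi> (verts (induced P s)) (verts (induced Q (\<phi> ` s)))"
      using inj by (simp add: bij_betw_def)
    show "(x, y) \<in> ord (induced P s) \<longleftrightarrow> (\<phi> x, \<phi> y) \<in> ord (induced Q (\<phi> ` s))"
      if "x \<in> verts (induced P s)" "y \<in> verts (induced P s)" for x y
      using that D(2) s by (auto simp: ord_induced)
    fix x y assume xy: "lt (induced P s) x y"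
    then have "lt (induced Q (\<phi> ` s)) (\<phi> x) (\<phi> y)" using D(3) s by (auto simp: lt_induced)
    then show "first_colour (induced P s) x y = first_colour (induced Q (\<phi> ` s)) (\<phi> x) (\<phi> y)"
      using xy D(4) first_colour_induced[OF P s] first_colour_induced[OF Q s'] by (simp add: lt_induced)
  qed
qed

text \<open>Only an isomorphism is claimed: the colour functions agree on comparable pairs of
  \<open>t\<close> but may differ on other pairs.\<close>

lemma iso_induced_induced:
  assumes P: "is_forest P" and s: "s \<subseteq> verts P" and t: "t \<subseteq> s"
  shows "iso (induced (induced P s) t) (induced P t)"
proof -
  have t': "t \<subseteq> verts P" using s t by blast
  note F = is_forest_induced[OF P s]
  have F': "is_forest (induced (induced P s) t)" using is_forest_induced[OF F] t by simp
  have "iso_via id (induced (induced P s) t) (induced P t)"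
  proof (rule iso_viaI[OF F' is_forest_induced[OF P t']])
    fix x y assume xy: "lt (induced (induced P s) t) x y"
    then have "lt (induced P s) x y" "lt (induced P t) x y" by (auto simp: lt_induced)
    then show "first_colour (induced (induced P s) t) x y = first_colour (induced P t) (id x) (id y)"
      using first_colour_induced[OF F _ xy] t first_colour_induced[OF P] s t' by simp
  qed (use t in \<open>auto simp: ord_induced\<close>)
  then show ?thesis unfolding iso_def by blast
qed

lemma iso_induced_verts:
  assumes P: "is_forest P" shows "iso (induced P (verts P)) P"
proof -
  have "iso_via id (induced P (verts P)) P"
  proof (rule iso_viaI[OF is_forest_induced[OF P order_refl] P])
    show "(x, y) \<in> ord (induced P (verts P)) \<longleftrightarrow> (id x, id y) \<in> ord P" for x y
      using forest_ordD(1)[OF P] by (auto simp: ord_induced)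
  qed (simp_all add: first_colour_induced[OF P])
  then show ?thesis unfolding iso_def by blast
qed

section \<open>Isomorphism classes of forest posets\<close>

text \<open>Isomorphisms of blocks glue when order and colour between different blocks depend only
  on the block indices, through the same \<open>R\<close> and \<open>K\<close> on both sides. It is
  used for components, where \<open>R\<close> is always false, and for a root with its
  branches.\<close>

lemma iso_glue:
  assumes P: "is_forest P" and Q: "is_forest Q"
    and A: "verts P = (\<Union>i\<in>I. A i)" "disjoint_family_on A I"
    and B: "verts Q = (\<Union>i\<in>I. B i)" "disjoint_family_on B I"
    and iso: "\<And>i. i \<in> I \<Longrightarrow> iso (induced P (A i)) (induced Q (B i))"
    and RP: "\<And>i j x y. \<lbrakk>i \<in> I; j \<in> I; i \<noteq> j; x \<in> A i; y \<in> A j\<rbrakk> \<Longrightarrow>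
      ((x, y) \<in> ord P \<longleftrightarrow> R i j) \<and> (R i j \<longrightarrow> first_colour P x y = K i j)"
    and RQ: "\<And>i j x y. \<lbrakk>i \<in> I; j \<in> I; i \<noteq> j; x \<in> B i; y \<in> B j\<rbrakk> \<Longrightarrow>
      ((x, y) \<in> ord Q \<longleftrightarrow> R i j) \<and> (R i j \<longrightarrow> first_colour Q x y = K i j)"
  shows "iso P Q"
proof -
  have subA: "A i \<subseteq> verts P" and subB: "B i \<subseteq> verts Q" if "i \<in> I" for i
    using that A B by auto
  obtain f where f: "\<And>i. i \<in> I \<Longrightarrow> iso_via (f i) (induced P (A i)) (induced Q (B i))"
    using iso unfolding iso_def by metis
  have FA: "is_forest (induced P (A i))" and FB: "is_forest (induced Q (B i))" if "i \<in> I" for i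
    using is_forest_induced P Q subA subB that by blast+
  note D = iso_viaD[OF FA FB f]
  define h where "h x = f (THE i. i \<in> I \<and> x \<in> A i) x" for x
  have h: "h x = f i x" if "i \<in> I" "x \<in> A i" for i x
  proof -
    have "(THE i. i \<in> I \<and> x \<in> A i) = i"
      by (rule the_equality) (use that A(2) in \<open>auto simp: disjoint_family_on_def\<close>)
    then show ?thesis by (simp add: h_def)
  qed
  have bij: "bij_betw (f i) (A i) (B i)" if "i \<in> I" for i using D(1)[OF that that that] by simp
  have hB: "h x \<in> B i" if "i \<in> I" "x \<in> A i" for i x
    using bij[OF that(1)] h[OF that] that(2) by (auto dest: bij_betwE)
  have idx: "\<exists>i\<in>I. x \<in> A i" if "x \<in> verts P" for x using that A by auto
  have "iso_via h P Q"
  proof (rule iso_viaI[OF P Q])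
    have "inj_on h (verts P)"
    proof (rule inj_onI)
      fix x y assume xy: "x \<in> verts P" "y \<in> verts P" "h x = h y"
      obtain i j where ij: "i \<in> I" "x \<in> A i" "j \<in> I" "y \<in> A j" using idx xy by meson
      have "i = j" using hB[OF ij(1,2)] hB[OF ij(3,4)] xy(3) B(2) ij
        unfolding disjoint_family_on_def by auto
      then show "x = y"
        using bij[OF ij(1)] ij xy(3) h[OF ij(1,2)] h[OF ij(3,4)] by (auto simp: bij_betw_def inj_on_def)
    qed
    moreover have "h ` verts P = verts Q"
    proof -
      have "h ` A i = B i" if "i \<in> I" for i
        using bij[OF that] h[OF that] by (simp add: bij_betw_def)
      then show ?thesis unfolding A(1) B(1) image_UN by simp
    qed
    ultimately show "bij_betw h (verts P) (verts Q)" by (simp add: bij_betw_def)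
  next
    fix x y assume xy: "x \<in> verts P" "y \<in> verts P"
    obtain i j where ij: "i \<in> I" "x \<in> A i" "j \<in> I" "y \<in> A j" using idx xy by meson
    show "(x, y) \<in> ord P \<longleftrightarrow> (h x, h y) \<in> ord Q"
    proof (cases "i = j")
      case True
      then show ?thesis
        using D(2)[OF ij(1) ij(1) ij(1), of x y] ij h[OF ij(1,2)] h[OF ij(3,4)] hB[OF ij(1,2)] hB[OF ij(3,4)]
        by (simp add: ord_induced)
    next
      case False
      then show ?thesis using RP[OF ij(1,3) False ij(2,4)] RQ[OF ij(1,3) False hB[OF ij(1,2)] hB[OF ij(3,4)]]
        by simp
    qed
  next
    fix x y assume xy: "lt P x y"
    obtain i j where ij: "i \<in> I" "x \<in> A i" "j \<in> I" "y \<in> A j" using idx lt_verts[OF P xy] by meson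
    show "first_colour P x y = first_colour Q (h x) (h y)"
    proof (cases "i = j")
      case True
      have l: "lt (induced P (A i)) x y" using xy ij True by (simp add: lt_induced)
      then have l': "lt (induced Q (B i)) (h x) (h y)"
        using D(3)[OF ij(1) ij(1) ij(1), of x y] ij h[OF ij(1,2)] h[OF ij(3,4)] True by simp
      show ?thesis
        using D(4)[OF ij(1) ij(1) ij(1) l] first_colour_induced[OF P subA[OF ij(1)] l]
          first_colour_induced[OF Q subB[OF ij(1)] l'] h[OF ij(1,2)] h[OF ij(3,4)] True by simp
    next
      case False
      then show ?thesis using xy RP[OF ij(1,3) False ij(2,4)] RQ[OF ij(1,3) False hB[OF ij(1,2)] hB[OF ij(3,4)]]
        by (simp add: lt_def)
    qed
  qed
  then show ?thesis unfolding iso_def by blast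
qed

lemma abs_ctree_eq_iff:
  assumes "is_tree P" "is_tree Q"
  shows "abs_ctree P = abs_ctree Q \<longleftrightarrow> iso P Q"
  using Quotient3_rel[OF Quotient3_ctree, of P Q] assms iso_refl by auto

lemma is_tree_is_forest: "is_tree P \<Longrightarrow> is_forest P"
  by (simp add: is_tree_def)

lemma iso_is_tree:
  assumes "is_tree P" "is_forest Q" "iso P Q"
  shows "is_tree Q"
proof -
  obtain \<phi> where i: "iso_via \<phi> P Q" using assms(3) unfolding iso_def by auto
  note D = iso_viaD[OF is_tree_is_forest[OF assms(1)] assms(2) i]
  obtain r where r: "r \<in> verts P" "\<And>v. v \<in> verts P \<Longrightarrow> (r, v) \<in> ord P"
    using assms(1) unfolding is_tree_def by auto
  have "\<phi> r \<in> verts Q" using D(1) r(1) by (auto dest: bij_betwE)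
  moreover have "(\<phi> r, v) \<in> ord Q" if "v \<in> verts Q" for v
  proof -
    obtain u where "u \<in> verts P" "v = \<phi> u" using D(1) \<open>v \<in> verts Q\<close> unfolding bij_betw_def by auto
    then show ?thesis using D(2) r by simp
  qed
  ultimately show ?thesis using assms(2) unfolding is_tree_def by blast
qed

lemma component_closed:
  assumes P: "is_forest P" and C: "C \<in> verts P // connected_rel P"
    and "x \<in> C" "(x, y) \<in> ord P \<or> (y, x) \<in> ord P"
  shows "y \<in> C"
proof -
  have "(x, y) \<in> connected_rel P"
    unfolding connected_rel_iff[OF P] using assms(4) forest_ordD(1,2)[OF P] by blast
  then show ?thesis using assms(3) C equiv_connected_rel[OF P] in_quotient_imp_closed by fastforce
qed

lemma component_subset:
  "is_forest P \<Longrightarrow> C \<in> verts P // connected_rel P \<Longrightarrow> C \<subseteq> verts P"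
  using equiv_connected_rel in_quotient_imp_subset by blast

lemma Union_components:
  "is_forest P \<Longrightarrow> \<Union>(verts P // connected_rel P) = verts P"
  using equiv_connected_rel Union_quotient by blast

lemma disjoint_components:
  "is_forest P \<Longrightarrow> disjoint_family_on id (verts P // connected_rel P)"
  unfolding disjoint_family_on_def using equiv_connected_rel quotient_disj by fastforce

lemma finite_components:
  "is_forest P \<Longrightarrow> finite (verts P // connected_rel P)"
  using finite_verts finite_quotient equiv_connected_rel unfolding equiv_def by blast

text \<open>An isomorphism maps components bijectively onto components and restricts to an
  isomorphism on each of them.\<close>

lemma iso_forest_of:
  assumes P: "is_forest P" and Q: "is_forest Q" and "iso P Q"
  shows "forest_of P = forest_of Q"
proof -
  obtain \<phi> where i: "iso_via \<phi> P Q" using assms(3) unfolding iso_def by auto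
  note D = iso_viaD[OF P Q i]
  have c: "connected_rel Q `` {\<phi> v} = \<phi> ` (connected_rel P `` {v})" if v: "v \<in> verts P" for v
  proof -
    have "(\<phi> v, w) \<in> connected_rel Q \<longleftrightarrow> (\<exists>u\<in>verts P. w = \<phi> u \<and> (v, u) \<in> connected_rel P)" for w
    proof
      assume "(\<phi> v, w) \<in> connected_rel Q"
      then obtain u where u: "(u, \<phi> v) \<in> ord Q" "(u, w) \<in> ord Q" using connected_rel_iff[OF Q] by auto
      then have "u \<in> verts Q" "w \<in> verts Q" using forest_ordD(1)[OF Q] by auto
      then obtain u' w' where "u' \<in> verts P" "u = \<phi> u'" "w' \<in> verts P" "w = \<phi> w'"
        using D(1) unfolding bij_betw_def by blast
      then show "\<exists>u\<in>verts P. w = \<phi> u \<and> (v, u) \<in> connected_rel P"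
        using u v D(2) connected_rel_iff[OF P] by blast
    next
      assume "\<exists>u\<in>verts P. w = \<phi> u \<and> (v, u) \<in> connected_rel P"
      then obtain u z where "u \<in> verts P" "w = \<phi> u" "(z, v) \<in> ord P" "(z, u) \<in> ord P"
        using connected_rel_iff[OF P] by auto
      then show "(\<phi> v, w) \<in> connected_rel Q"
        using D(2) v connected_rel_iff[OF Q] forest_ordD(1)[OF P] by blast
    qed
    moreover have "u \<in> verts P" if "(v, u) \<in> connected_rel P" for u
      using that connected_rel_iff[OF P] forest_ordD(1)[OF P] by blast
    ultimately show ?thesis by auto
  qed
  have Vq: "verts Q = \<phi> ` verts P" using D(1) by (simp add: bij_betw_def)
  have comps: "verts Q // connected_rel Q = (`) \<phi> ` (verts P // connected_rel P)"
    unfolding Vq quotient_def using c by auto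
  have inj: "inj_on ((`) \<phi>) (verts P // connected_rel P)"
  proof (rule inj_onI)
    fix X Y assume XY: "X \<in> verts P // connected_rel P" "Y \<in> verts P // connected_rel P" "\<phi> ` X = \<phi> ` Y"
    then show "X = Y"
      using D(1) component_subset[OF P] by (metis bij_betw_def inj_on_image_eq_iff)
  qed
  have "abs_ctree (induced P C) = abs_ctree (induced Q (\<phi> ` C))" if C: "C \<in> verts P // connected_rel P" for C
  proof -
    have "\<phi> ` C \<in> verts Q // connected_rel Q" using C comps by blast
    then show ?thesis
      using abs_ctree_eq_iff component_tree(1)[OF P C] component_tree(1)[OF Q]
        iso_via_induced[OF P Q i component_subset[OF P C]] unfolding iso_def by blast
  qed
  then show ?thesis
    unfolding forest_of_def comps image_mset_mset_set[OF inj, symmetric]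
    by (auto simp: multiset.map_comp comp_def finite_components[OF P] intro!: image_mset_cong)
qed

text \<open>Equal multisets of values allow each index to be matched with one of the same value;
  removing one matched pair at a time builds the bijection.\<close>

lemma image_mset_set_eq_bij:
  assumes "finite X" "finite Y" "image_mset f (mset_set X) = image_mset g (mset_set Y)"
  shows "\<exists>h. bij_betw h X Y \<and> (\<forall>x\<in>X. g (h x) = f x)"
  using assms
proof (induction X arbitrary: Y rule: finite_induct)
  case empty
  then have "Y = {}" by (metis image_mset_is_empty_iff mset_set_empty_iff mset_set.empty)
  then show ?case by (simp add: bij_betw_def)
next
  case (insert x X)
  have "f x \<in># image_mset g (mset_set Y)" using insert by (metis finite_insert finite_set_mset_mset_set
        imageI insertI1 set_image_mset)
  then obtain y where y: "y \<in> Y" "g y = f x" using insert.prems(1) by auto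
  have "mset_set Y = add_mset y (mset_set (Y - {y}))" using y insert.prems(1) by (simp add: mset_set.remove)
  then have "image_mset f (mset_set X) = image_mset g (mset_set (Y - {y}))"
    using insert y by simp
  then obtain h where h: "bij_betw h X (Y - {y})" "\<forall>x\<in>X. g (h x) = f x"
    using insert.IH[of "Y - {y}"] insert.prems(1) by auto
  have "bij_betw (h(x := y)) X (Y - {y})"
    using h(1) insert.hyps(2) by (subst bij_betw_cong[of _ _ h]) auto
  then have "bij_betw (h(x := y)) (insert x X) (insert y (Y - {y}))"
    unfolding bij_betw_def by (auto simp: inj_on_insert)
  then have "bij_betw (h(x := y)) (insert x X) Y" using y(1) by (simp add: insert_absorb)
  moreover have "\<forall>z\<in>insert x X. g ((h(x := y)) z) = f z" using h(2) y(2) insert.hyps(2) by auto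
  ultimately show ?case by blast
qed

text \<open>The multiset equality matches components with isomorphic ones, and these isomorphisms
  glue because distinct components are incomparable. With \<open>iso_forest_of\<close>, forests are
  isomorphism classes of forest posets.\<close>

lemma forest_of_eq_iso:
  assumes P: "is_forest P" and Q: "is_forest Q" and eq: "forest_of P = forest_of Q"
  shows "iso P Q"
proof -
  obtain h where h: "bij_betw h (verts P // connected_rel P) (verts Q // connected_rel Q)"
    and e: "\<And>C. C \<in> verts P // connected_rel P \<Longrightarrow> abs_ctree (induced Q (h C)) = abs_ctree (induced P C)"
    using image_mset_set_eq_bij[OF finite_components[OF P] finite_components[OF Q] eq[unfolded forest_of_def]]
    by auto
  have hC: "h C \<in> verts Q // connected_rel Q" if "C \<in> verts P // connected_rel P" for C
    using h that by (auto dest: bij_betwE)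
  show ?thesis
  proof (rule iso_glue[OF P Q, of id "verts P // connected_rel P" h "\<lambda>_ _. False"])
    show "verts P = (\<Union>i\<in>verts P // connected_rel P. id i)" using Union_components[OF P] by simp
    show "verts Q = (\<Union>i\<in>verts P // connected_rel P. h i)"
      using Union_components[OF Q] h by (metis bij_betw_def)
    show "disjoint_family_on id (verts P // connected_rel P)" by (rule disjoint_components[OF P])
    show "disjoint_family_on h (verts P // connected_rel P)"
      unfolding disjoint_family_on_def
    proof (intro ballI impI)
      fix C D assume CD: "C \<in> verts P // connected_rel P" "D \<in> verts P // connected_rel P" "C \<noteq> D"
      then have "h C \<noteq> h D" using h unfolding bij_betw_def inj_on_def by blast
      then show "h C \<inter> h D = {}"
        using disjoint_components[OF Q] hC[OF CD(1)] hC[OF CD(2)] unfolding disjoint_family_on_def by simp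
    qed
    show "iso (induced P (id C)) (induced Q (h C))" if C: "C \<in> verts P // connected_rel P" for C
      using iffD1[OF abs_ctree_eq_iff[OF component_tree(1)[OF P C] component_tree(1)[OF Q hC[OF C]]] e[OF C, symmetric]]
      by simp
  next
    fix C D x y assume CD: "C \<in> verts P // connected_rel P" "D \<in> verts P // connected_rel P" "C \<noteq> D"
      "x \<in> id C" "y \<in> id D"
    then have "C \<inter> D = {}" using disjoint_components[OF P] unfolding disjoint_family_on_def by simp
    then show "((x, y) \<in> ord P \<longleftrightarrow> False) \<and> (False \<longrightarrow> first_colour P x y = undefined C D)"
      using component_closed[OF P CD(1), of x y] CD(4,5) by (simp add: disjoint_iff) blast
  next
    fix C D x y assume CD: "C \<in> verts P // connected_rel P" "D \<in> verts P // connected_rel P" "C \<noteq> D"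
      "x \<in> h C" "y \<in> h D"
    then have "h C \<noteq> h D" using h by (auto simp: bij_betw_def inj_on_def)
    then have "h C \<inter> h D = {}"
      using hC CD disjoint_components[OF Q] unfolding disjoint_family_on_def by simp
    then show "((x, y) \<in> ord Q \<longleftrightarrow> False) \<and> (False \<longrightarrow> first_colour Q x y = undefined C D)"
      using component_closed[OF Q hC[OF CD(1)] CD(4)] CD(5) by blast
  qed
qed

lemma image_mset_set_eq_sum: "image_mset f (mset_set X) = (\<Sum>x\<in>X. {#f x#})"
  by (induction X rule: infinite_finite_induct) auto

lemma forest_of_eq_sum: "forest_of P = (\<Sum>C\<in>verts P // connected_rel P. {#abs_ctree (induced P C)#})"
  by (simp add: forest_of_def image_mset_set_eq_sum)

text \<open>Blocks without order relations between them are unions of components, so the set of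
  components splits along the blocks.\<close>

lemma forest_of_separated_UN:
  assumes P: "is_forest P" and fin: "finite I"
    and A: "verts P = (\<Union>i\<in>I. A i)" "disjoint_family_on A I"
    and sep: "\<And>i j x y. \<lbrakk>i \<in> I; j \<in> I; i \<noteq> j; x \<in> A i; y \<in> A j\<rbrakk> \<Longrightarrow> (x, y) \<notin> ord P"
  shows "forest_of P = (\<Sum>i\<in>I. forest_of (induced P (A i)))"
proof -
  define comps where "comps i = A i // connected_rel (induced P (A i))" for i
  have sub: "A i \<subseteq> verts P" if "i \<in> I" for i using that A by auto
  have F: "is_forest (induced P (A i))" if "i \<in> I" for i using is_forest_induced[OF P sub[OF that]] .
  \<comment> \<open>Whatever is comparable to a vertex of \<open>A i\<close> lies in
    \<open>A i\<close>, so connectivity can be computed inside the block.\<close>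
  have mem: "y \<in> A i" if "i \<in> I" "x \<in> A i" "(x, y) \<in> ord P \<or> (y, x) \<in> ord P" for i x y
  proof -
    have "y \<in> verts P" using forest_ordD(1)[OF P] that(3) by blast
    then obtain j where "j \<in> I" "y \<in> A j" using A by auto
    then show ?thesis using sep[of i j x y] sep[of j i y x] that by (cases "i = j") blast+
  qed
  have im: "connected_rel P `` {x} = connected_rel (induced P (A i)) `` {x}" if i: "i \<in> I" "x \<in> A i" for i x
  proof -
    have "(x, y) \<in> connected_rel P \<longleftrightarrow> (x, y) \<in> connected_rel (induced P (A i))" for y
      unfolding connected_rel_iff[OF P] connected_rel_iff[OF F[OF i(1)]] ord_induced
      using mem[OF i(1)] i(2) by blast
    then show ?thesis by auto
  qed
  have U: "verts P // connected_rel P = (\<Union>i\<in>I. comps i)"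
    unfolding comps_def quotient_def A(1) UN_UN_flatten by (intro SUP_cong refl) (simp add: im)
  have ne: "C \<noteq> {}" "C \<subseteq> A i" if "i \<in> I" "C \<in> comps i" for i C
  proof -
    show "C \<noteq> {}" using that equiv_connected_rel[OF F[OF that(1)]] in_quotient_imp_non_empty
      unfolding comps_def by fastforce
    show "C \<subseteq> A i" using component_subset[OF F[OF that(1)]] that(2) unfolding comps_def by simp
  qed
  have "forest_of P = (\<Sum>i\<in>I. \<Sum>C\<in>comps i. {#abs_ctree (induced P C)#})"
    unfolding forest_of_eq_sum U
  proof (rule sum.UNION_disjoint[OF fin])
    show "\<forall>i\<in>I. finite (comps i)" using finite_components[OF F] unfolding comps_def verts_induced by blast
    show "\<forall>i\<in>I. \<forall>j\<in>I. i \<noteq> j \<longrightarrow> comps i \<inter> comps j = {}"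
    proof (intro ballI impI)
      fix i j assume ij: "i \<in> I" "j \<in> I" "i \<noteq> j"
      then have "A i \<inter> A j = {}" using A(2) by (simp add: disjoint_family_on_def)
      then show "comps i \<inter> comps j = {}" using ne[OF ij(1)] ne[OF ij(2)] by blast
    qed
  qed
  also have "\<dots> = (\<Sum>i\<in>I. forest_of (induced P (A i)))"
  proof (rule sum.cong[OF refl])
    fix i assume i: "i \<in> I"
    show "(\<Sum>C\<in>comps i. {#abs_ctree (induced P C)#}) = forest_of (induced P (A i))"
      unfolding forest_of_eq_sum comps_def[symmetric] verts_induced
    proof (rule sum.cong[OF refl])
      fix C assume C: "C \<in> comps i"
      have t1: "is_tree (induced (induced P (A i)) C)"
        using component_tree(1)[OF F[OF i]] C by (simp add: comps_def)
      have t2: "is_tree (induced P C)" using component_tree(1)[OF P] C i U by blast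
      have "abs_ctree (induced (induced P (A i)) C) = abs_ctree (induced P C)"
        unfolding abs_ctree_eq_iff[OF t1 t2] by (rule iso_induced_induced[OF P sub[OF i] ne(2)[OF i C]])
      then show "{#abs_ctree (induced P C)#} = {#abs_ctree (induced (induced P (A i)) C)#}" by simp
    qed
  qed
  finally show ?thesis .
qed

lemma forest_of_tree:
  assumes T: "is_tree P"
  shows "forest_of P = {#abs_ctree P#}"
proof -
  have P: "is_forest P" using T by (rule is_tree_is_forest)
  obtain r where r: "r \<in> verts P" "\<And>v. v \<in> verts P \<Longrightarrow> (r, v) \<in> ord P"
    using T unfolding is_tree_def by auto
  have "connected_rel P `` {v} = verts P" if "v \<in> verts P" for v
    using that r connected_rel_iff[OF P] forest_ordD(1)[OF P] by blast
  then have "verts P // connected_rel P = {verts P}" using r(1) by (auto simp: quotient_def)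
  moreover have "abs_ctree (induced P (verts P)) = abs_ctree P"
    using abs_ctree_eq_iff[OF _ T] iso_induced_verts[OF P] iso_is_tree[OF T is_forest_induced[OF P]]
      iso_sym[OF is_forest_induced[OF P] P] by blast
  ultimately show ?thesis by (simp add: forest_of_eq_sum)
qed

lemma forest_of_induced_induced:
  assumes "is_forest P" "s \<subseteq> verts P" "t \<subseteq> s"
  shows "forest_of (induced (induced P s) t) = forest_of (induced P t)"
proof -
  have "t \<subseteq> verts P" using assms by blast
  then show ?thesis
    using iso_forest_of iso_induced_induced[OF assms] is_forest_induced assms by simp
qed

lemma forest_of_induced_verts: "is_forest P \<Longrightarrow> forest_of (induced P (verts P)) = forest_of P"
  using iso_forest_of is_forest_induced iso_induced_verts by blast

lemma forest_of_empty: "verts P = {} \<Longrightarrow> forest_of P = {#}"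
  by (simp add: forest_of_def quotient_def)

lemma tree_size_abs_ctree:
  assumes "is_tree T" shows "tree_size (abs_ctree T) = card (verts T)"
proof -
  have R: "is_tree (rep_ctree (abs_ctree T))" "iso (rep_ctree (abs_ctree T)) T"
    using Quotient3_rep_abs[OF Quotient3_ctree, of T] assms iso_refl by auto
  then show ?thesis unfolding tree_size_def iso_def iso_via_def using bij_betw_same_card by blast
qed

lemma forest_size_forest_of:
  assumes P: "is_forest P" shows "forest_size (forest_of P) = card (verts P)"
proof -
  have "forest_size (forest_of P) = (\<Sum>C\<in>verts P // connected_rel P. card C)"
    unfolding forest_size_def forest_of_def
    by (simp add: multiset.map_comp comp_def sum_unfold_sum_mset[symmetric]
        tree_size_abs_ctree[OF component_tree(1)[OF P]] cong: sum.cong)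
  also have "\<dots> = card (\<Union>(verts P // connected_rel P))"
  proof (rule card_Union_disjoint[symmetric])
    show "pairwise disjnt (verts P // connected_rel P)"
      using disjoint_components[OF P] by (simp add: pairwise_def disjnt_def disjoint_family_on_def)
    show "finite C" if "C \<in> verts P // connected_rel P" for C
      using finite_subset[OF component_subset[OF P that] finite_verts[OF P]] .
  qed
  finally show ?thesis using Union_components[OF P] by simp
qed

text \<open>Colours are unrestricted here, because \<open>forest_rep\<close> chooses a poset without
  reference to \<open>n\<close>.\<close>

lemma forest_of_surj: "\<exists>P. is_forest P \<and> forest_of P = f"
proof -
  obtain ts where ts: "mset ts = f" using ex_mset by auto
  define T where "T i = rep_ctree (ts ! i)" for i
  have T: "is_tree (T i)" for i using Quotient3_rep_reflp[OF Quotient3_ctree] by (auto simp: T_def)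
  have "map (\<lambda>i. abs_ctree (T i)) [0..<length ts] = ts"
    using Quotient3_abs_rep[OF Quotient3_ctree] by (auto simp: T_def intro: nth_equalityI)
  then show ?thesis using forest_of_disjoint_union[of "length ts" T, OF T] ts by auto
qed

lemma forest_rep: "is_forest (forest_rep f)" "forest_of (forest_rep f) = f"
  using someI_ex[OF forest_of_surj[of f]] unfolding forest_rep_def by auto

lemma forest_of_in_nforests: "P \<in> nforest_posets n \<Longrightarrow> forest_of P \<in> nforests n"
  using forest_of_image by blast

text \<open>The chosen representative is isomorphic to some \<open>n\<close>-coloured one, and
  isomorphisms preserve first colours.\<close>

lemma forest_rep_in_nforest_posets:
  assumes "f \<in> nforests n" shows "forest_rep f \<in> nforest_posets n"
proof -
  have "f \<in> forest_of ` nforest_posets n" using assms by (simp add: forest_of_image)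
  then obtain P where "P \<in> nforest_posets n" and f: "forest_of P = f" by (elim imageE) simp
  then have P: "is_forest P" "n_coloured n P" unfolding nforest_posets_def by auto
  have "iso (forest_rep f) P" using forest_of_eq_iso[OF forest_rep(1) P(1)] forest_rep(2) f by simp
  then show ?thesis using iso_n_coloured[OF forest_rep(1) P(1) _ P(2)] forest_rep(1)
    unfolding nforest_posets_def by simp
qed

section \<open>Trees as grafts of their branches\<close>

definition is_root :: "cposet \<Rightarrow> nat \<Rightarrow> bool" where
  "is_root T r \<longleftrightarrow> r \<in> verts T \<and> (\<forall>v\<in>verts T. (r, v) \<in> ord T)"

text \<open>In a grafted tree with root \<open>r\<close> this is the copy of the \<open>i\<close>-th
  forest: the colour of an edge at the root tells into which forest it leads.\<close>

definition branch :: "cposet \<Rightarrow> nat \<Rightarrow> nat \<Rightarrow> nat set" where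
  "branch T r i = {v \<in> verts T. v \<noteq> r \<and> first_colour T r v = i}"

abbreviation graft_vertex :: "nat \<Rightarrow> nat \<Rightarrow> nat" where
  "graft_vertex i v \<equiv> Suc (prod_encode (i, v))"

lemma is_tree_iff: "is_tree T \<longleftrightarrow> is_forest T \<and> (\<exists>r. is_root T r)"
  by (auto simp: is_tree_def is_root_def)

lemma branch_subset: "branch T r i \<subseteq> verts T"
  by (auto simp: branch_def)

lemma root_lt: "is_root T r \<Longrightarrow> lt T r v \<longleftrightarrow> v \<in> verts T \<and> v \<noteq> r" if "is_forest T"
  using forest_ordD(1)[OF that] by (auto simp: is_root_def lt_def)

lemma disjoint_branches: "disjoint_family_on (branch T r) I"
  by (auto simp: disjoint_family_on_def branch_def)

lemma UN_branches:
  assumes "is_forest T" "n_coloured n T" "is_root T r"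
  shows "(\<Union>i\<in>{1..n}. branch T r i) = verts T - {r}"
proof -
  have "first_colour T r v \<in> {1..n}" if "v \<in> verts T" "v \<noteq> r" for v
    using assms(2) root_lt[OF assms(1,3)] that unfolding n_coloured_iff_first_colour[OF assms(1)] by blast
  then show ?thesis unfolding branch_def by blast
qed

text \<open>Moving upwards from \<open>x\<close> to \<open>y\<close> does not change the first edge
  from the root, hence not the branch index.\<close>

lemma branches_separated:
  assumes T: "is_forest T" and r: "is_root T r" and "x \<in> branch T r i" "y \<in> branch T r j" "i \<noteq> j"
  shows "(x, y) \<notin> ord T"
proof
  assume "(x, y) \<in> ord T"
  moreover have "lt T r x" using assms(3) by (simp add: root_lt[OF T r] branch_def)
  ultimately have "first_colour T r y = first_colour T r x" by (intro first_colour_mono[OF T])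
  then show False using assms(3-5) by (simp add: branch_def)
qed

lemma ord_graft_poset:
  "verts (graft_poset n F) = {0} \<union> {graft_vertex i v | i v. i \<in> {1..n} \<and> v \<in> verts (F i)}"
  "ord (graft_poset n F) =
     {(0, 0)} \<union> {(0, graft_vertex i v) | i v. i \<in> {1..n} \<and> v \<in> verts (F i)} \<union>
     {(graft_vertex i v, graft_vertex i w) | i v w. i \<in> {1..n} \<and> (v, w) \<in> ord (F i)}"
  "colour (graft_poset n F) 0 (graft_vertex i v) = i"
  "colour (graft_poset n F) (graft_vertex i v) (graft_vertex i w) = colour (F i) v w"
  by (simp_all add: graft_poset_def Let_def)

lemma ord_graft_poset_iff:
  "(0, y) \<in> ord (graft_poset n F) \<longleftrightarrow> y \<in> verts (graft_poset n F)"
  "(x, 0) \<in> ord (graft_poset n F) \<longleftrightarrow> x = 0"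
  "(graft_vertex i v, graft_vertex j w) \<in> ord (graft_poset n F) \<longleftrightarrow>
     i = j \<and> i \<in> {1..n} \<and> (v, w) \<in> ord (F i)"
  unfolding ord_graft_poset by auto

lemma verts_graft_poset_cases:
  assumes "x \<in> verts (graft_poset n F)"
  obtains "x = 0" | i v where "x = graft_vertex i v" "i \<in> {1..n}" "v \<in> verts (F i)"
  using assms unfolding ord_graft_poset by blast

lemma verts_graft_poset_iff:
  "0 \<in> verts (graft_poset n F)"
  "graft_vertex i v \<in> verts (graft_poset n F) \<longleftrightarrow> i \<in> {1..n} \<and> v \<in> verts (F i)"
  unfolding ord_graft_poset by auto

lemma ord_graft_poset_cases:
  assumes "(x, y) \<in> ord (graft_poset n F)"
  obtains "x = 0" "y \<in> verts (graft_poset n F)"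
  | i v w where "x = graft_vertex i v" "y = graft_vertex i w" "i \<in> {1..n}" "(v, w) \<in> ord (F i)"
  using assms unfolding ord_graft_poset by blast

lemma is_forest_graft_poset:
  assumes F: "\<And>i. i \<in> {1..n} \<Longrightarrow> is_forest (F i)"
  shows "is_forest (graft_poset n F)"
proof -
  let ?G = "graft_poset n F"
  note D = forest_ordD[OF F]
  show ?thesis
    unfolding is_forest_def partial_order_on_def preorder_on_def
  proof (intro conjI allI impI)
    have "verts ?G = insert 0 (\<Union>i\<in>{1..n}. graft_vertex i ` verts (F i))"
      unfolding ord_graft_poset by auto
    then show "finite (verts ?G)" using finite_verts[OF F] by simp
    show "ord ?G \<subseteq> verts ?G \<times> verts ?G"
    proof clarify
      fix x y assume "(x, y) \<in> ord ?G"
      then show "x \<in> verts ?G \<and> y \<in> verts ?G"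
        by (cases rule: ord_graft_poset_cases) (use D(1) verts_graft_poset_iff in blast)+
    qed
    show "refl_on (verts ?G) (ord ?G)"
    proof (rule refl_onI)
      fix x assume "x \<in> verts ?G"
      then show "(x, x) \<in> ord ?G"
        by (cases rule: verts_graft_poset_cases) (use D(2) in \<open>auto simp: ord_graft_poset_iff verts_graft_poset_iff\<close>)
    qed
    show "trans (ord ?G)"
    proof (rule transI)
      fix x y z assume xy: "(x, y) \<in> ord ?G" and yz: "(y, z) \<in> ord ?G"
      have z: "z \<in> verts ?G" using yz
        by (cases rule: ord_graft_poset_cases) (use D(1) verts_graft_poset_iff in blast)+
      from xy show "(x, z) \<in> ord ?G"
      proof (cases rule: ord_graft_poset_cases)
        case 1
        then show ?thesis using z ord_graft_poset_iff(1) by simp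
      next
        case (2 i v w)
        from yz 2(2) obtain u where u: "z = graft_vertex i u" "(w, u) \<in> ord (F i)"
          by (cases rule: ord_graft_poset_cases) auto
        then have "(v, u) \<in> ord (F i)" using D(3)[OF 2(3,4)] by simp
        then show ?thesis unfolding 2(1) u(1) ord_graft_poset_iff using 2(3) by simp
      qed
    qed
    show "antisym (ord ?G)"
    proof (rule antisymI)
      fix x y assume xy: "(x, y) \<in> ord ?G" and yx: "(y, x) \<in> ord ?G"
      from xy show "x = y"
      proof (cases rule: ord_graft_poset_cases)
        case 1
        then show ?thesis using yx ord_graft_poset_iff(2) by simp
      next
        case (2 i v w)
        then have "(w, v) \<in> ord (F i)" using yx ord_graft_poset_iff(3) by simp
        then show ?thesis using 2 D(4)[OF 2(3)] by simp
      qed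
    qed
    fix x y z assume yz: "y \<noteq> z \<and> lt ?G y x \<and> lt ?G z x"
    then have yx: "(y, x) \<in> ord ?G" and zx: "(z, x) \<in> ord ?G" unfolding lt_def by auto
    have zV: "z \<in> verts ?G" using zx
      by (cases rule: ord_graft_poset_cases) (use D(1) verts_graft_poset_iff in blast)+
    have yV: "y \<in> verts ?G" using yx
      by (cases rule: ord_graft_poset_cases) (use D(1) verts_graft_poset_iff in blast)+
    from yx have "(y, z) \<in> ord ?G \<or> (z, y) \<in> ord ?G"
    proof (cases rule: ord_graft_poset_cases)
      case 1
      then show ?thesis using zV ord_graft_poset_iff(1) by simp
    next
      case (2 i v w)
      from zx 2(2) consider "z = 0" | u where "z = graft_vertex i u" "(u, w) \<in> ord (F i)"
        by (cases rule: ord_graft_poset_cases) auto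
      then show ?thesis
      proof cases
        case 1
        then show ?thesis using yV ord_graft_poset_iff(1) by simp
      next
        case (2 u)
        then show ?thesis using D(5)[OF \<open>i \<in> {1..n}\<close> \<open>(v, w) \<in> ord (F i)\<close>, of u] \<open>y = _\<close> \<open>i \<in> {1..n}\<close>
          by (auto simp: ord_graft_poset_iff)
      qed
    qed
    then show "lt ?G y z \<or> lt ?G z y" using yz unfolding lt_def by auto
  qed
qed

lemma is_root_graft_poset: "is_root (graft_poset n F) 0"
  unfolding is_root_def using ord_graft_poset_iff(1) verts_graft_poset_iff(1) by blast

lemma lt_graft_poset:
  "lt (graft_poset n F) (graft_vertex i v) x \<longleftrightarrow> (\<exists>w. x = graft_vertex i w \<and> i \<in> {1..n} \<and> lt (F i) v w)"
proof
  assume "lt (graft_poset n F) (graft_vertex i v) x"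
  then have "(graft_vertex i v, x) \<in> ord (graft_poset n F)" "graft_vertex i v \<noteq> x" by (simp_all add: lt_def)
  then show "\<exists>w. x = graft_vertex i w \<and> i \<in> {1..n} \<and> lt (F i) v w"
    by (cases rule: ord_graft_poset_cases) (auto simp: lt_def)
qed (auto simp: lt_def ord_graft_poset_iff)

text \<open>The first edge from \<open>0\<close> towards a vertex of \<open>F i\<close> already ends
  in \<open>F i\<close>, since no order relation joins different forests.\<close>

lemma first_colour_graft_poset_root:
  assumes F: "\<And>i. i \<in> {1..n} \<Longrightarrow> is_forest (F i)" and i: "i \<in> {1..n}" "v \<in> verts (F i)"
  shows "first_colour (graft_poset n F) 0 (graft_vertex i v) = i"
proof -
  let ?G = "graft_poset n F"
  have G: "is_forest ?G" by (rule is_forest_graft_poset) (rule F)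
  have "lt ?G 0 (graft_vertex i v)" using i by (simp add: lt_def ord_graft_poset_iff verts_graft_poset_iff)
  then obtain x where x: "edge ?G 0 x" "(x, graft_vertex i v) \<in> ord ?G"
    using first_edge_exists[OF G] by blast
  from x(2) x(1) obtain u where "x = graft_vertex i u"
    by (cases rule: ord_graft_poset_cases) (auto simp: edge_def lt_def)
  then show ?thesis using first_colour_eq[OF G x] ord_graft_poset(3) by simp
qed

lemma first_colour_graft_poset:
  assumes F: "\<And>i. i \<in> {1..n} \<Longrightarrow> is_forest (F i)" and i: "i \<in> {1..n}" "lt (F i) v w"
  shows "first_colour (graft_poset n F) (graft_vertex i v) (graft_vertex i w) = first_colour (F i) v w"
proof -
  let ?G = "graft_poset n F"
  have G: "is_forest ?G" by (rule is_forest_graft_poset) (rule F)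
  obtain u where u: "edge (F i) v u" "(u, w) \<in> ord (F i)" using first_edge_exists[OF F[OF i(1)] i(2)] by blast
  have "edge ?G (graft_vertex i v) (graft_vertex i u)"
    using u(1) i(1) unfolding edge_def lt_graft_poset by (auto simp: lt_graft_poset)
  moreover have "(graft_vertex i u, graft_vertex i w) \<in> ord ?G"
    using u(2) i(1) by (simp add: ord_graft_poset_iff)
  ultimately show ?thesis
    using first_colour_eq[OF G] first_colour_eq[OF F[OF i(1)] u] ord_graft_poset(4) by metis
qed

lemma branch_graft_poset:
  assumes F: "\<And>i. i \<in> {1..n} \<Longrightarrow> is_forest (F i)" and i: "i \<in> {1..n}"
  shows "branch (graft_poset n F) 0 i = graft_vertex i ` verts (F i)"
proof -
  have "x \<in> branch (graft_poset n F) 0 i \<longleftrightarrow> x \<in> graft_vertex i ` verts (F i)" for x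
  proof
    assume x: "x \<in> branch (graft_poset n F) 0 i"
    then have "x \<in> verts (graft_poset n F)" "x \<noteq> 0" by (simp_all add: branch_def)
    then obtain j v where j: "x = graft_vertex j v" "j \<in> {1..n}" "v \<in> verts (F j)"
      by (cases rule: verts_graft_poset_cases) auto
    then have "j = i" using x first_colour_graft_poset_root[of n F, OF F] by (simp add: branch_def)
    then show "x \<in> graft_vertex i ` verts (F i)" using j by simp
  next
    assume "x \<in> graft_vertex i ` verts (F i)"
    then show "x \<in> branch (graft_poset n F) 0 i"
      using first_colour_graft_poset_root[of n F, OF F i] i by (auto simp: branch_def verts_graft_poset_iff)
  qed
  then show ?thesis by blast
qed

lemma iso_branch_graft_poset:
  assumes F: "\<And>i. i \<in> {1..n} \<Longrightarrow> is_forest (F i)" and i: "i \<in> {1..n}"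
  shows "iso (F i) (induced (graft_poset n F) (branch (graft_poset n F) 0 i))"
proof -
  let ?G = "graft_poset n F"
  have G: "is_forest ?G" by (rule is_forest_graft_poset) (rule F)
  have B: "branch ?G 0 i = graft_vertex i ` verts (F i)" by (rule branch_graft_poset) (rule F, assumption, rule i)
  have "iso_via (graft_vertex i) (F i) (induced ?G (branch ?G 0 i))"
  proof (rule iso_viaI[OF F[OF i] is_forest_induced[OF G branch_subset]])
    show "bij_betw (graft_vertex i) (verts (F i)) (verts (induced ?G (branch ?G 0 i)))"
      unfolding verts_induced B by (simp add: bij_betw_def inj_on_def)
    show "(x, y) \<in> ord (F i) \<longleftrightarrow> (graft_vertex i x, graft_vertex i y) \<in> ord (induced ?G (branch ?G 0 i))"
      if "x \<in> verts (F i)" "y \<in> verts (F i)" for x y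
      using that i by (simp add: ord_induced B ord_graft_poset_iff)
    fix x y assume xy: "lt (F i) x y"
    have "lt (induced ?G (branch ?G 0 i)) (graft_vertex i x) (graft_vertex i y)"
      using xy i lt_verts[OF F[OF i] xy] by (simp add: lt_induced B lt_graft_poset)
    then show "first_colour (F i) x y =
        first_colour (induced ?G (branch ?G 0 i)) (graft_vertex i x) (graft_vertex i y)"
      using first_colour_induced[OF G branch_subset] first_colour_graft_poset[of n F, OF F i xy] by simp
  qed
  then show ?thesis unfolding iso_def by blast
qed

lemma n_coloured_graft_poset:
  assumes F: "\<And>i. i \<in> {1..n} \<Longrightarrow> is_forest (F i)" and n: "\<And>i. i \<in> {1..n} \<Longrightarrow> n_coloured n (F i)"
  shows "n_coloured n (graft_poset n F)"
proof -
  let ?G = "graft_poset n F"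
  have G: "is_forest ?G" by (rule is_forest_graft_poset) (rule F)
  show ?thesis
    unfolding n_coloured_iff_first_colour[OF G]
  proof (intro allI impI)
    fix x y assume xy: "lt ?G x y"
    then have "(x, y) \<in> ord ?G" "x \<noteq> y" by (simp_all add: lt_def)
    then show "first_colour ?G x y \<in> {1..n}"
    proof (cases rule: ord_graft_poset_cases)
      case 1
      from 1(2) show ?thesis
      proof (cases rule: verts_graft_poset_cases)
        case 1
        then show ?thesis using \<open>x = 0\<close> \<open>x \<noteq> y\<close> by simp
      next
        case (2 i v)
        then show ?thesis using first_colour_graft_poset_root[of n F, OF F] \<open>x = 0\<close> by simp
      qed
    next
      case (2 i v w)
      then have l: "lt (F i) v w" using xy by (simp add: lt_graft_poset)
      then have "first_colour (F i) v w \<in> {1..n}"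
        using n[OF 2(3)] n_coloured_iff_first_colour[OF F[OF 2(3)]] by blast
      then show ?thesis using first_colour_graft_poset[of n F, OF F 2(3) l] 2 by simp
    qed
  qed
qed

text \<open>Equal classes of branches give isomorphisms of branches, which are glued with that of
  the roots. The families met in the recursion are restricted to \<open>{1..n}\<close> and carry a
  default value elsewhere, so \<open>f\<close> is compared with \<open>T\<close> at these indices
  only.\<close>

lemma tree_eq_graft:
  assumes T: "is_forest T" and n: "n_coloured n T" and r: "is_root T r"
    and f: "\<And>i. i \<in> {1..n} \<Longrightarrow> forest_of (induced T (branch T r i)) = f i"
  shows "abs_ctree T = graft n f"
proof -
  define F where "F i = forest_rep (f i)" for i
  have F: "is_forest (F i)" and fF: "forest_of (F i) = f i" for i by (simp_all add: F_def forest_rep)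
  define G where "G = graft_poset n F"
  have G: "is_forest G" unfolding G_def by (rule is_forest_graft_poset[of n F, OF F])
  have nG: "n_coloured n (F i)" if i: "i \<in> {1..n}" for i
  proof -
    have I: "is_forest (induced T (branch T r i))" by (rule is_forest_induced[OF T branch_subset])
    show ?thesis
      by (rule iso_n_coloured[OF F I forest_of_eq_iso[OF F I]])
        (use f[OF i] fF n_coloured_induced[OF T n branch_subset] in auto)
  qed
  have n': "n_coloured n G" unfolding G_def by (rule n_coloured_graft_poset[of n F, OF F nG])
  have r': "is_root G 0" unfolding G_def by (rule is_root_graft_poset)
  \<comment> \<open>Colours start at 1, so the index 0 is free for the block consisting of the
    root.\<close>
  define part where "part T r i = (if i = 0 then {r} else branch T r i)" for T and r i :: nat
  have parts: "verts T = (\<Union>i\<in>{0..n}. part T r i)" "disjoint_family_on (part T r) {0..n}"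
    if "is_forest T" "n_coloured n T" "is_root T r" for T r
  proof -
    have "{0..n} = insert 0 {1..n}" by auto
    then have "(\<Union>i\<in>{0..n}. part T r i) = {r} \<union> (\<Union>i\<in>{1..n}. branch T r i)"
      by (auto simp: part_def)
    then show "verts T = (\<Union>i\<in>{0..n}. part T r i)"
      using UN_branches[OF that] that(3) by (auto simp: is_root_def)
    show "disjoint_family_on (part T r) {0..n}"
      by (auto simp: disjoint_family_on_def part_def branch_def)
  qed
  \<comment> \<open>Relations between different blocks start at the root, and the colour towards
    branch \<open>j\<close> is \<open>j\<close>. So \<open>iso_glue\<close> applies with
    \<open>R i j\<close> being \<open>i = 0\<close> and \<open>K i j\<close> being
    \<open>j\<close>.\<close>
  have cross: "((x, y) \<in> ord T \<longleftrightarrow> i = 0) \<and> (i = 0 \<longrightarrow> first_colour T r' y = j \<and> x = r')"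
    if T: "is_forest T" and r: "is_root T r'" and ij: "i \<noteq> j" "x \<in> part T r' i" "y \<in> part T r' j"
    for T r' i j x y
  proof (cases "i = 0")
    case True
    then show ?thesis using ij r by (auto simp: part_def branch_def is_root_def)
  next
    case False
    then have x: "x \<in> branch T r' i" using ij by (simp add: part_def)
    have "(x, y) \<notin> ord T"
    proof (cases "j = 0")
      case True
      then have "y = r'" "x \<in> verts T" "x \<noteq> r'" using x ij by (simp_all add: part_def branch_def)
      then show ?thesis using r forest_ordD(4)[OF T] unfolding is_root_def by blast
    next
      case False
      then show ?thesis using branches_separated[OF T r x _ ij(1)] ij(3) by (simp add: part_def)
    qed
    then show ?thesis using False by simp
  qed
  have isoT: "iso T G"
  proof (rule iso_glue[OF T G parts[OF T n r] parts[OF G n' r']])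
    fix i assume i: "i \<in> {0..n}"
    show "iso (induced T (part T r i)) (induced G (part G 0 i))"
    proof (cases "i = 0")
      case True
      have "r \<in> verts T" "0 \<in> verts G" using r r' by (simp_all add: is_root_def)
      then have "iso_via (\<lambda>_. 0) (induced T {r}) (induced G {0})"
        using forest_ordD(2)[OF T] forest_ordD(2)[OF G]
        by (auto simp: iso_via_def ord_induced edge_def lt_def bij_betw_def)
      then show ?thesis using True unfolding iso_def part_def by auto
    next
      case False
      then have i: "i \<in> {1..n}" using i by simp
      have I: "is_forest (induced T (branch T r i))" by (rule is_forest_induced[OF T branch_subset])
      have "iso (induced T (branch T r i)) (F i)" using forest_of_eq_iso[OF I F] f[OF i] fF by simp
      moreover have "iso (F i) (induced G (branch G 0 i))"
        unfolding G_def by (rule iso_branch_graft_poset[of n F, OF F i])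
      ultimately have "iso (induced T (branch T r i)) (induced G (branch G 0 i))" by (rule iso_trans[OF I F])
      then show ?thesis using False by (simp add: part_def)
    qed
  next
    fix i j x y assume "i \<noteq> j" "x \<in> part T r i" "y \<in> part T r j"
    then show "((x, y) \<in> ord T \<longleftrightarrow> i = 0) \<and> (i = 0 \<longrightarrow> first_colour T x y = j)"
      using cross[OF T r] by blast
  next
    fix i j x y assume "i \<noteq> j" "x \<in> part G 0 i" "y \<in> part G 0 j"
    then show "((x, y) \<in> ord G \<longleftrightarrow> i = 0) \<and> (i = 0 \<longrightarrow> first_colour G x y = j)"
      using cross[OF G r'] by blast
  qed
  have "is_tree T" "is_tree G" using T r G r' is_tree_iff by blast+
  then have "abs_ctree T = abs_ctree G" using iffD2[OF abs_ctree_eq_iff isoT] by blast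
  then show ?thesis by (simp add: graft_def G_def F_def[abs_def])
qed

text \<open>The grafted poset is itself a tree with the prescribed branches; this allows the
  recursion for the coproduct to be checked on posets.\<close>

lemma graft_exists:
  assumes f: "\<And>i. i \<in> {1..n} \<Longrightarrow> f i \<in> nforests n"
  obtains T r where "T \<in> nforest_posets n" "is_root T r" "forest_of T = {#graft n f#}"
    "\<And>i. i \<in> {1..n} \<Longrightarrow> forest_of (induced T (branch T r i)) = f i"
proof -
  define F where "F i = forest_rep (f i)" for i
  have F: "is_forest (F i)" for i by (simp add: F_def forest_rep)
  have n: "n_coloured n (F i)" if "i \<in> {1..n}" for i
    using forest_rep_in_nforest_posets[OF f[OF that]] by (simp add: nforest_posets_def F_def)
  define G where "G = graft_poset n F"
  have G: "is_forest G" unfolding G_def by (rule is_forest_graft_poset[of n F, OF F])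
  have nG: "n_coloured n G" unfolding G_def by (rule n_coloured_graft_poset[of n F, OF F n])
  have r: "is_root G 0" unfolding G_def by (rule is_root_graft_poset)
  have b: "forest_of (induced G (branch G 0 i)) = f i" if i: "i \<in> {1..n}" for i
  proof -
    have "forest_of (F i) = forest_of (induced G (branch G 0 i))"
      by (rule iso_forest_of[OF F is_forest_induced[OF G branch_subset]])
        (unfold G_def, rule iso_branch_graft_poset[of n F, OF F i])
    then show ?thesis by (simp add: F_def forest_rep)
  qed
  have "is_tree G" using G r is_tree_iff by blast
  then have "forest_of G = {#graft n f#}" using forest_of_tree tree_eq_graft[OF G nG r b] by simp
  moreover have "G \<in> nforest_posets n" using G nG by (simp add: nforest_posets_def)
  ultimately show ?thesis using that r b by blast
qed

text \<open>A subforest containing the root is a tree with the same root. Since first colours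
  restrict, its branches are the parts of \<open>s\<close> in the branches of
  \<open>T\<close>.\<close>

lemma forest_of_induced_root:
  assumes T: "is_forest T" and n: "n_coloured n T" and r: "is_root T r" and s: "s \<subseteq> verts T" "r \<in> s"
    and f: "\<And>i. i \<in> {1..n} \<Longrightarrow> forest_of (induced T (s \<inter> branch T r i)) = f i"
  shows "forest_of (induced T s) = {#graft n f#}"
proof -
  have F: "is_forest (induced T s)" by (rule is_forest_induced[OF T s(1)])
  have R: "is_root (induced T s) r" using r s by (auto simp: is_root_def ord_induced)
  have b: "branch (induced T s) r i = s \<inter> branch T r i" for i
  proof -
    have "first_colour (induced T s) r v = first_colour T r v" if "v \<in> s" "v \<noteq> r" for v
      by (rule first_colour_induced[OF T s(1)]) (simp add: root_lt[OF F R] that)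
    then show ?thesis using s(1) by (auto simp: branch_def)
  qed
  have "is_tree (induced T s)" using F R is_tree_iff by blast
  then have "forest_of (induced T s) = {#abs_ctree (induced T s)#}" by (rule forest_of_tree)
  also have "abs_ctree (induced T s) = graft n f"
    by (rule tree_eq_graft[OF F n_coloured_induced[OF T n s(1)] R])
      (simp add: b forest_of_induced_induced[OF T s(1)] f)
  finally show ?thesis .
qed

text \<open>Once the root is removed, nothing joins different branches.\<close>

lemma forest_of_induced_no_root:
  assumes T: "is_forest T" and n: "n_coloured n T" and r: "is_root T r" and s: "s \<subseteq> verts T - {r}"
  shows "forest_of (induced T s) = (\<Sum>i=1..n. forest_of (induced T (s \<inter> branch T r i)))"
proof -
  have s': "s \<subseteq> verts T" using s by blast
  have "forest_of (induced T s) = (\<Sum>i=1..n. forest_of (induced (induced T s) (s \<inter> branch T r i)))"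
  proof (rule forest_of_separated_UN[OF is_forest_induced[OF T s']])
    show "verts (induced T s) = (\<Union>i\<in>{1..n}. s \<inter> branch T r i)"
      using s UN_branches[OF T n r] by auto
    show "disjoint_family_on (\<lambda>i. s \<inter> branch T r i) {1..n}"
      by (auto simp: disjoint_family_on_def branch_def)
    fix i j x y assume "i \<noteq> j" "x \<in> s \<inter> branch T r i" "y \<in> s \<inter> branch T r j"
    then show "(x, y) \<notin> ord (induced T s)" using branches_separated[OF T r] by (auto simp: ord_induced)
  qed simp
  then show ?thesis using forest_of_induced_induced[OF T s'] by simp
qed

section \<open>The coefficients as products over comparable pairs\<close>

definition lt_pairs :: "cposet \<Rightarrow> (nat \<times> nat) set" where
  "lt_pairs P = {(w, v). lt P w v}"

text \<open>The ambient set \<open>A\<close> is a parameter, so that coefficients inside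
  \<open>induced P A\<close> are computed in the fixed poset \<open>P\<close>. For
  \<open>s \<subseteq> A\<close>, a pair not contained in \<open>A\<close> has weight 1.\<close>

definition pair_weight ::
    "(nat \<Rightarrow> nat \<Rightarrow> 'k::comm_ring_1) \<Rightarrow> cposet \<Rightarrow> nat set \<Rightarrow> nat set \<Rightarrow> nat \<times> nat \<Rightarrow> 'k" where
  "pair_weight q P A s = (\<lambda>(w, v).
     (if v \<in> s \<and> w \<in> A - s then q 1 (first_colour P w v) else 1) *
     (if w \<in> s \<and> v \<in> A - s then q 2 (first_colour P w v) else 1))"

definition pair_prod ::
    "(nat \<Rightarrow> nat \<Rightarrow> 'k::comm_ring_1) \<Rightarrow> cposet \<Rightarrow> nat set \<Rightarrow> nat set \<Rightarrow> 'k" where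
  "pair_prod q P A s = prod (pair_weight q P A s) (lt_pairs P)"

lemma finite_lt_pairs: "is_forest P \<Longrightarrow> finite (lt_pairs P)"
  by (rule finite_subset[of _ "verts P \<times> verts P"])
    (use lt_verts in \<open>auto simp: lt_pairs_def finite_verts\<close>)

text \<open>An edge on the path from \<open>v\<close> to the root is determined by its lower vertex,
  which runs through the vertices strictly below \<open>v\<close>; its colour is the first colour
  towards \<open>v\<close>. The whole path stays in the component of \<open>v\<close>.\<close>

lemma p_forest_eq_card:
  assumes P: "is_forest P" and v: "v \<in> verts P"
  shows "p_forest j v s P = card {w. lt P w v \<and> w \<notin> s \<and> first_colour P w v = j}"
proof -
  define C where "C = connected_rel P `` {v}"
  have C: "C \<in> verts P // connected_rel P" unfolding C_def using v by (rule quotientI)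
  have sub: "C \<subseteq> verts P" using component_subset[OF P C] .
  have vC: "v \<in> C" unfolding C_def using v connected_rel_iff[OF P] forest_ordD(2)[OF P] by blast
  define T where "T = induced P C"
  have T: "is_forest T" unfolding T_def by (rule is_forest_induced[OF P sub])
  have lt: "lt T w v \<longleftrightarrow> lt P w v" for w
    using component_closed[OF P C vC, of w] vC unfolding T_def lt_induced by (auto simp: lt_def)
  have fc: "first_colour T w v = first_colour P w v" if "lt P w v" for w
    unfolding T_def by (rule first_colour_induced[OF P sub]) (use that lt in \<open>simp add: T_def\<close>)
  define E where "E = {(x, y). edge T x y \<and> (y, v) \<in> ord T \<and> colour T x y = j \<and> x \<in> verts T - (s \<inter> C)}"
  have "fst ` E = {w. lt P w v \<and> w \<notin> s \<and> first_colour P w v = j}" (is "_ = ?R")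
  proof
    show "fst ` E \<subseteq> ?R"
    proof clarify
      fix x y assume "(x, y) \<in> E"
      then have e: "edge T x y" "(y, v) \<in> ord T" "colour T x y = j" "x \<in> verts T - (s \<inter> C)"
        by (simp_all add: E_def)
      have l: "lt T x v" using lt_le_trans[OF T _ e(2)] e(1) by (simp add: edge_def)
      have "first_colour T x v = j" using first_colour_eq[OF T e(1,2)] e(3) by simp
      then have "first_colour P x v = j" using fc l lt by simp
      moreover have "x \<notin> s" using e(4) by (auto simp: T_def)
      ultimately show "lt P (fst (x, y)) v \<and> fst (x, y) \<notin> s \<and> first_colour P (fst (x, y)) v = j"
        using l lt by simp
    qed
    show "?R \<subseteq> fst ` E"
    proof
      fix w assume "w \<in> ?R"
      then have w: "lt P w v" "w \<notin> s" "j = first_colour P w v" by auto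
      have l: "lt T w v" using w lt by simp
      then obtain y where y: "edge T w y" "(y, v) \<in> ord T" using first_edge_exists[OF T] by blast
      have "(w, y) \<in> E"
        unfolding E_def using y w first_colour_eq[OF T y] fc[OF w(1)] lt_verts[OF T l] by simp
      then show "w \<in> fst ` E" by (rule image_eqI[rotated]) simp
    qed
  qed
  moreover have "inj_on fst E"
    unfolding inj_on_def E_def using first_edge_unique[OF T] by auto
  ultimately show ?thesis
    using card_image[of fst E] by (simp add: p_forest_def p_tree_def Let_def E_def T_def C_def)
qed

lemma prod_power_card_fibres:
  fixes a :: "nat \<Rightarrow> 'k::comm_ring_1"
  assumes "finite X" "c ` X \<subseteq> {1..n}"
  shows "(\<Prod>j=1..n. a j ^ card {w \<in> X. c w = j}) = (\<Prod>w\<in>X. a (c w))"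
  using prod.group[OF assms(1) _ assms(2), of "\<lambda>w. a (c w)"] by simp

text \<open>Each exponent counts pairs with given upper vertex and colour, so the product over
  colours of powers is a product over pairs. The second half is the first one for the complement of
  \<open>s\<close> and \<open>q 2\<close>.\<close>

lemma qcoeff_eq_pair_prod:
  fixes q :: "nat \<Rightarrow> nat \<Rightarrow> 'k::comm_ring_1"
  assumes P: "is_forest P" and n: "n_coloured n P" and s: "s \<subseteq> verts P"
  shows "qcoeff n q s P = pair_prod q P (verts P) s"
proof -
  let ?V = "verts P"
  have fin: "finite ?V" "finite s" using finite_verts[OF P] s finite_subset by auto
  have part: "(\<Prod>j=1..n. \<Prod>v\<in>u. a j ^ p_forest j v u P) =
      (\<Prod>(w, v)\<in>lt_pairs P. if v \<in> u \<and> w \<in> ?V - u then a (first_colour P w v) else 1)"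
    if u: "u \<subseteq> ?V" for u and a :: "nat \<Rightarrow> 'k"
  proof -
    define X where "X v = {w. lt P w v \<and> w \<notin> u}" for v
    have finX: "finite (X v)" for v
      by (rule finite_subset[OF _ fin(1)]) (use lt_verts[OF P] in \<open>auto simp: X_def\<close>)
    have "(\<Prod>j=1..n. \<Prod>v\<in>u. a j ^ p_forest j v u P) = (\<Prod>v\<in>u. \<Prod>j=1..n. a j ^ p_forest j v u P)"
      by (rule prod.swap)
    also have "\<dots> = (\<Prod>v\<in>u. \<Prod>w\<in>X v. a (first_colour P w v))"
    proof (rule prod.cong[OF refl])
      fix v assume "v \<in> u"
      then have "p_forest j v u P = card {w \<in> X v. first_colour P w v = j}" for j
        using p_forest_eq_card[OF P] u by (auto simp: X_def intro!: arg_cong[where f = card])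
      moreover have "(\<lambda>w. first_colour P w v) ` X v \<subseteq> {1..n}"
        using n unfolding X_def n_coloured_iff_first_colour[OF P] by blast
      ultimately show "(\<Prod>j=1..n. a j ^ p_forest j v u P) = (\<Prod>w\<in>X v. a (first_colour P w v))"
        using prod_power_card_fibres[OF finX, of "\<lambda>w. first_colour P w v" v n a] by simp
    qed
    also have "\<dots> = (\<Prod>(v, w)\<in>Sigma u X. a (first_colour P w v))"
      using finX finite_subset[OF u fin(1)] by (intro prod.Sigma) auto
    also have "\<dots> = (\<Prod>(w, v)\<in>{(w, v)\<in>lt_pairs P. v \<in> u \<and> w \<in> ?V - u}. a (first_colour P w v))"
      by (rule prod.reindex_bij_witness[of _ "\<lambda>(v, w). (w, v)" "\<lambda>(v, w). (w, v)"])
        (use lt_verts[OF P] in \<open>auto simp: X_def lt_pairs_def\<close>)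
    also have "\<dots> = (\<Prod>(w, v)\<in>lt_pairs P. if v \<in> u \<and> w \<in> ?V - u then a (first_colour P w v) else 1)"
      by (rule prod.mono_neutral_cong_left[OF finite_lt_pairs[OF P]]) (auto split: if_splits)
    finally show ?thesis .
  qed
  have "qcoeff n q s P = (\<Prod>j=1..n. \<Prod>v\<in>s. q 1 j ^ p_forest j v s P) *
      (\<Prod>j=1..n. \<Prod>v\<in>?V - s. q 2 j ^ p_forest j v (?V - s) P)"
    by (simp add: qcoeff_def prod.distrib)
  also have "\<dots> = pair_prod q P ?V s"
    unfolding part[OF s] part[OF Diff_subset] pair_prod_def prod.distrib[symmetric]
    by (rule prod.cong[OF refl])
      (use s lt_verts[OF P] in \<open>auto simp: pair_weight_def lt_pairs_def\<close>)
  finally show ?thesis .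
qed

lemma pair_prod_induced:
  assumes P: "is_forest P" and A: "A \<subseteq> verts P" and s: "s \<subseteq> A"
  shows "pair_prod q (induced P A) A s = pair_prod q P A s"
  unfolding pair_prod_def
proof (rule prod.mono_neutral_cong_left[OF finite_lt_pairs[OF P]])
  show "lt_pairs (induced P A) \<subseteq> lt_pairs P" by (auto simp: lt_pairs_def lt_induced)
  show "\<forall>i\<in>lt_pairs P - lt_pairs (induced P A). pair_weight q P A s i = 1"
    using s by (auto simp: lt_pairs_def lt_induced pair_weight_def split: if_splits)
  fix x assume "x \<in> lt_pairs (induced P A)"
  then show "pair_weight q (induced P A) A s x = pair_weight q P A s x"
    using first_colour_induced[OF P A] by (auto simp: lt_pairs_def pair_weight_def)
qed

lemma qcoeff_induced:
  assumes "P \<in> nforest_posets n" "A \<subseteq> verts P" "s \<subseteq> A"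
  shows "qcoeff n q s (induced P A) = pair_prod q P A s"
proof -
  have P: "is_forest P" "n_coloured n P" using assms(1) by (simp_all add: nforest_posets_def)
  have "qcoeff n q s (induced P A) = pair_prod q (induced P A) A s"
    using qcoeff_eq_pair_prod[OF is_forest_induced[OF P(1) assms(2)] n_coloured_induced[OF P assms(2)]]
      assms(3) by simp
  then show ?thesis using pair_prod_induced[OF P(1) assms(2,3)] by simp
qed

text \<open>The cocycle identity behind coassociativity: both sides weigh each comparable pair according
  to which of the blocks \<open>s\<close>, \<open>t\<close>, \<open>A - (s \<union> t)\<close> contain its two vertices.\<close>

lemma pair_prod_cocycle:
  assumes "s \<subseteq> A" "t \<subseteq> A" "s \<inter> t = {}"
  shows "pair_prod q P A s * pair_prod q P (A - s) t =
    pair_prod q P A (s \<union> t) * pair_prod q P (s \<union> t) s"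
  unfolding pair_prod_def prod.distrib[symmetric]
  by (rule prod.cong[OF refl]) (use assms in \<open>auto simp: pair_weight_def\<close>)

lemma pair_prod_trivial: "pair_prod q P A {} = 1" "pair_prod q P A A = 1"
  unfolding pair_prod_def by (auto simp: pair_weight_def intro: prod.neutral)

text \<open>No pair joins the two blocks, and a pair inside one block has weight 1 for the
  other.\<close>

lemma pair_prod_union:
  assumes "A \<inter> B = {}" "s \<subseteq> A \<union> B"
    and "\<And>x y. x \<in> A \<Longrightarrow> y \<in> B \<Longrightarrow> \<not> lt P x y \<and> \<not> lt P y x"
  shows "pair_prod q P (A \<union> B) s = pair_prod q P A (s \<inter> A) * pair_prod q P B (s \<inter> B)"
  unfolding pair_prod_def prod.distrib[symmetric]
proof (rule prod.cong[OF refl])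
  fix p assume "p \<in> lt_pairs P"
  then obtain w v where p: "p = (w, v)" "lt P w v" by (auto simp: lt_pairs_def)
  then have "w \<in> A \<Longrightarrow> v \<notin> B" "w \<in> B \<Longrightarrow> v \<notin> A" using assms(3) by blast+
  moreover have "v \<in> s \<Longrightarrow> v \<in> A \<or> v \<in> B" "w \<in> s \<Longrightarrow> w \<in> A \<or> w \<in> B" using assms(2) by blast+
  moreover have "v \<in> A \<Longrightarrow> v \<notin> B" "w \<in> A \<Longrightarrow> w \<notin> B" using assms(1) by blast+
  ultimately show "pair_weight q P (A \<union> B) s p =
      pair_weight q P A (s \<inter> A) p * pair_weight q P B (s \<inter> B) p"
    unfolding p(1) pair_weight_def by (cases "w \<in> s"; cases "v \<in> s") auto
qed

lemma pair_prod_UN: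
  assumes "finite I" "disjoint_family_on A I" "s \<subseteq> (\<Union>i\<in>I. A i)"
    and "\<And>i j x y. \<lbrakk>i \<in> I; j \<in> I; i \<noteq> j; x \<in> A i; y \<in> A j\<rbrakk> \<Longrightarrow> \<not> lt P x y"
  shows "pair_prod q P (\<Union>i\<in>I. A i) s = (\<Prod>i\<in>I. pair_prod q P (A i) (s \<inter> A i))"
  using assms
proof (induction I arbitrary: s rule: finite_induct)
  case empty
  then show ?case by (simp add: pair_prod_trivial)
next
  case (insert i I)
  let ?U = "\<Union>j\<in>I. A j"
  have d: "A i \<inter> ?U = {}" using insert.prems(1) insert.hyps(2) by (auto simp: disjoint_family_on_def)
  have "pair_prod q P (A i \<union> ?U) s = pair_prod q P (A i) (s \<inter> A i) * pair_prod q P ?U (s \<inter> ?U)"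
  proof (rule pair_prod_union[OF d])
    show "s \<subseteq> A i \<union> ?U" using insert.prems(2) by simp
    fix x y assume x: "x \<in> A i" and "y \<in> ?U"
    then obtain j where j: "j \<in> I" "y \<in> A j" by blast
    then have "i \<noteq> j" using insert.hyps(2) by blast
    then show "\<not> lt P x y \<and> \<not> lt P y x"
      using insert.prems(3)[of i j x y] insert.prems(3)[of j i y x] x j by simp
  qed
  also have "pair_prod q P ?U (s \<inter> ?U) = (\<Prod>j\<in>I. pair_prod q P (A j) (s \<inter> ?U \<inter> A j))"
  proof (rule insert.IH)
    show "disjoint_family_on A I" using insert.prems(1) by (auto simp: disjoint_family_on_def)
    show "\<not> lt P x y" if "i \<in> I" "j \<in> I" "i \<noteq> j" "x \<in> A i" "y \<in> A j" for i j x y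
      using insert.prems(3)[of i j x y] that by simp
  qed simp
  also have "\<dots> = (\<Prod>j\<in>I. pair_prod q P (A j) (s \<inter> A j))"
    by (intro prod.cong refl arg_cong[where f = "pair_prod q P _"]) blast
  finally show ?case using insert.hyps by simp
qed

text \<open>Pairs avoiding the root split along the branches. A pair \<open>(r, v)\<close> counts
  when the root and \<open>v\<close> are separated: with \<open>q 1\<close> if only \<open>v\<close>
  belongs to the subforest, with \<open>q 2\<close> if only \<open>r\<close> does. The first colour
  of the pair is the branch index of \<open>v\<close>, so the exponents are cardinalities inside the
  branches.\<close>

lemma pair_prod_root:
  fixes q :: "nat \<Rightarrow> nat \<Rightarrow> 'k::comm_ring_1"
  assumes T: "is_forest T" and n: "n_coloured n T" and r: "is_root T r" and s: "s \<subseteq> verts T - {r}"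
  shows "pair_prod q T (verts T) s =
      (\<Prod>i=1..n. pair_prod q T (branch T r i) (s \<inter> branch T r i) * q 1 i ^ card (s \<inter> branch T r i))"
    and "pair_prod q T (verts T) (insert r s) =
      (\<Prod>i=1..n. pair_prod q T (branch T r i) (s \<inter> branch T r i) * q 2 i ^ card (branch T r i - s))"
proof -
  let ?U = "verts T - {r}"
  note U = UN_branches[OF T n r]
  have fin: "finite ?U" using finite_verts[OF T] by simp
  \<comment> \<open>Nothing lies below the root, so it enters pairs only as lower vertex.\<close>
  have lr: "\<not> lt T w r" for w
    using root_lt[OF T r] lt_trans[OF T, of r w r] lt_verts[OF T, of w r] by (auto simp: lt_def)
  have root_pairs: "(\<Prod>(w, v)\<in>lt_pairs T. if w = r \<and> v \<in> u then a (first_colour T w v) else 1) =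
      (\<Prod>i=1..n. a i ^ card (u \<inter> branch T r i))" if u: "u \<subseteq> ?U" for u and a :: "nat \<Rightarrow> 'k"
  proof -
    have "(\<Prod>(w, v)\<in>lt_pairs T. if w = r \<and> v \<in> u then a (first_colour T w v) else 1) =
        (\<Prod>(w, v)\<in>{r} \<times> u. a (first_colour T w v))"
      by (rule prod.mono_neutral_cong_right[OF finite_lt_pairs[OF T]])
        (use u root_lt[OF T r] in \<open>auto simp: lt_pairs_def split: if_splits\<close>)
    also have "\<dots> = (\<Prod>v\<in>u. a (first_colour T r v))"
      by (rule prod.reindex_bij_witness[of _ "\<lambda>v. (r, v)" snd]) auto
    also have "\<dots> = (\<Prod>i=1..n. a i ^ card {v \<in> u. first_colour T r v = i})"
    proof (rule prod_power_card_fibres[symmetric])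
      show "finite u" using u fin finite_subset by blast
      show "first_colour T r ` u \<subseteq> {1..n}"
        using n root_lt[OF T r] u unfolding n_coloured_iff_first_colour[OF T] by blast
    qed
    also have "\<dots> = (\<Prod>i=1..n. a i ^ card (u \<inter> branch T r i))"
      by (intro prod.cong refl arg_cong2[where f = power] arg_cong[where f = card])
        (use u in \<open>auto simp: branch_def\<close>)
    finally show ?thesis .
  qed
  have no_root: "pair_prod q T ?U s = (\<Prod>i=1..n. pair_prod q T (branch T r i) (s \<inter> branch T r i))"
    unfolding U[symmetric]
    by (rule pair_prod_UN)
      (use s U branches_separated[OF T r] disjoint_branches in \<open>auto simp: lt_def\<close>)
  have "pair_prod q T (verts T) s = pair_prod q T ?U s *
      (\<Prod>(w, v)\<in>lt_pairs T. if w = r \<and> v \<in> s then q 1 (first_colour T w v) else 1)"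
    unfolding pair_prod_def prod.distrib[symmetric]
    by (rule prod.cong[OF refl])
      (use s r lr lt_verts[OF T] in \<open>auto simp: pair_weight_def lt_pairs_def is_root_def\<close>)
  then show "pair_prod q T (verts T) s =
      (\<Prod>i=1..n. pair_prod q T (branch T r i) (s \<inter> branch T r i) * q 1 i ^ card (s \<inter> branch T r i))"
    unfolding root_pairs[OF s] no_root by (simp add: prod.distrib)
  have "pair_prod q T (verts T) (insert r s) = pair_prod q T ?U s *
      (\<Prod>(w, v)\<in>lt_pairs T. if w = r \<and> v \<in> ?U - s then q 2 (first_colour T w v) else 1)"
    unfolding pair_prod_def prod.distrib[symmetric]
    by (rule prod.cong[OF refl])
      (use s r lr lt_verts[OF T] in \<open>auto simp: pair_weight_def lt_pairs_def is_root_def\<close>)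
  moreover have "(?U - s) \<inter> branch T r i = branch T r i - s" for i by (auto simp: branch_def)
  ultimately show "pair_prod q T (verts T) (insert r s) =
      (\<Prod>i=1..n. pair_prod q T (branch T r i) (s \<inter> branch T r i) * q 2 i ^ card (branch T r i - s))"
    using root_pairs[OF Diff_subset, of s "q 2"] no_root by (simp add: prod.distrib)
qed

section \<open>Linear extension\<close>

definition lin :: "('a \<Rightarrow> ('b \<Rightarrow>\<^sub>0 'k::field_char_0)) \<Rightarrow> ('a \<Rightarrow>\<^sub>0 'k) \<Rightarrow> ('b \<Rightarrow>\<^sub>0 'k)" where
  "lin g x = (\<Sum>a\<in>Poly_Mapping.keys x. scale (Poly_Mapping.lookup x a) (g a))"

lemma lookup_scale: "Poly_Mapping.lookup (scale c x) a = c * Poly_Mapping.lookup x a"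
  unfolding scale_def by (simp add: Poly_Mapping.map.rep_eq when_def)

lemma scale_simps:
  "scale c (x + y) = scale c x + scale c y"
  "scale (c + d) x = scale c x + scale d x"
  "scale c (scale d x) = scale (c * d) x"
  "scale 1 x = x" "scale 0 x = 0" "scale c 0 = 0"
  "scale (- c) x = - scale c x"
  "scale c (Poly_Mapping.single a d) = Poly_Mapping.single a (c * d)"
  by (rule poly_mapping_eqI,
      simp add: lookup_scale lookup_add lookup_single when_def algebra_simps)+

lemma scale_sum: "scale c (sum f A) = (\<Sum>a\<in>A. scale c (f a))"
  by (induction A rule: infinite_finite_induct) (simp_all add: scale_simps)

lemma sum_scale: "scale (sum f A) x = (\<Sum>a\<in>A. scale (f a) x)"
  by (induction A rule: infinite_finite_induct) (simp_all add: scale_simps)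

lemma scale_mult:
  fixes x y :: "'a::comm_monoid_add \<Rightarrow>\<^sub>0 'k::field_char_0"
  shows "scale c x * y = scale c (x * y)" "x * scale c y = scale c (x * y)"
  unfolding scale_def mult_map_scale_conv_mult by (simp_all add: mult_ac)

lemma keys_scale: "Poly_Mapping.keys (scale c x) \<subseteq> Poly_Mapping.keys x"
  by (auto simp: in_keys_iff lookup_scale)

lemma lin_superset:
  assumes "finite S" "Poly_Mapping.keys x \<subseteq> S"
  shows "lin g x = (\<Sum>a\<in>S. scale (Poly_Mapping.lookup x a) (g a))"
  unfolding lin_def
  by (rule sum.mono_neutral_left) (use assms in \<open>auto simp: in_keys_iff scale_simps\<close>)

lemma lin_add: "lin g (x + y) = lin g x + lin g y"
proof -
  let ?S = "Poly_Mapping.keys x \<union> Poly_Mapping.keys y"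
  have "lin g z = (\<Sum>a\<in>?S. scale (Poly_Mapping.lookup z a) (g a))"
    if "Poly_Mapping.keys z \<subseteq> ?S" for z by (rule lin_superset) (use that in auto)
  note L = this
  show ?thesis
    by (subst (1 2 3) L) (use keys_add[of x y] in \<open>auto simp: lookup_add scale_simps sum.distrib\<close>)
qed

lemma lin_scale: "lin g (scale c x) = scale c (lin g x)"
  unfolding lin_superset[OF finite_keys keys_scale]
  by (simp add: lin_def lookup_scale scale_sum scale_simps)

lemma lin_0: "lin g 0 = 0"
  by (simp add: lin_def)

lemma lin_sum: "lin g (sum f A) = (\<Sum>a\<in>A. lin g (f a))"
  by (induction A rule: infinite_finite_induct) (simp_all add: lin_0 lin_add)

lemma lin_basis: "lin g (basis a) = g a"
  by (simp add: lin_def scale_simps)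

lemma lin_cong: "(\<And>a. a \<in> Poly_Mapping.keys x \<Longrightarrow> g a = h a) \<Longrightarrow> lin g x = lin h x"
  by (simp add: lin_def)

lemma basis_expansion: "x = (\<Sum>a\<in>Poly_Mapping.keys x. scale (Poly_Mapping.lookup x a) (basis a))"
  by (rule poly_mapping_eqI)
    (simp add: lookup_sum lookup_scale lookup_single when_def in_keys_iff if_distrib[of "(*) _"] cong: if_cong)

text \<open>Multiplicativity of \<open>g\<close> is asked for on the supports only, because the
  subforest sum is shown to be multiplicative on \<open>n\<close>-coloured forests.\<close>

lemma lin_mult:
  fixes x y :: "'a::comm_monoid_add \<Rightarrow>\<^sub>0 'k::field_char_0"
    and g :: "'a \<Rightarrow> ('b::comm_monoid_add \<Rightarrow>\<^sub>0 'k)"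
  assumes g: "\<And>a b. a \<in> Poly_Mapping.keys x \<Longrightarrow> b \<in> Poly_Mapping.keys y \<Longrightarrow> g (a + b) = g a * g b"
  shows "lin g (x * y) = lin g x * lin g y"
proof -
  have "x * y = (\<Sum>a\<in>Poly_Mapping.keys x. \<Sum>b\<in>Poly_Mapping.keys y.
      scale (Poly_Mapping.lookup x a) (scale (Poly_Mapping.lookup y b) (basis (a + b))))"
    by (subst basis_expansion[of x], subst basis_expansion[of y])
      (simp add: sum_product scale_mult scale_simps mult_single)
  then have "lin g (x * y) = (\<Sum>a\<in>Poly_Mapping.keys x. \<Sum>b\<in>Poly_Mapping.keys y.
      scale (Poly_Mapping.lookup x a) (scale (Poly_Mapping.lookup y b) (g (a + b))))"
    by (simp add: lin_sum lin_scale lin_basis)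
  also have "\<dots> = lin g x * lin g y"
    unfolding lin_def sum_product by (intro sum.cong refl) (simp add: g scale_mult scale_simps mult.commute)
  finally show ?thesis .
qed

lemma linear_map_on_lin: "linear_map_on A (lin g)"
  by (simp add: linear_map_on_def lin_add lin_scale)

text \<open>Linearity is known only on the span of \<open>X\<close>, so the induction along the
  basis expansion also carries membership of the partial sums.\<close>

lemma linear_map_on_eq_lin:
  assumes D: "linear_map_on {x. Poly_Mapping.keys x \<subseteq> X} D" and x: "Poly_Mapping.keys x \<subseteq> X"
  shows "D x = lin (\<lambda>a. D (basis a)) x"
proof -
  let ?A = "{x. Poly_Mapping.keys x \<subseteq> X}"
  have add: "D (x + y) = D x + D y" if "x \<in> ?A" "y \<in> ?A" for x y
    using D that unfolding linear_map_on_def by blast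
  have sc: "D (scale c x) = scale c (D x)" if "x \<in> ?A" for c x
    using D that unfolding linear_map_on_def by blast
  have b: "scale c (basis a) \<in> ?A" if "a \<in> X" for a c
    using that keys_scale[of c "basis a"] by auto
  have "(\<Sum>a\<in>F. scale (c a) (basis a)) \<in> ?A \<and>
      D (\<Sum>a\<in>F. scale (c a) (basis a)) = (\<Sum>a\<in>F. scale (c a) (D (basis a)))"
    if "finite F" "F \<subseteq> X" for F c
    using that
  proof (induction F rule: finite_induct)
    case empty
    \<comment> \<open>The value at 0 is obtained from homogeneity with scalar 0.\<close>
    have "D (scale 0 0) = scale 0 (D 0)" by (rule sc) simp
    then show ?case by (simp add: scale_simps)
  next
    case (insert a F)
    then have IH: "(\<Sum>a\<in>F. scale (c a) (basis a)) \<in> ?A"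
      "D (\<Sum>a\<in>F. scale (c a) (basis a)) = (\<Sum>a\<in>F. scale (c a) (D (basis a)))" and a: "a \<in> X"
      by simp_all
    have "scale (c a) (basis a) + (\<Sum>a\<in>F. scale (c a) (basis a)) \<in> ?A"
      using keys_add[of "scale (c a) (basis a)" "\<Sum>a\<in>F. scale (c a) (basis a)"] b[OF a, of "c a"] IH(1)
      by auto
    moreover have "D (scale (c a) (basis a)) = scale (c a) (D (basis a))" by (rule sc) (use a in simp)
    ultimately show ?case using insert.hyps add[OF b[OF a] IH(1)] IH(2) by simp
  qed
  from this[OF finite_keys x, of "Poly_Mapping.lookup x"] show ?thesis
    unfolding basis_expansion[symmetric] lin_def by blast
qed

text \<open>A Sweedler sum over the supports of tensors may be taken over any families of indices
  that express the tensors, even when distinct indices give the same basis element.\<close>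

lemma sum_keys_PiE:
  fixes x :: "'i \<Rightarrow> ('a \<Rightarrow>\<^sub>0 'k::field_char_0)"
  assumes I: "finite I" and A: "\<And>i. i \<in> I \<Longrightarrow> finite (A i)"
    and x: "\<And>i. i \<in> I \<Longrightarrow> x i = (\<Sum>s\<in>A i. scale (c i s) (basis (g i s)))"
  shows "(\<Sum>p\<in>Pi\<^sub>E I (\<lambda>i. Poly_Mapping.keys (x i)). scale (\<Prod>i\<in>I. Poly_Mapping.lookup (x i) (p i)) (H p)) =
    (\<Sum>\<sigma>\<in>Pi\<^sub>E I A. scale (\<Prod>i\<in>I. c i (\<sigma> i)) (H (\<lambda>i\<in>I. g i (\<sigma> i))))"
proof -
  \<comment> \<open>All values taken by the indices; the support of \<open>x i\<close> can be
    smaller, since coefficients belonging to one value may cancel.\<close>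
  define K where "K i = g i ` A i" for i
  have lk: "Poly_Mapping.lookup (x i) a = (\<Sum>s\<in>{s \<in> A i. g i s = a}. c i s)" if i: "i \<in> I" for i a
    unfolding x[OF i] lookup_sum
    by (rule sum.mono_neutral_cong_right)
      (use A[OF i] in \<open>auto simp: lookup_scale lookup_single when_def\<close>)
  have KA: "Poly_Mapping.keys (x i) \<subseteq> K i" if i: "i \<in> I" for i
  proof
    fix a assume "a \<in> Poly_Mapping.keys (x i)"
    then have "(\<Sum>s\<in>{s \<in> A i. g i s = a}. c i s) \<noteq> 0" using lk[OF i] by (simp add: in_keys_iff)
    then have "{s \<in> A i. g i s = a} \<noteq> {}" by (metis sum.empty)
    then show "a \<in> K i" by (auto simp: K_def)
  qed
  have fK: "finite (Pi\<^sub>E I K)" using I A by (intro finite_PiE) (auto simp: K_def)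
  have fA: "finite (Pi\<^sub>E I A)" using I A by (intro finite_PiE) auto
  have "(\<Sum>p\<in>Pi\<^sub>E I (\<lambda>i. Poly_Mapping.keys (x i)). scale (\<Prod>i\<in>I. Poly_Mapping.lookup (x i) (p i)) (H p)) =
      (\<Sum>p\<in>Pi\<^sub>E I K. scale (\<Prod>i\<in>I. Poly_Mapping.lookup (x i) (p i)) (H p))"
  proof (rule sum.mono_neutral_left[OF fK])
    show "Pi\<^sub>E I (\<lambda>i. Poly_Mapping.keys (x i)) \<subseteq> Pi\<^sub>E I K" by (rule PiE_mono) (rule KA)
    show "\<forall>p\<in>Pi\<^sub>E I K - Pi\<^sub>E I (\<lambda>i. Poly_Mapping.keys (x i)).
        scale (\<Prod>i\<in>I. Poly_Mapping.lookup (x i) (p i)) (H p) = 0"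
    proof
      fix p assume p: "p \<in> Pi\<^sub>E I K - Pi\<^sub>E I (\<lambda>i. Poly_Mapping.keys (x i))"
      then obtain i where "i \<in> I" "p i \<notin> Poly_Mapping.keys (x i)" by (auto simp: PiE_iff)
      then have "(\<Prod>i\<in>I. Poly_Mapping.lookup (x i) (p i)) = 0"
        using I by (intro prod_zero) (auto simp: in_keys_iff)
      then show "scale (\<Prod>i\<in>I. Poly_Mapping.lookup (x i) (p i)) (H p) = 0" by (simp add: scale_simps)
    qed
  qed
  \<comment> \<open>The coefficient at \<open>p\<close> is a product of sums over the fibres of the
    maps \<open>g i\<close>. Expanding it gives a sum over the index families whose family of values
    is \<open>p\<close>.\<close>
  also have "\<dots> = (\<Sum>p\<in>Pi\<^sub>E I K. \<Sum>\<sigma>\<in>{\<sigma> \<in> Pi\<^sub>E I A. (\<lambda>i\<in>I. g i (\<sigma> i)) = p}.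
      scale (\<Prod>i\<in>I. c i (\<sigma> i)) (H (\<lambda>i\<in>I. g i (\<sigma> i))))"
  proof (rule sum.cong[OF refl])
    fix p assume p: "p \<in> Pi\<^sub>E I K"
    have "(\<Prod>i\<in>I. Poly_Mapping.lookup (x i) (p i)) = (\<Prod>i\<in>I. \<Sum>s\<in>{s \<in> A i. g i s = p i}. c i s)"
      by (rule prod.cong[OF refl]) (rule lk)
    also have "\<dots> = (\<Sum>\<sigma>\<in>Pi\<^sub>E I (\<lambda>i. {s \<in> A i. g i s = p i}). \<Prod>i\<in>I. c i (\<sigma> i))"
      by (rule prod_sum_PiE) (use I A in auto)
    also have "Pi\<^sub>E I (\<lambda>i. {s \<in> A i. g i s = p i}) = {\<sigma> \<in> Pi\<^sub>E I A. (\<lambda>i\<in>I. g i (\<sigma> i)) = p}"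
    proof -
      have "(\<lambda>i\<in>I. g i (\<sigma> i)) = p \<longleftrightarrow> (\<forall>i\<in>I. g i (\<sigma> i) = p i)" for \<sigma>
        using p by (auto simp: fun_eq_iff PiE_iff extensional_def restrict_def)
      then show ?thesis by (intro set_eqI) (simp add: PiE_iff; blast)
    qed
    finally show "scale (\<Prod>i\<in>I. Poly_Mapping.lookup (x i) (p i)) (H p) =
        (\<Sum>\<sigma>\<in>{\<sigma> \<in> Pi\<^sub>E I A. (\<lambda>i\<in>I. g i (\<sigma> i)) = p}.
          scale (\<Prod>i\<in>I. c i (\<sigma> i)) (H (\<lambda>i\<in>I. g i (\<sigma> i))))"
      by (simp add: sum_scale)
  qed
  also have "\<dots> = (\<Sum>\<sigma>\<in>Pi\<^sub>E I A. scale (\<Prod>i\<in>I. c i (\<sigma> i)) (H (\<lambda>i\<in>I. g i (\<sigma> i))))"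
    by (rule sum.group[OF fA fK]) (auto simp: K_def PiE_iff)
  finally show ?thesis .
qed

section \<open>The sum over subforests\<close>

abbreviation forest_on :: "cposet \<Rightarrow> nat set \<Rightarrow> cforest" where
  "forest_on P s \<equiv> forest_of (induced P s)"

definition delta ::
    "nat \<Rightarrow> (nat \<Rightarrow> nat \<Rightarrow> 'k::field_char_0) \<Rightarrow> cposet \<Rightarrow> (cforest \<times> cforest \<Rightarrow>\<^sub>0 'k)" where
  "delta n q P = (\<Sum>s\<in>Pow (verts P). scale (qcoeff n q s P)
     (basis (forest_on P s, forest_on P (verts P - s))))"

lemma nforest_posetsD: "P \<in> nforest_posets n \<Longrightarrow> is_forest P" "P \<in> nforest_posets n \<Longrightarrow> n_coloured n P"
  by (simp_all add: nforest_posets_def)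

lemma induced_in_nforest_posets:
  "P \<in> nforest_posets n \<Longrightarrow> s \<subseteq> verts P \<Longrightarrow> induced P s \<in> nforest_posets n"
  by (simp add: nforest_posets_def is_forest_induced n_coloured_induced)

lemma delta_eq_pair_prod:
  assumes "P \<in> nforest_posets n"
  shows "delta n q P = (\<Sum>s\<in>Pow (verts P). scale (pair_prod q P (verts P) s)
    (basis (forest_on P s, forest_on P (verts P - s))))"
  unfolding delta_def
  by (intro sum.cong refl) (simp add: qcoeff_eq_pair_prod nforest_posetsD[OF assms])

lemma delta_induced:
  assumes P: "P \<in> nforest_posets n" and A: "A \<subseteq> verts P"
  shows "delta n q (induced P A) =
    (\<Sum>s\<in>Pow A. scale (pair_prod q P A s) (basis (forest_on P s, forest_on P (A - s))))"
  unfolding delta_def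
  by (intro sum.cong)
    (simp_all add: qcoeff_induced[OF P A] forest_of_induced_induced[OF nforest_posetsD(1)[OF P] A])

lemma pair_prod_iso:
  assumes P: "is_forest P" and Q: "is_forest Q" and i: "iso_via \<phi> P Q"
    and A: "A \<subseteq> verts P" and s: "s \<subseteq> A"
  shows "pair_prod q Q (\<phi> ` A) (\<phi> ` s) = pair_prod q P A s"
proof -
  note D = iso_viaD[OF P Q i]
  have inj: "inj_on \<phi> (verts P)" and im: "\<phi> ` verts P = verts Q"
    using D(1) by (simp_all add: bij_betw_def)
  have mem: "\<phi> x \<in> \<phi> ` B \<longleftrightarrow> x \<in> B" if "x \<in> verts P" "B \<subseteq> verts P" for x B
    using inj_on_image_mem_iff[OF inj that] .
  have s': "s \<subseteq> verts P" using A s by blast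
  have pairs: "lt_pairs Q = map_prod \<phi> \<phi> ` lt_pairs P"
  proof
    show "map_prod \<phi> \<phi> ` lt_pairs P \<subseteq> lt_pairs Q"
    proof
      fix p assume "p \<in> map_prod \<phi> \<phi> ` lt_pairs P"
      then obtain u v where p: "p = (\<phi> u, \<phi> v)" "lt P u v" by (auto simp: lt_pairs_def)
      then show "p \<in> lt_pairs Q" using D(3)[of u v] lt_verts[OF P p(2)] by (simp add: lt_pairs_def)
    qed
    show "lt_pairs Q \<subseteq> map_prod \<phi> \<phi> ` lt_pairs P"
    proof
      fix p assume "p \<in> lt_pairs Q"
      then obtain x y where p: "p = (x, y)" "lt Q x y" by (auto simp: lt_pairs_def)
      then have "x \<in> \<phi> ` verts P" "y \<in> \<phi> ` verts P" using lt_verts[OF Q] im by simp_all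
      then obtain u v where u: "u \<in> verts P" "x = \<phi> u" "v \<in> verts P" "y = \<phi> v" by blast
      then have "(u, v) \<in> lt_pairs P" using p(2) D(3)[of u v] by (simp add: lt_pairs_def)
      then show "p \<in> map_prod \<phi> \<phi> ` lt_pairs P" using p(1) u by (intro image_eqI) auto
    qed
  qed
  have "inj_on (map_prod \<phi> \<phi>) (lt_pairs P)"
  proof (rule inj_on_subset)
    show "inj_on (map_prod \<phi> \<phi>) (verts P \<times> verts P)" using inj by (rule map_prod_inj_on[OF _ inj])
    show "lt_pairs P \<subseteq> verts P \<times> verts P" using lt_verts[OF P] by (auto simp: lt_pairs_def)
  qed
  then have "pair_prod q Q (\<phi> ` A) (\<phi> ` s) =
      (\<Prod>p\<in>lt_pairs P. pair_weight q Q (\<phi> ` A) (\<phi> ` s) (map_prod \<phi> \<phi> p))"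
    unfolding pair_prod_def pairs by (simp add: prod.reindex)
  also have "\<dots> = pair_prod q P A s"
    unfolding pair_prod_def
  proof (rule prod.cong[OF refl])
    fix p assume "p \<in> lt_pairs P"
    then obtain x y where p: "p = (x, y)" "lt P x y" by (auto simp: lt_pairs_def)
    have V: "x \<in> verts P" "y \<in> verts P" using lt_verts[OF P p(2)] by auto
    show "pair_weight q Q (\<phi> ` A) (\<phi> ` s) (map_prod \<phi> \<phi> p) = pair_weight q P A s p"
      unfolding p(1) pair_weight_def
      using mem[OF V(1) A] mem[OF V(1) s'] mem[OF V(2) A] mem[OF V(2) s'] D(4)[OF p(2)] by simp
  qed
  finally show ?thesis .
qed

text \<open>An isomorphism transports subsets together with their subforests and pair weights, so
  the subforest sum depends only on the forest.\<close>

lemma delta_cong: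
  assumes P: "P \<in> nforest_posets n" and Q: "Q \<in> nforest_posets n" and eq: "forest_of P = forest_of Q"
  shows "delta n q P = delta n q Q"
proof -
  note FP = nforest_posetsD(1)[OF P] and FQ = nforest_posetsD(1)[OF Q]
  obtain \<phi> where i: "iso_via \<phi> P Q" using forest_of_eq_iso[OF FP FQ eq] unfolding iso_def by auto
  have inj: "inj_on \<phi> (verts P)" and im: "verts Q = \<phi> ` verts P"
    using iso_viaD(1)[OF FP FQ i] by (simp_all add: bij_betw_def)
  have F: "forest_on Q (\<phi> ` s) = forest_on P s" if s: "s \<subseteq> verts P" for s
  proof -
    have "\<phi> ` s \<subseteq> verts Q" using s im by blast
    then show ?thesis
      using iso_forest_of[OF is_forest_induced[OF FP s] is_forest_induced[OF FQ]]
        iso_via_induced[OF FP FQ i s] unfolding iso_def by metis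
  qed
  have "delta n q Q = (\<Sum>s\<in>Pow (verts P). scale (pair_prod q Q (\<phi> ` verts P) (\<phi> ` s))
      (basis (forest_on Q (\<phi> ` s), forest_on Q (\<phi> ` verts P - \<phi> ` s))))"
    unfolding delta_eq_pair_prod[OF Q] im image_Pow_surj[OF refl, symmetric]
    by (subst sum.reindex[OF inj_on_image_Pow[OF inj]]) simp
  also have "\<dots> = delta n q P"
    unfolding delta_eq_pair_prod[OF P]
  proof (rule sum.cong[OF refl])
    fix s assume "s \<in> Pow (verts P)"
    then have s: "s \<subseteq> verts P" by simp
    have "\<phi> ` verts P - \<phi> ` s = \<phi> ` (verts P - s)" using inj_on_image_set_diff[OF inj _ s] by auto
    then show "scale (pair_prod q Q (\<phi> ` verts P) (\<phi> ` s))
        (basis (forest_on Q (\<phi> ` s), forest_on Q (\<phi> ` verts P - \<phi> ` s))) =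
      scale (pair_prod q P (verts P) s) (basis (forest_on P s, forest_on P (verts P - s)))"
      using pair_prod_iso[OF FP FQ i order_refl s, of q] F[OF s] F[of "verts P - s"] by simp
  qed
  finally show ?thesis by simp
qed

lemma forest_on_union:
  assumes P: "is_forest P" and st: "s \<union> t \<subseteq> verts P" "s \<inter> t = {}"
    and sep: "\<And>x y. x \<in> s \<Longrightarrow> y \<in> t \<Longrightarrow> \<not> lt P x y \<and> \<not> lt P y x"
  shows "forest_on P (s \<union> t) = forest_on P s + forest_on P t"
proof -
  define A where "A b = (if b then s else t)" for b
  have "forest_on P (s \<union> t) = (\<Sum>b\<in>UNIV. forest_of (induced (induced P (s \<union> t)) (A b)))"
  proof (rule forest_of_separated_UN[OF is_forest_induced[OF P st(1)]])
    show "verts (induced P (s \<union> t)) = (\<Union>b\<in>UNIV. A b)" by (auto simp: A_def UNIV_bool)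
    show "disjoint_family_on A UNIV" using st(2) by (auto simp: disjoint_family_on_def A_def)
    fix b c :: bool and x y assume b: "b \<noteq> c" "x \<in> A b" "y \<in> A c"
    then have "x \<noteq> y" using st(2) by (auto simp: A_def split: if_splits)
    moreover have "\<not> lt P x y" using b sep by (auto simp: A_def split: if_splits)
    ultimately show "(x, y) \<notin> ord (induced P (s \<union> t))" by (simp add: lt_def ord_induced)
  qed simp
  then show ?thesis
    using forest_of_induced_induced[OF P st(1)] by (simp add: A_def UNIV_bool add.commute)
qed

text \<open>A subset of \<open>A \<union> B\<close> is a pair of subsets; without relations between
  \<open>A\<close> and \<open>B\<close>, subforests add and weights multiply.\<close>

lemma delta_union:
  assumes P: "P \<in> nforest_posets n" and V: "verts P = A \<union> B" and AB: "A \<inter> B = {}"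
    and sep: "\<And>x y. x \<in> A \<Longrightarrow> y \<in> B \<Longrightarrow> \<not> lt P x y \<and> \<not> lt P y x"
  shows "delta n q P = delta n q (induced P A) * delta n q (induced P B)"
proof -
  have A: "A \<subseteq> verts P" and B: "B \<subseteq> verts P" using V by auto
  note F = nforest_posetsD(1)[OF P]
  have "delta n q (induced P A) * delta n q (induced P B) =
      (\<Sum>(s, t)\<in>Pow A \<times> Pow B. scale (pair_prod q P A s * pair_prod q P B t)
        (basis (forest_on P s + forest_on P t, forest_on P (A - s) + forest_on P (B - t))))"
    unfolding delta_induced[OF P A] delta_induced[OF P B] sum_product sum.cartesian_product
    by (intro sum.cong refl) (auto simp: scale_mult scale_simps mult_single mult_ac)
  also have "\<dots> = (\<Sum>s\<in>Pow (A \<union> B). scale (pair_prod q P (A \<union> B) s)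
        (basis (forest_on P s, forest_on P (A \<union> B - s))))"
  proof (rule sum.reindex_bij_witness[of _ "\<lambda>s. (s \<inter> A, s \<inter> B)" "\<lambda>(s, t). s \<union> t"])
    fix p assume "p \<in> Pow A \<times> Pow B"
    then obtain s t where p: "p = (s, t)" and st: "s \<subseteq> A" "t \<subseteq> B" by auto
    have eq: "(s \<union> t) \<inter> A = s" "(s \<union> t) \<inter> B = t" "A \<union> B - (s \<union> t) = (A - s) \<union> (B - t)"
      using st AB by blast+
    show "(case p of (s, t) \<Rightarrow> s \<union> t) \<in> Pow (A \<union> B)" using st p by auto
    show "((case p of (s, t) \<Rightarrow> s \<union> t) \<inter> A, (case p of (s, t) \<Rightarrow> s \<union> t) \<inter> B) = p" using eq p by simp
    have 1: "forest_on P (s \<union> t) = forest_on P s + forest_on P t"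
    proof (rule forest_on_union[OF F])
      show "s \<union> t \<subseteq> verts P" "s \<inter> t = {}" using st V AB by blast+
      show "\<not> lt P x y \<and> \<not> lt P y x" if "x \<in> s" "y \<in> t" for x y using st that by (intro sep) blast+
    qed
    have 2: "forest_on P (A \<union> B - (s \<union> t)) = forest_on P (A - s) + forest_on P (B - t)"
      unfolding eq(3)
    proof (rule forest_on_union[OF F])
      show "A - s \<union> (B - t) \<subseteq> verts P" "(A - s) \<inter> (B - t) = {}" using V AB by blast+
      show "\<not> lt P x y \<and> \<not> lt P y x" if "x \<in> A - s" "y \<in> B - t" for x y using that by (intro sep) blast+
    qed
    have 3: "pair_prod q P (A \<union> B) (s \<union> t) = pair_prod q P A s * pair_prod q P B t"
      using pair_prod_union[OF AB _ sep, of "s \<union> t" q] st eq by auto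
    show "scale (pair_prod q P (A \<union> B) (case p of (s, t) \<Rightarrow> s \<union> t))
        (basis (forest_on P (case p of (s, t) \<Rightarrow> s \<union> t),
          forest_on P (A \<union> B - (case p of (s, t) \<Rightarrow> s \<union> t)))) =
      (case p of (s, t) \<Rightarrow> scale (pair_prod q P A s * pair_prod q P B t)
        (basis (forest_on P s + forest_on P t, forest_on P (A - s) + forest_on P (B - t))))"
      unfolding p prod.case 1 2 3 by simp
  qed auto
  finally show ?thesis using delta_eq_pair_prod[OF P] V by simp
qed

text \<open>The splitting of the multiset of classes is lifted to the components themselves; the
  unions of the two groups of components realise \<open>f\<close> and \<open>g\<close> inside
  \<open>P\<close>.\<close>

lemma forest_of_eq_plusD:
  assumes P: "is_forest P" and eq: "forest_of P = f + g"
  obtains A B where "verts P = A \<union> B" "A \<inter> B = {}" "forest_on P A = f" "forest_on P B = g"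
    "\<And>x y. x \<in> A \<Longrightarrow> y \<in> B \<Longrightarrow> \<not> lt P x y \<and> \<not> lt P y x"
proof -
  let ?X = "verts P // connected_rel P" and ?F = "\<lambda>C. abs_ctree (induced P C)"
  obtain X Y where XY: "mset_set ?X = X + Y" "f = image_mset ?F X" "g = image_mset ?F Y"
    using image_mset_eq_plusD[OF eq[unfolded forest_of_def]] by blast
  \<comment> \<open>Each component occurs once, even if several have the same class. Hence the two
    multisets of components are disjoint sets.\<close>
  have cnt: "count X C + count Y C = (if C \<in> ?X then 1 else 0)" for C
    using arg_cong[OF XY(1), of "\<lambda>M. count M C"] finite_components[OF P] by (simp add: count_mset_set')
  have Xs: "X = mset_set (set_mset X)" and Ys: "Y = mset_set (set_mset Y)"
  proof -
    have eq: "Z = mset_set (set_mset Z)" if Z: "\<And>C. count Z C \<le> 1" for Z :: "nat set multiset"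
    proof (rule multiset_eqI)
      fix C show "count Z C = count (mset_set (set_mset Z)) C"
        using Z[of C] by (cases "C \<in># Z") (simp_all add: count_mset_set' not_in_iff le_antisym Suc_leI)
    qed
    have "count X C \<le> 1" "count Y C \<le> 1" for C using cnt[of C] by (auto split: if_splits)
    then show "X = mset_set (set_mset X)" "Y = mset_set (set_mset Y)" using eq by blast+
  qed
  have disj: "set_mset X \<inter> set_mset Y = {}"
  proof (rule ccontr)
    assume "set_mset X \<inter> set_mset Y \<noteq> {}"
    then obtain C where "C \<in># X" "C \<in># Y" by blast
    then have "count X C > 0" "count Y C > 0" by (simp_all only: count_greater_zero_iff)
    moreover have "count X C + count Y C \<le> 1" unfolding cnt by simp
    ultimately show False by linarith
  qed
  have un: "set_mset X \<union> set_mset Y = ?X"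
    using arg_cong[OF XY(1), of set_mset] finite_components[OF P] by simp
  have part: "forest_on P (\<Union>(set_mset Z)) = image_mset ?F Z"
    if Z: "Z = mset_set (set_mset Z)" "set_mset Z \<subseteq> ?X" for Z
  proof -
    have sub: "\<Union>(set_mset Z) \<subseteq> verts P" using Z(2) component_subset[OF P] by blast
    have "forest_on P (\<Union>(set_mset Z)) =
        (\<Sum>C\<in>set_mset Z. forest_of (induced (induced P (\<Union>(set_mset Z))) C))"
    proof (rule forest_of_separated_UN[OF is_forest_induced[OF P sub], where A = "\<lambda>C. C"])
      show "disjoint_family_on (\<lambda>C. C) (set_mset Z)"
        using disjoint_components[OF P] Z(2) by (auto simp: disjoint_family_on_def id_def)
      fix C D x y assume CD: "C \<in> set_mset Z" "D \<in> set_mset Z" "C \<noteq> D" "x \<in> C" "y \<in> D"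
      then have "C \<inter> D = {}"
        using disjoint_components[OF P] Z(2) by (auto simp: disjoint_family_on_def id_def)
      then have "y \<notin> C" using CD(5) by blast
      then show "(x, y) \<notin> ord (induced P (\<Union>(set_mset Z)))"
        using component_closed[OF P _ CD(4)] CD(1) Z(2) by (auto simp: ord_induced)
    qed simp_all
    also have "\<dots> = (\<Sum>C\<in>set_mset Z. {#?F C#})"
    proof (rule sum.cong[OF refl])
      fix C assume C: "C \<in> set_mset Z"
      then have "C \<subseteq> \<Union>(set_mset Z)" "C \<in> ?X" using Z(2) by blast+
      then show "forest_of (induced (induced P (\<Union>(set_mset Z))) C) = {#?F C#}"
        using forest_of_induced_induced[OF P sub, of C] forest_of_tree[OF component_tree(1)[OF P]] by simp
    qed
    also have "\<dots> = image_mset ?F Z" by (subst (2) Z(1)) (simp add: image_mset_set_eq_sum)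
    finally show ?thesis .
  qed
  show ?thesis
  proof (rule that[of "\<Union>(set_mset X)" "\<Union>(set_mset Y)"])
    show "verts P = \<Union>(set_mset X) \<union> \<Union>(set_mset Y)"
      using Union_components[OF P] un by (metis Union_Un_distrib)
    have d: "C \<inter> D = {}" if "C \<in># X" "D \<in># Y" for C D
    proof -
      have "C \<noteq> D" "C \<in> ?X" "D \<in> ?X" using that disj un by blast+
      then show ?thesis using disjoint_components[OF P] by (simp add: disjoint_family_on_def)
    qed
    then show "\<Union>(set_mset X) \<inter> \<Union>(set_mset Y) = {}" by blast
    show "forest_on P (\<Union>(set_mset X)) = f" using part[OF Xs] un XY(2) by auto
    show "forest_on P (\<Union>(set_mset Y)) = g" using part[OF Ys] un XY(3) by auto
    fix x y assume "x \<in> \<Union>(set_mset X)" "y \<in> \<Union>(set_mset Y)"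
    then obtain C D where CD: "C \<in># X" "x \<in> C" "D \<in># Y" "y \<in> D" by blast
    then have "y \<notin> C" "C \<in> ?X" using d[OF CD(1,3)] un by blast+
    then show "\<not> lt P x y \<and> \<not> lt P y x" using component_closed[OF P _ CD(2)] unfolding lt_def by blast
  qed
qed

text \<open>The representative is an arbitrary choice; \<open>delta_forest_of\<close> exchanges it
  for any other \<open>n\<close>-coloured one.\<close>

definition delta_forest ::
    "nat \<Rightarrow> (nat \<Rightarrow> nat \<Rightarrow> 'k::field_char_0) \<Rightarrow> cforest \<Rightarrow> (cforest \<times> cforest \<Rightarrow>\<^sub>0 'k)" where
  "delta_forest n q f = delta n q (forest_rep f)"

lemma delta_forest_of: "P \<in> nforest_posets n \<Longrightarrow> delta_forest n q (forest_of P) = delta n q P"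
  unfolding delta_forest_def
  using delta_cong forest_rep forest_rep_in_nforest_posets forest_of_in_nforests by metis

lemma nforests_add_iff: "f + g \<in> nforests n \<longleftrightarrow> f \<in> nforests n \<and> g \<in> nforests n"
  by (auto simp: nforests_def)

text \<open>The representative of \<open>f + g\<close> splits into parts representing
  \<open>f\<close> and \<open>g\<close>. These need not be the posets chosen by
  \<open>forest_rep\<close>, which is where independence of the representative enters.\<close>

lemma delta_forest_add:
  assumes "f \<in> nforests n" "g \<in> nforests n"
  shows "delta_forest n q (f + g) = delta_forest n q f * delta_forest n q g"
proof -
  define P where "P = forest_rep (f + g)"
  have P: "P \<in> nforest_posets n"
    unfolding P_def by (rule forest_rep_in_nforest_posets) (use assms nforests_add_iff in blast)
  have "forest_of P = f + g" by (simp add: P_def forest_rep)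
  then obtain A B where AB: "verts P = A \<union> B" "A \<inter> B = {}" "forest_on P A = f" "forest_on P B = g"
    "\<And>x y. x \<in> A \<Longrightarrow> y \<in> B \<Longrightarrow> \<not> lt P x y \<and> \<not> lt P y x"
    using forest_of_eq_plusD[OF nforest_posetsD(1)[OF P]] by metis
  have "delta n q (induced P A) = delta_forest n q f" "delta n q (induced P B) = delta_forest n q g"
    using delta_forest_of[OF induced_in_nforest_posets[OF P], of _ q] AB(1,3,4) by auto
  then show ?thesis
    using delta_union[OF P AB(1,2,5), of q] by (simp add: delta_forest_def P_def)
qed

lemma delta_empty:
  assumes "verts P = {}" shows "delta n q P = 1"
proof -
  have "delta n q P = basis ({#}, {#})"
    using assms by (simp add: delta_def qcoeff_def forest_of_empty scale_simps)
  also have "\<dots> = 1" by (subst single_one[symmetric]) (simp add: zero_prod_def)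
  finally show ?thesis .
qed

lemma delta_forest_empty: "delta_forest n q {#} = 1"
proof -
  have "card (verts (forest_rep {#})) = 0"
    using forest_size_forest_of[OF forest_rep(1), of "{#}"] by (simp add: forest_rep forest_size_def)
  then show ?thesis
    unfolding delta_forest_def using delta_empty finite_verts[OF forest_rep(1)] by simp
qed

lemma delta_in_ST2: "P \<in> nforest_posets n \<Longrightarrow> delta n q P \<in> ST2 n"
  unfolding ST2_def delta_def
proof (intro CollectI order.trans[OF keys_sum] UN_least)
  fix s assume P: "P \<in> nforest_posets n" and "s \<in> Pow (verts P)"
  then have "forest_on P s \<in> nforests n" "forest_on P (verts P - s) \<in> nforests n"
    using forest_of_in_nforests induced_in_nforest_posets by auto
  then show "Poly_Mapping.keys (scale (qcoeff n q s P)
      (basis (forest_on P s, forest_on P (verts P - s)))) \<subseteq> nforests n \<times> nforests n"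
    using keys_scale by fastforce
qed

section \<open>The coproduct\<close>

text \<open>A set of vertices other than the root is the same as a family of subsets of the
  branches. This merges the independent Sweedler choices into one subset.\<close>

lemma sum_Pow_branches:
  assumes T: "is_forest T" and n: "n_coloured n T" and r: "is_root T r"
  shows "(\<Sum>s\<in>Pow (verts T - {r}). H (\<lambda>i\<in>{1..n}. s \<inter> branch T r i)) =
    (\<Sum>\<sigma>\<in>Pi\<^sub>E {1..n} (\<lambda>i. Pow (branch T r i)). H \<sigma>)"
proof (rule sum.reindex_bij_witness[of _ "\<lambda>\<sigma>. \<Union>i\<in>{1..n}. \<sigma> i" "\<lambda>s. \<lambda>i\<in>{1..n}. s \<inter> branch T r i"])
  note U = UN_branches[OF T n r]
  fix s assume s: "s \<in> Pow (verts T - {r})"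
  have "(\<Union>i\<in>{1..n}. (\<lambda>i\<in>{1..n}. s \<inter> branch T r i) i) = s \<inter> (\<Union>i\<in>{1..n}. branch T r i)" by auto
  then show "(\<Union>i\<in>{1..n}. (\<lambda>i\<in>{1..n}. s \<inter> branch T r i) i) = s" using s U by auto
  show "(\<lambda>i\<in>{1..n}. s \<inter> branch T r i) \<in> Pi\<^sub>E {1..n} (\<lambda>i. Pow (branch T r i))" by auto
next
  note U = UN_branches[OF T n r]
  fix \<sigma> assume \<sigma>: "\<sigma> \<in> Pi\<^sub>E {1..n} (\<lambda>i. Pow (branch T r i))"
  have sub: "\<sigma> i \<subseteq> branch T r i" if "i \<in> {1..n}" for i using \<sigma> that by blast
  show "(\<Union>i\<in>{1..n}. \<sigma> i) \<in> Pow (verts T - {r})" unfolding U[symmetric] using sub by blast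
  show "(\<lambda>i\<in>{1..n}. (\<Union>i\<in>{1..n}. \<sigma> i) \<inter> branch T r i) = \<sigma>"
  proof (rule extensionalityI[of _ "{1..n}"])
    fix i assume i: "i \<in> {1..n}"
    have "\<sigma> j \<inter> branch T r i = {}" if "j \<in> {1..n}" "j \<noteq> i" for j
      using sub[OF that(1)] that(2) by (auto simp: branch_def)
    then have "(\<Union>i\<in>{1..n}. \<sigma> i) \<inter> branch T r i = \<sigma> i" using sub[OF i] i by blast
    then show "(\<lambda>i\<in>{1..n}. (\<Union>i\<in>{1..n}. \<sigma> i) \<inter> branch T r i) i = \<sigma> i" using i by simp
  qed (use \<sigma> in \<open>auto simp: PiE_def\<close>)
qed simp

text \<open>\<open>D\<close> is any map that takes the forests \<open>f i\<close> to the subforest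
  sums of the branches. This generality serves twice: to see that the subforest sum satisfies the
  recursion, and to compute an arbitrary coproduct by induction.\<close>

lemma coproduct_step_eq_delta:
  assumes T: "T \<in> nforest_posets n" and r: "is_root T r"
    and D: "\<And>i. i \<in> {1..n} \<Longrightarrow> D (basis (f i)) = delta n q (induced T (branch T r i))"
  shows "coproduct_step n q D f = delta n q T"
proof -
  let ?I = "{1..n}" and ?B = "branch T r" and ?U = "verts T - {r}"
  note FT = nforest_posetsD[OF T]
  define g where "g i s = (forest_on T s, forest_on T (?B i - s))" for i s
  define fam where "fam s = (\<lambda>i\<in>?I. s \<inter> ?B i)" for s
  \<comment> \<open>\<open>H1\<close> and \<open>H2\<close> are the terms of the two Sweedler sums
    without the structure coefficients, in the shape needed for \<open>sum_keys_PiE\<close>.\<close>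
  define H1 where "H1 p = scale (\<Prod>j=1..n. q 1 j ^ forest_size (fst (p j)))
      (basis (\<Sum>i=1..n. fst (p i), {#graft n (\<lambda>i. snd (p i))#}))" for p :: "nat \<Rightarrow> cforest \<times> cforest"
  define H2 where "H2 p = scale (\<Prod>j=1..n. q 2 j ^ forest_size (snd (p j)))
      (basis ({#graft n (\<lambda>i. fst (p i))#}, \<Sum>i=1..n. snd (p i)))" for p :: "nat \<Rightarrow> cforest \<times> cforest"
  define c where "c i s = pair_prod q T (?B i) s" for i s
  have fin: "finite (?B i)" for i using finite_subset[OF branch_subset finite_verts[OF FT(1)]] .
  have x: "D (basis (f i)) = (\<Sum>s\<in>Pow (?B i). scale (c i s) (basis (g i s)))" if "i \<in> ?I" for i
    using D[OF that] delta_induced[OF T branch_subset] by (simp add: g_def c_def)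
  have sweedler: "(\<Sum>p\<in>Pi\<^sub>E ?I (\<lambda>i. Poly_Mapping.keys (D (basis (f i)))).
        scale (\<Prod>i=1..n. Poly_Mapping.lookup (D (basis (f i))) (p i)) (H p)) =
      (\<Sum>s\<in>Pow ?U. scale (\<Prod>i=1..n. c i (s \<inter> ?B i)) (H (\<lambda>i\<in>?I. g i (s \<inter> ?B i))))"
    for H :: "(nat \<Rightarrow> cforest \<times> cforest) \<Rightarrow> (cforest \<times> cforest \<Rightarrow>\<^sub>0 'a)"
  proof -
    have "(\<Sum>p\<in>Pi\<^sub>E ?I (\<lambda>i. Poly_Mapping.keys (D (basis (f i)))).
        scale (\<Prod>i=1..n. Poly_Mapping.lookup (D (basis (f i))) (p i)) (H p)) =
      (\<Sum>\<sigma>\<in>Pi\<^sub>E ?I (\<lambda>i. Pow (?B i)). scale (\<Prod>i=1..n. c i (\<sigma> i)) (H (\<lambda>i\<in>?I. g i (\<sigma> i))))"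
      by (rule sum_keys_PiE) (use x fin in auto)
    also have "\<dots> = (\<Sum>s\<in>Pow ?U. scale (\<Prod>i=1..n. c i (fam s i)) (H (\<lambda>i\<in>?I. g i (fam s i))))"
      unfolding fam_def
      by (rule sum_Pow_branches[OF FT r, of "\<lambda>\<sigma>. scale (\<Prod>i=1..n. c i (\<sigma> i)) (H (\<lambda>i\<in>?I. g i (\<sigma> i)))",
            symmetric])
    also have "\<dots> = (\<Sum>s\<in>Pow ?U. scale (\<Prod>i=1..n. c i (s \<inter> ?B i)) (H (\<lambda>i\<in>?I. g i (s \<inter> ?B i))))"
      by (intro sum.cong refl arg_cong2[where f = scale] prod.cong arg_cong[where f = H] restrict_ext)
        (simp_all add: fam_def)
    finally show ?thesis .
  qed
  have "coproduct_step n q D f =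
      (\<Sum>p\<in>Pi\<^sub>E ?I (\<lambda>i. Poly_Mapping.keys (D (basis (f i)))).
        scale (\<Prod>i=1..n. Poly_Mapping.lookup (D (basis (f i))) (p i)) (H1 p)) +
      (\<Sum>p\<in>Pi\<^sub>E ?I (\<lambda>i. Poly_Mapping.keys (D (basis (f i)))).
        scale (\<Prod>i=1..n. Poly_Mapping.lookup (D (basis (f i))) (p i)) (H2 p))"
    unfolding coproduct_step_def Let_def H1_def H2_def by (simp add: scale_simps)
  also have "\<dots> =
      (\<Sum>s\<in>Pow ?U. scale (\<Prod>i=1..n. c i (s \<inter> ?B i)) (H1 (\<lambda>i\<in>?I. g i (s \<inter> ?B i)))) +
      (\<Sum>s\<in>Pow ?U. scale (\<Prod>i=1..n. c i (s \<inter> ?B i)) (H2 (\<lambda>i\<in>?I. g i (s \<inter> ?B i))))"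
    unfolding sweedler ..
  also have "(\<Sum>s\<in>Pow ?U. scale (\<Prod>i=1..n. c i (s \<inter> ?B i)) (H1 (\<lambda>i\<in>?I. g i (s \<inter> ?B i)))) =
      (\<Sum>s\<in>Pow ?U. scale (pair_prod q T (verts T) s) (basis (forest_on T s, forest_on T (verts T - s))))"
  proof (rule sum.cong[OF refl])
    fix s assume "s \<in> Pow ?U"
    then have s: "s \<subseteq> ?U" by simp
    have size: "forest_size (forest_on T (s \<inter> ?B j)) = card (s \<inter> ?B j)" for j
      using forest_size_forest_of[OF is_forest_induced[OF FT(1)]] branch_subset by (metis le_infI2 verts_induced)
    have "forest_on T (verts T - s) = {#graft n (\<lambda>i. snd ((\<lambda>i\<in>?I. g i (s \<inter> ?B i)) i))#}"
    proof (rule forest_of_induced_root[OF FT r])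
      show "verts T - s \<subseteq> verts T" "r \<in> verts T - s" using s r by (auto simp: is_root_def)
      fix i assume "i \<in> ?I"
      moreover have "(verts T - s) \<inter> ?B i = ?B i - s \<inter> ?B i" using branch_subset by blast
      ultimately show "forest_on T ((verts T - s) \<inter> ?B i) = snd ((\<lambda>i\<in>?I. g i (s \<inter> ?B i)) i)"
        by (simp add: g_def)
    qed
    moreover have "forest_on T s = (\<Sum>i=1..n. fst ((\<lambda>i\<in>?I. g i (s \<inter> ?B i)) i))"
      using forest_of_induced_no_root[OF FT r s] by (simp add: g_def)
    ultimately show "scale (\<Prod>i=1..n. c i (s \<inter> ?B i)) (H1 (\<lambda>i\<in>?I. g i (s \<inter> ?B i))) =
        scale (pair_prod q T (verts T) s) (basis (forest_on T s, forest_on T (verts T - s)))"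
      unfolding H1_def scale_simps pair_prod_root(1)[OF FT r s]
      by (simp add: c_def g_def size prod.distrib)
  qed
  also have "(\<Sum>s\<in>Pow ?U. scale (\<Prod>i=1..n. c i (s \<inter> ?B i)) (H2 (\<lambda>i\<in>?I. g i (s \<inter> ?B i)))) =
      (\<Sum>s\<in>Pow ?U. scale (pair_prod q T (verts T) (insert r s))
        (basis (forest_on T (insert r s), forest_on T (verts T - insert r s))))"
  proof (rule sum.cong[OF refl])
    fix s assume "s \<in> Pow ?U"
    then have s: "s \<subseteq> ?U" by simp
    have d: "?B j - s \<inter> ?B j = ?B j - s" for j by blast
    have size: "forest_size (forest_on T (?B j - s)) = card (?B j - s)" for j
      using forest_size_forest_of[OF is_forest_induced[OF FT(1)], of "?B j - s"] branch_subset by fastforce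
    have "forest_on T (insert r s) = {#graft n (\<lambda>i. fst ((\<lambda>i\<in>?I. g i (s \<inter> ?B i)) i))#}"
    proof (rule forest_of_induced_root[OF FT r])
      show "insert r s \<subseteq> verts T" "r \<in> insert r s" using s r by (auto simp: is_root_def)
      fix i assume "i \<in> ?I"
      moreover have "insert r s \<inter> ?B i = s \<inter> ?B i" by (auto simp: branch_def)
      ultimately show "forest_on T (insert r s \<inter> ?B i) = fst ((\<lambda>i\<in>?I. g i (s \<inter> ?B i)) i)"
        by (simp add: g_def)
    qed
    moreover have "forest_on T (verts T - insert r s) = (\<Sum>i=1..n. snd ((\<lambda>i\<in>?I. g i (s \<inter> ?B i)) i))"
    proof -
      have "(verts T - insert r s) \<inter> ?B i = ?B i - s" for i by (auto simp: branch_def)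
      moreover have "verts T - insert r s \<subseteq> ?U" by blast
      ultimately show ?thesis
        using forest_of_induced_no_root[OF FT r, of "verts T - insert r s"] by (simp add: g_def d)
    qed
    ultimately show "scale (\<Prod>i=1..n. c i (s \<inter> ?B i)) (H2 (\<lambda>i\<in>?I. g i (s \<inter> ?B i))) =
        scale (pair_prod q T (verts T) (insert r s))
          (basis (forest_on T (insert r s), forest_on T (verts T - insert r s)))"
      unfolding H2_def scale_simps pair_prod_root(2)[OF FT r s]
      by (simp add: c_def g_def d size prod.distrib)
  qed
  also have "(\<Sum>s\<in>Pow ?U. scale (pair_prod q T (verts T) s)
        (basis (forest_on T s, forest_on T (verts T - s)))) +
      (\<Sum>s\<in>Pow ?U. scale (pair_prod q T (verts T) (insert r s))
        (basis (forest_on T (insert r s), forest_on T (verts T - insert r s)))) = delta n q T"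
  proof -
    have V: "verts T = insert r ?U" using r by (auto simp: is_root_def)
    have inj: "inj_on (insert r) (Pow ?U)" by (auto simp: inj_on_def)
    have "delta n q T = (\<Sum>s\<in>Pow ?U \<union> insert r ` Pow ?U. scale (pair_prod q T (verts T) s)
        (basis (forest_on T s, forest_on T (verts T - s))))"
      unfolding delta_eq_pair_prod[OF T] using Pow_insert[of r ?U] V by simp
    also have "\<dots> = (\<Sum>s\<in>Pow ?U. scale (pair_prod q T (verts T) s)
        (basis (forest_on T s, forest_on T (verts T - s)))) +
      (\<Sum>s\<in>insert r ` Pow ?U. scale (pair_prod q T (verts T) s)
        (basis (forest_on T s, forest_on T (verts T - s))))"
      by (rule sum.union_disjoint) (use finite_verts[OF FT(1)] in auto)
    finally show ?thesis unfolding sum.reindex[OF inj] by simp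
  qed
  finally show ?thesis .
qed

section \<open>Existence and uniqueness of the coproduct\<close>

lemma ST_closed:
  "0 \<in> ST n" "1 \<in> ST n" "f \<in> nforests n \<Longrightarrow> basis f \<in> ST n"
  "x \<in> ST n \<Longrightarrow> y \<in> ST n \<Longrightarrow> x + y \<in> ST n"
  "x \<in> ST n \<Longrightarrow> scale c x \<in> ST n"
  "x \<in> ST n \<Longrightarrow> y \<in> ST n \<Longrightarrow> x * y \<in> ST n"
proof -
  show "0 \<in> ST n" "1 \<in> ST n" by (simp_all add: ST_def nforests_def)
  show "f \<in> nforests n \<Longrightarrow> basis f \<in> ST n" by (simp add: ST_def)
  show "x \<in> ST n \<Longrightarrow> y \<in> ST n \<Longrightarrow> x + y \<in> ST n"
    using keys_add[of x y] by (auto simp: ST_def)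
  show "x \<in> ST n \<Longrightarrow> scale c x \<in> ST n" using keys_scale[of c x] by (auto simp: ST_def)
  show "x \<in> ST n \<Longrightarrow> y \<in> ST n \<Longrightarrow> x * y \<in> ST n"
    using keys_mult[of x y] nforests_add_iff[of _ _ n] by (fastforce simp: ST_def)
qed

lemma ST_sum: "(\<And>a. a \<in> A \<Longrightarrow> f a \<in> ST n) \<Longrightarrow> sum f A \<in> ST n"
  by (induction A rule: infinite_finite_induct) (simp_all add: ST_closed)

lemma lin_in_ST: "(\<And>a. a \<in> Poly_Mapping.keys x \<Longrightarrow> g a \<in> ST n) \<Longrightarrow> lin g x \<in> ST n"
  unfolding lin_def by (intro ST_sum ST_closed)

text \<open>\<open>is_coproduct\<close> and \<open>is_antipode\<close> demand extensional functions
  on \<open>ST n\<close>, which makes the descriptions unique; the candidates are restricted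
  accordingly.\<close>

lemma linear_map_on_restrict:
  "linear_map_on (ST n) g \<Longrightarrow> linear_map_on (ST n) (restrict g (ST n))"
  by (simp add: linear_map_on_def ST_closed)

lemma lin_delta_forest_in_ST2:
  assumes "x \<in> ST n" shows "lin (delta_forest n q) x \<in> ST2 n"
  unfolding ST2_def lin_def
proof (intro CollectI order.trans[OF keys_sum] UN_least)
  fix f assume "f \<in> Poly_Mapping.keys x"
  then have "f \<in> nforests n" using assms by (auto simp: ST_def)
  then have "delta_forest n q f \<in> ST2 n"
    unfolding delta_forest_def by (rule delta_in_ST2[OF forest_rep_in_nforest_posets])
  then have "Poly_Mapping.keys (delta_forest n q f) \<subseteq> nforests n \<times> nforests n" by (simp add: ST2_def)
  then show "Poly_Mapping.keys (scale (Poly_Mapping.lookup x f) (delta_forest n q f)) \<subseteq> nforests n \<times> nforests n"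
    by (rule order.trans[OF keys_scale])
qed

text \<open>The recursion is verified on the tree supplied by \<open>graft_exists\<close>, where
  both sides become the same subforest sum.\<close>

lemma is_coproduct_lin_delta_forest: "is_coproduct n q (restrict (lin (delta_forest n q)) (ST n))"
  (is "is_coproduct n q ?D")
  unfolding is_coproduct_def
proof (intro conjI allI impI ballI)
  show "?D \<in> ST n \<rightarrow>\<^sub>E ST2 n" using lin_delta_forest_in_ST2 by auto
  show "linear_map_on (ST n) ?D" by (rule linear_map_on_restrict[OF linear_map_on_lin])
  show "?D 1 = 1" using lin_basis[of "delta_forest n q" "{#}"] by (simp add: ST_closed delta_forest_empty)
  show "?D (x * y) = ?D x * ?D y" if "x \<in> ST n" "y \<in> ST n" for x y
  proof -
    have "lin (delta_forest n q) (x * y) = lin (delta_forest n q) x * lin (delta_forest n q) y"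
      by (rule lin_mult, rule delta_forest_add) (use that in \<open>auto simp: ST_def\<close>)
    then show ?thesis using that by (simp add: ST_closed)
  qed
  fix f assume "\<forall>i\<in>{1..n}. f i \<in> nforests n"
  then have f: "\<And>i. i \<in> {1..n} \<Longrightarrow> f i \<in> nforests n" by blast
  obtain T r where T: "T \<in> nforest_posets n" "is_root T r" "forest_of T = {#graft n f#}"
    "\<And>i. i \<in> {1..n} \<Longrightarrow> forest_on T (branch T r i) = f i"
    using graft_exists[of n f, OF f] by metis
  have "coproduct_step n q ?D f = delta n q T"
  proof (rule coproduct_step_eq_delta[OF T(1,2)])
    fix i assume i: "i \<in> {1..n}"
    have "?D (basis (f i)) = delta_forest n q (f i)" using f[OF i] by (simp add: ST_closed lin_basis)
    then show "?D (basis (f i)) = delta n q (induced T (branch T r i))"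
      using delta_forest_of[OF induced_in_nforest_posets[OF T(1) branch_subset], of q] T(4)[OF i] by metis
  qed
  moreover have "?D (basis {#graft n f#}) = delta n q T"
    using delta_forest_of[OF T(1), of q] forest_of_in_nforests[OF T(1)]
    by (simp add: T(3) ST_closed lin_basis)
  ultimately show "?D (basis {#graft n f#}) = coproduct_step n q ?D f" by simp
qed

lemma forest_size_add: "forest_size (f + g) = forest_size f + forest_size g"
  by (simp add: forest_size_def)

lemma forest_size_eq_0_iff: "forest_size f = 0 \<longleftrightarrow> f = {#}"
proof
  assume "forest_size f = 0"
  then have "verts (forest_rep f) = {}"
    using forest_size_forest_of[OF forest_rep(1)] finite_verts[OF forest_rep(1)] by (simp add: forest_rep)
  then show "f = {#}" using forest_of_empty forest_rep(2) by metis
qed (simp add: forest_size_def)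

text \<open>Induction on the number of vertices. Multiplicativity splits a forest with several trees
  into smaller forests; a single tree is the graft of its branches, which are smaller because they
  lack the root.\<close>

lemma is_coproduct_basis:
  assumes D: "is_coproduct n q D" and "f \<in> nforests n"
  shows "D (basis f) = delta_forest n q f"
  using assms(2)
proof (induction "forest_size f" arbitrary: f rule: less_induct)
  case less
  consider "f = {#}" | t where "f = {#t#}" | t g where "f = {#t#} + g" "g \<noteq> {#}"
    by (metis add_mset_add_single multi_nonempty_split union_commute)
  then show ?case
  proof cases
    case 1
    then show ?thesis using D by (simp add: is_coproduct_def delta_forest_empty)
  next
    case (3 t g)
    have n: "{#t#} \<in> nforests n" "g \<in> nforests n" using less.prems unfolding 3(1) nforests_add_iff by blast+
    have "forest_size {#t#} > 0" "forest_size g > 0"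
      using forest_size_eq_0_iff[of "{#t#}"] forest_size_eq_0_iff[of g] 3(2) by auto
    then have "forest_size {#t#} < forest_size f" "forest_size g < forest_size f"
      unfolding 3(1) forest_size_add by simp_all
    then have IH: "D (basis {#t#}) = delta_forest n q {#t#}" "D (basis g) = delta_forest n q g"
      using less.hyps n by blast+
    have "D (basis f) = D (basis {#t#} * basis g)" by (simp add: 3 mult_single)
    also have "\<dots> = D (basis {#t#}) * D (basis g)" using D n by (simp add: is_coproduct_def ST_closed)
    finally show ?thesis using delta_forest_add[OF n, of q] IH 3 by simp
  next
    case (2 t)
    then have "t \<in> ntrees n" using less.prems by (simp add: nforests_def)
    then obtain T where T: "t = abs_ctree T" "is_tree T" "n_coloured n T" by (auto simp: ntrees_def)
    then have P: "T \<in> nforest_posets n" "is_forest T"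
      by (simp_all add: nforest_posets_def is_tree_is_forest)
    obtain r where r: "is_root T r" using T(2) is_tree_iff by blast
    have fT: "f = forest_of T" using 2 T forest_of_tree by simp
    define h where "h i = forest_on T (branch T r i)" for i
    have hn: "h i \<in> nforests n" for i
      unfolding h_def by (rule forest_of_in_nforests[OF induced_in_nforest_posets[OF P(1) branch_subset]])
    have "forest_size (h i) < forest_size f" for i
    proof -
      have "branch T r i \<subset> verts T" using r branch_subset by (auto simp: is_root_def branch_def)
      then have "card (branch T r i) < card (verts T)" by (rule psubset_card_mono[OF finite_verts[OF P(2)]])
      then show ?thesis
        using forest_size_forest_of[OF is_forest_induced[OF P(2) branch_subset], of r i]
          forest_size_forest_of[OF P(2)] fT by (simp add: h_def)
    qed
    then have "D (basis (h i)) = delta n q (induced T (branch T r i))" for i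
      using less.hyps[OF _ hn] delta_forest_of[OF induced_in_nforest_posets[OF P(1) branch_subset], of q r i]
      by (simp add: h_def)
    then have "coproduct_step n q D h = delta n q T" by (rule coproduct_step_eq_delta[OF P(1) r])
    moreover have "t = graft n h" unfolding T(1) by (rule tree_eq_graft[OF P(2) T(3) r]) (simp add: h_def)
    ultimately show ?thesis
      using D hn 2 delta_forest_of[OF P(1), of q] fT by (simp add: is_coproduct_def)
  qed
qed

lemma coproduct_eq:
  fixes q :: "nat \<Rightarrow> nat \<Rightarrow> 'k::field_char_0"
  shows "coproduct n q = restrict (lin (delta_forest n q)) (ST n)"
  unfolding coproduct_def
proof (rule the_equality)
  show "is_coproduct n q (restrict (lin (delta_forest n q)) (ST n))" by (rule is_coproduct_lin_delta_forest)
  fix D assume D: "is_coproduct n q D"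
  show "D = restrict (lin (delta_forest n q)) (ST n)"
  proof (rule extensionalityI[of _ "ST n :: (cforest \<Rightarrow>\<^sub>0 'k) set"])
    show "D \<in> extensional (ST n)" using D by (auto simp: is_coproduct_def PiE_def)
    fix x :: "cforest \<Rightarrow>\<^sub>0 'k" assume x: "x \<in> ST n"
    then have "D x = lin (\<lambda>f. D (basis f)) x"
      using linear_map_on_eq_lin[of "nforests n" D x] D by (simp add: is_coproduct_def ST_def)
    also have "\<dots> = lin (delta_forest n q) x"
      by (rule lin_cong) (use x is_coproduct_basis[OF D] in \<open>auto simp: ST_def\<close>)
    finally show "D x = restrict (lin (delta_forest n q)) (ST n) x" using x by simp
  qed simp
qed

lemma coproduct_forest_of:
  "P \<in> nforest_posets n \<Longrightarrow> coproduct n q (basis (forest_of P)) = delta n q P"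
  by (simp add: coproduct_eq forest_of_in_nforests ST_closed lin_basis delta_forest_of)

section \<open>The antipode\<close>

lemma convolution_eq_lin:
  "convolution D X Y x = lin (\<lambda>(a, b). X (basis a) * Y (basis b)) (D x)"
  unfolding convolution_def lin_def by (intro sum.cong refl) auto

text \<open>Functions of subsets stand for linear maps evaluated at the subforests of
  \<open>P\<close>. By \<open>convolution_basis\<close>, the value at \<open>A\<close> is the
  convolution of these maps at the forest on \<open>A\<close>.\<close>

definition conv ::
    "(nat \<Rightarrow> nat \<Rightarrow> 'k::field_char_0) \<Rightarrow> cposet \<Rightarrow> (nat set \<Rightarrow> (cforest \<Rightarrow>\<^sub>0 'k)) \<Rightarrow>
     (nat set \<Rightarrow> (cforest \<Rightarrow>\<^sub>0 'k)) \<Rightarrow> nat set \<Rightarrow> (cforest \<Rightarrow>\<^sub>0 'k)" where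
  "conv q P F G A = (\<Sum>s\<in>Pow A. scale (pair_prod q P A s) (F s * G (A - s)))"

definition conv_unit :: "nat set \<Rightarrow> (cforest \<Rightarrow>\<^sub>0 'k::field_char_0)" where
  "conv_unit A = (if A = {} then 1 else 0)"

lemma conv_cong:
  "(\<And>s. s \<subseteq> A \<Longrightarrow> F s = F' s) \<Longrightarrow> (\<And>s. s \<subseteq> A \<Longrightarrow> G s = G' s) \<Longrightarrow> conv q P F G A = conv q P F' G' A"
  unfolding conv_def by (intro sum.cong refl) auto

lemma conv_unit_left: "finite A \<Longrightarrow> conv q P conv_unit F A = F A"
  unfolding conv_def conv_unit_def
  by (subst sum.mono_neutral_right[of _ "{{}}"]) (auto simp: scale_simps pair_prod_trivial)

lemma conv_unit_right: "finite A \<Longrightarrow> conv q P F conv_unit A = F A"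
  unfolding conv_def conv_unit_def
  by (subst sum.mono_neutral_right[of _ "{A}"]) (auto simp: scale_simps pair_prod_trivial)

text \<open>Both sides sum over chains \<open>s \<subseteq> u \<subseteq> A\<close>, that is, over
  ordered splittings of \<open>A\<close> into three possibly empty blocks; the cocycle identity
  matches the weights.\<close>

lemma conv_assoc:
  assumes A: "finite A"
  shows "conv q P (conv q P F G) H A = conv q P F (conv q P G H) A"
proof -
  have fin: "finite s" if "s \<in> Pow A" for s using that A finite_subset by auto
  have "conv q P (conv q P F G) H A = (\<Sum>(u, s)\<in>Sigma (Pow A) Pow.
      scale (pair_prod q P A u * pair_prod q P u s) (F s * G (u - s) * H (A - u)))"
    unfolding conv_def
    by (subst sum.Sigma[symmetric])
      (use A fin in \<open>auto simp: sum_distrib_right scale_sum scale_mult scale_simps\<close>)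
  also have "\<dots> = (\<Sum>(s, t)\<in>Sigma (Pow A) (\<lambda>s. Pow (A - s)).
      scale (pair_prod q P A s * pair_prod q P (A - s) t) (F s * (G t * H (A - s - t))))"
  proof (rule sum.reindex_bij_witness[of _ "\<lambda>(s, t). (s \<union> t, s)" "\<lambda>(u, s). (s, u - s)"])
    fix p assume "p \<in> Sigma (Pow A) Pow"
    then obtain u s where p: "p = (u, s)" and us: "u \<subseteq> A" "s \<subseteq> u" by auto
    have "s \<union> (u - s) = u" "A - s - (u - s) = A - u" using us by blast+
    moreover have "pair_prod q P A s * pair_prod q P (A - s) (u - s) =
        pair_prod q P A (s \<union> (u - s)) * pair_prod q P (s \<union> (u - s)) s"
      by (rule pair_prod_cocycle) (use us in auto)
    ultimately show "(case case p of (u, s) \<Rightarrow> (s, u - s) of (s, t) \<Rightarrow>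
        scale (pair_prod q P A s * pair_prod q P (A - s) t) (F s * (G t * H (A - s - t)))) =
      (case p of (u, s) \<Rightarrow>
        scale (pair_prod q P A u * pair_prod q P u s) (F s * G (u - s) * H (A - u)))"
      by (simp add: p mult.assoc)
  qed auto
  also have "\<dots> = conv q P F (conv q P G H) A"
    unfolding conv_def
    by (subst sum.Sigma[symmetric])
      (use A fin in \<open>auto simp: sum_distrib_left scale_sum scale_mult scale_simps\<close>)
  finally show ?thesis .
qed

lemma UN_nth_Cons: "(\<Union>i<Suc m. (s # ss) ! i) = s \<union> (\<Union>i<m. ss ! i)"
  by (simp add: lessThan_Suc_eq_insert_0 image_image)

text \<open>Splitting off the first block reproduces the recursion that defines
  \<open>antipode_part\<close>.\<close>

lemma ordered_partitions_Suc:
  "ordered_partitions A (Suc m) =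
    (\<lambda>(s, ss). s # ss) ` Sigma (Pow A - {{}}) (\<lambda>s. ordered_partitions (A - s) m)"
proof (intro subset_antisym subsetI)
  fix xs assume "xs \<in> ordered_partitions A (Suc m)"
  then have x: "length xs = Suc m" "\<And>i. i < Suc m \<Longrightarrow> xs ! i \<noteq> {}"
    "\<And>i j. i < Suc m \<Longrightarrow> j < Suc m \<Longrightarrow> i \<noteq> j \<Longrightarrow> xs ! i \<inter> xs ! j = {}" "(\<Union>i<Suc m. xs ! i) = A"
    unfolding ordered_partitions_def by auto
  obtain s ss where xs: "xs = s # ss" using x(1) by (cases xs) auto
  have un: "s \<union> (\<Union>i<m. ss ! i) = A" using x(4) unfolding xs UN_nth_Cons .
  have "s \<inter> ss ! i = {}" if "i < m" for i using x(3)[of 0 "Suc i"] that xs by simp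
  then have "s \<inter> (\<Union>i<m. ss ! i) = {}" by blast
  with un have "(\<Union>i<m. ss ! i) = A - s" "s \<subseteq> A" by blast+
  moreover have "s \<noteq> {}" using x(2)[of 0] xs by simp
  moreover have "ss ! i \<noteq> {}" if "i < m" for i using x(2)[of "Suc i"] that xs by simp
  moreover have "ss ! i \<inter> ss ! j = {}" if "i < m" "j < m" "i \<noteq> j" for i j
    using x(3)[of "Suc i" "Suc j"] that xs by simp
  ultimately have "(s, ss) \<in> Sigma (Pow A - {{}}) (\<lambda>s. ordered_partitions (A - s) m)"
    using x(1) xs by (auto simp: ordered_partitions_def)
  then show "xs \<in> (\<lambda>(s, ss). s # ss) ` Sigma (Pow A - {{}}) (\<lambda>s. ordered_partitions (A - s) m)"
    unfolding xs by (intro image_eqI) auto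
next
  fix xs assume "xs \<in> (\<lambda>(s, ss). s # ss) ` Sigma (Pow A - {{}}) (\<lambda>s. ordered_partitions (A - s) m)"
  then obtain s ss where xs: "xs = s # ss" "s \<subseteq> A" "s \<noteq> {}" and ss: "ss \<in> ordered_partitions (A - s) m"
    by auto
  have un: "(\<Union>i<m. ss ! i) = A - s" and dj: "\<And>i j. i < m \<Longrightarrow> j < m \<Longrightarrow> i \<noteq> j \<Longrightarrow> ss ! i \<inter> ss ! j = {}"
    and ne: "\<And>i. i < m \<Longrightarrow> ss ! i \<noteq> {}" and len: "length ss = m"
    using ss by (auto simp: ordered_partitions_def)
  have "xs ! i \<noteq> {}" if "i < Suc m" for i using that xs ne by (cases i) auto
  moreover have "xs ! i \<inter> xs ! j = {}" if "i < Suc m" "j < Suc m" "i \<noteq> j" for i j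
  proof -
    have "s \<inter> ss ! k = {}" if "k < m" for k using un that by blast
    then show ?thesis using that xs dj by (cases i; cases j) auto
  qed
  moreover have "(\<Union>i<Suc m. xs ! i) = A" using un xs(2) unfolding xs(1) UN_nth_Cons by blast
  ultimately show "xs \<in> ordered_partitions A (Suc m)"
    using xs len unfolding ordered_partitions_def by simp
qed

lemma finite_ordered_partitions: "finite A \<Longrightarrow> finite (ordered_partitions A m)"
proof (induction m arbitrary: A)
  case 0
  have "ordered_partitions A 0 \<subseteq> {[]}" by (auto simp: ordered_partitions_def)
  then show ?case using finite_subset by blast
next
  case (Suc m)
  then show ?case unfolding ordered_partitions_Suc by (intro finite_imageI finite_SigmaI) auto
qed

text \<open>The summand of the antipode formula belonging to partitions into \<open>m\<close> blocks, obtained from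
  the coproduct by splitting off the first block. Phrased on forests, it is visibly independent of
  the poset that represents the forest.\<close>

primrec antipode_part ::
    "nat \<Rightarrow> (nat \<Rightarrow> nat \<Rightarrow> 'k::field_char_0) \<Rightarrow> nat \<Rightarrow> cforest \<Rightarrow> (cforest \<Rightarrow>\<^sub>0 'k)" where
  "antipode_part n q 0 f = (if f = {#} then 1 else 0)"
| "antipode_part n q (Suc m) f =
     - lin (\<lambda>(a, b). if a = {#} then 0 else basis a * antipode_part n q m b) (delta_forest n q f)"

text \<open>There cannot be more blocks than vertices, so the sum stops at the size. The term
  \<open>m = 0\<close> supplies the value 1 on the empty forest and vanishes otherwise.\<close>

definition antipode_forest ::
    "nat \<Rightarrow> (nat \<Rightarrow> nat \<Rightarrow> 'k::field_char_0) \<Rightarrow> cforest \<Rightarrow> (cforest \<Rightarrow>\<^sub>0 'k)" where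
  "antipode_forest n q f = (\<Sum>m\<le>forest_size f. antipode_part n q m f)"

context
  fixes n :: nat and q :: "nat \<Rightarrow> nat \<Rightarrow> 'k::field_char_0" and P :: cposet
  assumes P: "P \<in> nforest_posets n"
begin

lemma forest_size_forest_on: "A \<subseteq> verts P \<Longrightarrow> forest_size (forest_on P A) = card A"
  using forest_size_forest_of[OF is_forest_induced[OF nforest_posetsD(1)[OF P]]] by simp

lemma finite_subset_verts: "A \<subseteq> verts P \<Longrightarrow> finite A"
  using finite_subset finite_verts[OF nforest_posetsD(1)[OF P]] by blast

lemma forest_on_eq_empty_iff: "A \<subseteq> verts P \<Longrightarrow> forest_on P A = {#} \<longleftrightarrow> A = {}"
  using forest_size_eq_0_iff[of "forest_on P A"] forest_size_forest_on finite_subset_verts by simp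

lemma forest_on_in_nforests: "A \<subseteq> verts P \<Longrightarrow> forest_on P A \<in> nforests n"
  using forest_of_in_nforests induced_in_nforest_posets P by blast

lemma lin_delta_forest_on:
  assumes A: "A \<subseteq> verts P"
  shows "lin g (delta_forest n q (forest_on P A)) =
    (\<Sum>s\<in>Pow A. scale (pair_prod q P A s) (g (forest_on P s, forest_on P (A - s))))"
  unfolding delta_forest_of[OF induced_in_nforest_posets[OF P A]] delta_induced[OF P A]
  by (simp add: lin_sum lin_scale lin_basis)

lemma antipode_part_Suc:
  assumes A: "A \<subseteq> verts P"
  shows "antipode_part n q (Suc m) (forest_on P A) =
    - (\<Sum>s\<in>Pow A - {{}}. scale (pair_prod q P A s)
        (basis (forest_on P s) * antipode_part n q m (forest_on P (A - s))))"
proof -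
  have "(\<Sum>s\<in>Pow A. scale (pair_prod q P A s)
        (if forest_on P s = {#} then 0 else basis (forest_on P s) * antipode_part n q m (forest_on P (A - s)))) =
      (\<Sum>s\<in>Pow A - {{}}. scale (pair_prod q P A s)
        (basis (forest_on P s) * antipode_part n q m (forest_on P (A - s))))"
  proof (rule sum.mono_neutral_cong_right)
    show "finite (Pow A)" using finite_subset_verts[OF A] by simp
    fix s assume "s \<in> Pow A - {{}}"
    then have "forest_on P s \<noteq> {#}" using forest_on_eq_empty_iff[of s] A by auto
    then show "scale (pair_prod q P A s)
        (if forest_on P s = {#} then 0 else basis (forest_on P s) * antipode_part n q m (forest_on P (A - s))) =
      scale (pair_prod q P A s) (basis (forest_on P s) * antipode_part n q m (forest_on P (A - s)))"
      by simp
  qed (auto simp: scale_simps forest_of_empty)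
  then show ?thesis by (simp add: lin_delta_forest_on[OF A])
qed

lemma antipode_part_0: "A \<subseteq> verts P \<Longrightarrow> antipode_part n q 0 (forest_on P A) = conv_unit A"
  by (simp add: forest_on_eq_empty_iff conv_unit_def)

text \<open>Each of the \<open>m\<close> steps of the recursion removes at least one vertex.\<close>

lemma antipode_part_eq_0:
  assumes "A \<subseteq> verts P" "card A < m"
  shows "antipode_part n q m (forest_on P A) = 0"
  using assms
proof (induction m arbitrary: A)
  case (Suc m)
  have "antipode_part n q m (forest_on P (A - s)) = 0" if "s \<in> Pow A - {{}}" for s
  proof (rule Suc.IH)
    show "A - s \<subseteq> verts P" using Suc.prems by blast
    have "card (A - s) < card A"
      by (rule psubset_card_mono) (use that finite_subset_verts[OF Suc.prems(1)] in auto)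
    then show "card (A - s) < m" using Suc.prems(2) by simp
  qed
  then show ?case unfolding antipode_part_Suc[OF Suc.prems(1)] by (simp add: scale_simps)
qed simp

text \<open>Any larger bound gives the same sum, so subsets of different sizes can share one
  summation range.\<close>

lemma antipode_forest_on:
  assumes A: "A \<subseteq> verts P" and N: "card A \<le> N"
  shows "antipode_forest n q (forest_on P A) = (\<Sum>m\<le>N. antipode_part n q m (forest_on P A))"
  unfolding antipode_forest_def forest_size_forest_on[OF A]
  by (rule sum.mono_neutral_left) (use N antipode_part_eq_0[OF A] in auto)

text \<open>The summand with empty first factor is the antipode at \<open>A\<close> itself, and the
  recursion makes it the negative of the sum of all others.\<close>

lemma conv_basis_antipode:
  assumes A: "A \<subseteq> verts P"
  shows "conv q P (\<lambda>s. basis (forest_on P s)) (\<lambda>s. antipode_forest n q (forest_on P s)) A = conv_unit A"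
proof (cases "A = {}")
  case True
  have "antipode_forest n q (forest_on P {}) = 1"
    using antipode_forest_on[of "{}" 0] antipode_part_0[of "{}"] by (simp add: conv_unit_def)
  then show ?thesis
    using True by (simp add: conv_def conv_unit_def pair_prod_trivial scale_simps forest_of_empty)
next
  case False
  let ?b = "\<lambda>s. basis (forest_on P s)" and ?S = "\<lambda>s. antipode_forest n q (forest_on P s)"
  \<comment> \<open>One less than the size: every \<open>A - s\<close> with \<open>s\<close>
    nonempty has at most \<open>N\<close> vertices.\<close>
  define N where "N = card A - 1"
  have N: "card A = Suc N" using False finite_subset_verts[OF A] by (simp add: N_def card_gt_0_iff)
  have "?S A = (\<Sum>m\<le>Suc N. antipode_part n q m (forest_on P A))"
    by (rule antipode_forest_on[OF A]) (simp add: N)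
  \<comment> \<open>The term \<open>m = 0\<close> vanishes because \<open>A\<close> is nonempty, and
    the shift leaves the range \<open>m \<le> N\<close>.\<close>
  also have "\<dots> = (\<Sum>m\<le>N. antipode_part n q (Suc m) (forest_on P A))"
    unfolding sum.atMost_Suc_shift using antipode_part_0[OF A] False by (simp add: conv_unit_def)
  also have "\<dots> = - (\<Sum>s\<in>Pow A - {{}}. scale (pair_prod q P A s)
      (?b s * (\<Sum>m\<le>N. antipode_part n q m (forest_on P (A - s)))))"
    unfolding antipode_part_Suc[OF A] sum_negf sum_distrib_left scale_sum by (subst sum.swap) simp
  also have "\<dots> = - (\<Sum>s\<in>Pow A - {{}}. scale (pair_prod q P A s) (?b s * ?S (A - s)))"
  proof -
    have "(\<Sum>m\<le>N. antipode_part n q m (forest_on P (A - s))) = ?S (A - s)" if s: "s \<in> Pow A - {{}}" for s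
    proof (rule antipode_forest_on[symmetric])
      show "A - s \<subseteq> verts P" using A by blast
      have "card (A - s) < card A"
        by (rule psubset_card_mono) (use s finite_subset_verts[OF A] in auto)
      then show "card (A - s) \<le> N" using N by simp
    qed
    then show ?thesis by simp
  qed
  finally have rec: "?S A = - (\<Sum>s\<in>Pow A - {{}}. scale (pair_prod q P A s) (?b s * ?S (A - s)))" .
  have "conv q P ?b ?S A = scale (pair_prod q P A {}) (?b {} * ?S (A - {})) +
      (\<Sum>s\<in>Pow A - {{}}. scale (pair_prod q P A s) (?b s * ?S (A - s)))"
    unfolding conv_def by (rule sum.remove) (use finite_subset_verts[OF A] in auto)
  also have "scale (pair_prod q P A {}) (?b {} * ?S (A - {})) = ?S A"
    by (simp add: pair_prod_trivial scale_simps forest_of_empty)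
  also note rec
  finally show ?thesis using False by (simp add: conv_unit_def)
qed

text \<open>The recursion by itself yields a right inverse. For the convolution \<open>?L\<close> on
  the other side, associativity gives that \<open>?L\<close> convolved with \<open>?S\<close> is
  \<open>?S\<close>. By induction \<open>?L\<close> vanishes on nonempty proper subsets, so at a
  nonempty \<open>A\<close> the expansion reads \<open>?S A = ?L A + ?S A\<close>.\<close>

lemma conv_antipode_basis:
  assumes A: "A \<subseteq> verts P"
  shows "conv q P (\<lambda>s. antipode_forest n q (forest_on P s)) (\<lambda>s. basis (forest_on P s)) A = conv_unit A"
  using A
proof (induction "card A" arbitrary: A rule: less_induct)
  case less
  let ?b = "\<lambda>s. basis (forest_on P s)" and ?S = "\<lambda>s. antipode_forest n q (forest_on P s)"
  note fin = finite_subset_verts[OF less.prems]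
  let ?L = "conv q P ?S ?b"
  have S1: "?S {} = 1"
    using antipode_forest_on[of "{}" 0] antipode_part_0[of "{}"] by (simp add: conv_unit_def)
  show ?case
  proof (cases "A = {}")
    case True
    then show ?thesis
      using S1 by (simp add: conv_def conv_unit_def pair_prod_trivial scale_simps forest_of_empty)
  next
    case False
    have L: "?L s = conv_unit s" if "s \<in> Pow A - {A}" for s
    proof (rule less.hyps)
      show "card s < card A" by (rule psubset_card_mono[OF fin]) (use that in auto)
      show "s \<subseteq> verts P" using that less.prems by auto
    qed
    have "conv q P ?L ?S A = conv q P ?S (conv q P ?b ?S) A" by (rule conv_assoc[OF fin])
    also have "\<dots> = conv q P ?S conv_unit A"
      by (rule conv_cong) (use conv_basis_antipode less.prems in auto)
    also have "\<dots> = ?S A" by (rule conv_unit_right[OF fin])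
    finally have "?S A = conv q P ?L ?S A" by simp
    also have "\<dots> = scale (pair_prod q P A A) (?L A * ?S (A - A)) +
        (\<Sum>s\<in>Pow A - {A}. scale (pair_prod q P A s) (?L s * ?S (A - s)))"
      unfolding conv_def[of q P ?L] by (rule sum.remove) (use fin in auto)
    also have "(\<Sum>s\<in>Pow A - {A}. scale (pair_prod q P A s) (?L s * ?S (A - s))) =
        (\<Sum>s\<in>Pow A - {A}. scale (pair_prod q P A s) (conv_unit s * ?S (A - s)))"
      using L by simp
    also have "\<dots> = (\<Sum>s\<in>{{}}. scale (pair_prod q P A s) (conv_unit s * ?S (A - s)))"
      by (rule sum.mono_neutral_right) (use fin False in \<open>auto simp: conv_unit_def scale_simps\<close>)
    also have "\<dots> = ?S A" by (simp add: conv_unit_def pair_prod_trivial scale_simps)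
    also have "scale (pair_prod q P A A) (?L A * ?S (A - A)) = ?L A"
      using S1 by (simp add: pair_prod_trivial scale_simps)
    finally show ?thesis using False by (simp add: conv_unit_def)
  qed
qed

lemma convolution_basis:
  assumes A: "A \<subseteq> verts P"
  shows "convolution (coproduct n q) X Y (basis (forest_on P A)) =
    conv q P (\<lambda>s. X (basis (forest_on P s))) (\<lambda>s. Y (basis (forest_on P s))) A"
proof -
  have "coproduct n q (basis (forest_on P A)) = delta_forest n q (forest_on P A)"
    by (simp add: coproduct_eq ST_closed forest_on_in_nforests[OF A] lin_basis)
  then show ?thesis by (simp add: convolution_eq_lin lin_delta_forest_on[OF A] conv_def)
qed

text \<open>Unrolling the recursion, each block contributes a sign and its weight within the union
  of itself and the later blocks. The last block is included in the product, with weight 1.\<close>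

lemma antipode_part_eq:
  assumes A: "A \<subseteq> verts P"
  shows "antipode_part n q m (forest_on P A) = (\<Sum>ss\<in>ordered_partitions A m.
    scale ((-1) ^ m * (\<Prod>j<m. pair_prod q P (\<Union>i\<in>{j..<m}. ss ! i) (ss ! j)))
      (\<Prod>i<m. basis (forest_on P (ss ! i))))"
  using A
proof (induction m arbitrary: A)
  case 0
  have "ordered_partitions A 0 = (if A = {} then {[]} else {})" by (auto simp: ordered_partitions_def)
  then show ?case using antipode_part_0[OF 0] by (simp add: conv_unit_def scale_simps)
next
  case (Suc m)
  define T where "T m ss = scale ((-1) ^ m * (\<Prod>j<m. pair_prod q P (\<Union>i\<in>{j..<m}. ss ! i) (ss ! j)))
      (\<Prod>i<m. basis (forest_on P (ss ! i)))" for m ss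
  have cons: "T (Suc m) (s # ss) = - scale (pair_prod q P A s) (basis (forest_on P s) * T m ss)"
    if s: "s \<in> Pow A - {{}}" and ss: "ss \<in> ordered_partitions (A - s) m" for s ss
  proof -
    have shift: "(\<Union>i\<in>{Suc j..<Suc m}. (s # ss) ! i) = (\<Union>i\<in>{j..<m}. ss ! i)" for j
      unfolding image_Suc_atLeastLessThan[symmetric]
      by (simp add: image_image del: image_Suc_atLeastLessThan)
    have "(\<Union>i<m. ss ! i) = A - s" using ss by (simp add: ordered_partitions_def)
    then have "(\<Union>i\<in>{0..<Suc m}. (s # ss) ! i) = A"
      using s unfolding atLeast0LessThan UN_nth_Cons by auto
    then have "(\<Prod>j<Suc m. pair_prod q P (\<Union>i\<in>{j..<Suc m}. (s # ss) ! i) ((s # ss) ! j)) =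
        pair_prod q P A s * (\<Prod>j<m. pair_prod q P (\<Union>i\<in>{j..<m}. ss ! i) (ss ! j))"
      unfolding prod.lessThan_Suc_shift shift by simp
    moreover have "(\<Prod>i<Suc m. basis (forest_on P ((s # ss) ! i))) =
        basis (forest_on P s) * (\<Prod>i<m. basis (forest_on P (ss ! i)) :: cforest \<Rightarrow>\<^sub>0 'k)"
      unfolding prod.lessThan_Suc_shift by simp
    ultimately show ?thesis unfolding T_def by (simp only:) (simp add: scale_simps scale_mult mult_ac)
  qed
  have fin: "finite A" by (rule finite_subset_verts[OF Suc.prems])
  have inj: "inj_on (\<lambda>(s, ss). s # ss) X" for X :: "(nat set \<times> nat set list) set" by (auto simp: inj_on_def)
  have "(\<Sum>ss\<in>ordered_partitions A (Suc m). T (Suc m) ss) =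
      (\<Sum>(s, ss)\<in>Sigma (Pow A - {{}}) (\<lambda>s. ordered_partitions (A - s) m). T (Suc m) (s # ss))"
    by (rule sum.reindex_cong[OF inj ordered_partitions_Suc]) (simp split: prod.split)
  also have "\<dots> = (\<Sum>(s, ss)\<in>Sigma (Pow A - {{}}) (\<lambda>s. ordered_partitions (A - s) m).
      - scale (pair_prod q P A s) (basis (forest_on P s) * T m ss))"
    by (rule sum.cong[OF refl], elim SigmaE, simp only: prod.case, rule cons)
  also have "\<dots> = (\<Sum>s\<in>Pow A - {{}}. \<Sum>ss\<in>ordered_partitions (A - s) m.
      - scale (pair_prod q P A s) (basis (forest_on P s) * T m ss))"
    using fin finite_ordered_partitions by (intro sum.Sigma[symmetric]) auto
  also have "\<dots> = - (\<Sum>s\<in>Pow A - {{}}. scale (pair_prod q P A s)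
      (basis (forest_on P s) * antipode_part n q m (forest_on P (A - s))))"
  proof -
    have "antipode_part n q m (forest_on P (A - s)) = (\<Sum>ss\<in>ordered_partitions (A - s) m. T m ss)" for s
      unfolding T_def by (rule Suc.IH) (use Suc.prems in blast)
    then show ?thesis by (simp only: sum_negf sum_distrib_left scale_sum)
  qed
  also have "\<dots> = antipode_part n q (Suc m) (forest_on P A)"
    by (rule antipode_part_Suc[OF Suc.prems, symmetric])
  finally show ?case by (simp only: T_def)
qed

end

section \<open>Existence and uniqueness of the antipode\<close>

lemma antipode_part_in_ST: "f \<in> nforests n \<Longrightarrow> antipode_part n q m f \<in> ST n"
proof (induction m arbitrary: f)
  case 0
  then show ?case by (simp add: ST_closed)
next
  case (Suc m)
  let ?G = "\<lambda>(a, b). if a = {#} then 0 else basis a * antipode_part n q m b"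
  have "delta_forest n q f \<in> ST2 n"
    using lin_delta_forest_in_ST2[OF ST_closed(3)[OF Suc.prems], of q] by (simp add: lin_basis)
  then have "lin ?G (delta_forest n q f) \<in> ST n"
    using Suc.IH by (intro lin_in_ST) (auto simp: ST2_def ST_closed)
  then have "scale (- 1) (lin ?G (delta_forest n q f)) \<in> ST n" by (rule ST_closed)
  then show ?case by (simp add: scale_simps)
qed

lemma antipode_forest_in_ST: "f \<in> nforests n \<Longrightarrow> antipode_forest n q f \<in> ST n"
  unfolding antipode_forest_def by (intro ST_sum antipode_part_in_ST)

lemma lin_lin: "lin g (lin h x) = lin (\<lambda>a. lin g (h a)) x"
  unfolding lin_def[of h] lin_def[of "\<lambda>a. lin g (h a)"] by (simp add: lin_sum lin_scale)

text \<open>By linearity the identity is tested on forests, each represented by one poset, where the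
  convolution becomes \<open>conv\<close> on the whole vertex set.\<close>

lemma convolution_eq_counit:
  fixes q :: "nat \<Rightarrow> nat \<Rightarrow> 'k::field_char_0"
  assumes XY: "\<And>P. P \<in> nforest_posets n \<Longrightarrow>
      conv q P (\<lambda>s. X (basis (forest_on P s))) (\<lambda>s. Y (basis (forest_on P s))) (verts P) = conv_unit (verts P)"
    and x: "x \<in> ST n"
  shows "convolution (coproduct n q) X Y x = scale (counit x) 1"
proof -
  let ?G = "\<lambda>(a, b). X (basis a) * Y (basis b)"
  have "convolution (coproduct n q) X Y x = lin (\<lambda>f. lin ?G (delta_forest n q f)) x"
    using x by (simp add: convolution_eq_lin coproduct_eq lin_lin)
  also have "\<dots> = lin (\<lambda>f. if f = {#} then 1 else 0) x"
  proof (rule lin_cong)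
    fix f assume "f \<in> Poly_Mapping.keys x"
    then have f: "f \<in> nforests n" using x by (auto simp: ST_def)
    define P where "P = forest_rep f"
    have P: "P \<in> nforest_posets n" unfolding P_def by (rule forest_rep_in_nforest_posets[OF f])
    have PV: "forest_on P (verts P) = f"
      using forest_of_induced_verts[OF nforest_posetsD(1)[OF P]] by (simp add: P_def forest_rep)
    have "lin ?G (delta_forest n q f) = conv_unit (verts P)"
      using lin_delta_forest_on[OF P order_refl, of ?G q] XY[OF P] PV by (simp add: conv_def)
    then show "lin ?G (delta_forest n q f) = (if f = {#} then 1 else 0)"
      using forest_on_eq_empty_iff[OF P order_refl] PV by (simp add: conv_unit_def)
  qed
  also have "\<dots> = (\<Sum>f\<in>Poly_Mapping.keys x. if f = {#} then scale (counit x) 1 else 0)"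
    unfolding lin_def by (intro sum.cong refl) (simp add: scale_simps counit_def)
  also have "\<dots> = scale (counit x) 1"
    by (simp add: counit_def in_keys_iff scale_simps)
  finally show ?thesis .
qed

lemma is_antipode_lin_antipode_forest:
  fixes q :: "nat \<Rightarrow> nat \<Rightarrow> 'k::field_char_0"
  shows "is_antipode n q (restrict (lin (antipode_forest n q)) (ST n))" (is "is_antipode n q ?S")
  unfolding is_antipode_def
proof (intro conjI ballI)
  have "lin (antipode_forest n q) x \<in> ST n" if "x \<in> ST n" for x
    by (rule lin_in_ST, rule antipode_forest_in_ST) (use that in \<open>auto simp: ST_def\<close>)
  then show "?S \<in> ST n \<rightarrow>\<^sub>E ST n" by auto
  show "linear_map_on (ST n) ?S" by (rule linear_map_on_restrict[OF linear_map_on_lin])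
  have S: "?S (basis (forest_on P s)) = antipode_forest n q (forest_on P s)"
    if "P \<in> nforest_posets n" "s \<subseteq> verts P" for P s
    using forest_on_in_nforests[OF that] by (simp add: ST_closed lin_basis)
  fix x :: "cforest \<Rightarrow>\<^sub>0 'k" assume x: "x \<in> ST n"
  show "convolution (coproduct n q) ?S id x = scale (counit x) 1"
  proof (rule convolution_eq_counit[OF _ x])
    fix P assume P: "P \<in> nforest_posets n"
    have "conv q P (\<lambda>s. ?S (basis (forest_on P s))) (\<lambda>s. id (basis (forest_on P s))) (verts P) =
        conv q P (\<lambda>s. antipode_forest n q (forest_on P s)) (\<lambda>s. basis (forest_on P s)) (verts P)"
      by (rule conv_cong) (use S[OF P] in simp_all)
    then show "conv q P (\<lambda>s. ?S (basis (forest_on P s))) (\<lambda>s. id (basis (forest_on P s))) (verts P) =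
        conv_unit (verts P)"
      using conv_antipode_basis[OF P order_refl, of q] by simp
  qed
  show "convolution (coproduct n q) id ?S x = scale (counit x) 1"
  proof (rule convolution_eq_counit[OF _ x])
    fix P assume P: "P \<in> nforest_posets n"
    have "conv q P (\<lambda>s. id (basis (forest_on P s))) (\<lambda>s. ?S (basis (forest_on P s))) (verts P) =
        conv q P (\<lambda>s. basis (forest_on P s)) (\<lambda>s. antipode_forest n q (forest_on P s)) (verts P)"
      by (rule conv_cong) (use S[OF P] in simp_all)
    then show "conv q P (\<lambda>s. id (basis (forest_on P s))) (\<lambda>s. ?S (basis (forest_on P s))) (verts P) =
        conv_unit (verts P)"
      using conv_basis_antipode[OF P order_refl, of q] by simp
  qed
qed

text \<open>Writing \<open>*\<close> for \<open>conv\<close> over the subsets of one poset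
  representing \<open>f\<close>, \<open>F = (G * b) * F = G * (b * F) = G\<close>: a right inverse
  of the identity equals the left inverse already found.\<close>

lemma is_antipode_basis:
  fixes q :: "nat \<Rightarrow> nat \<Rightarrow> 'k::field_char_0"
  assumes S: "is_antipode n q S" and f: "f \<in> nforests n"
  shows "S (basis f) = antipode_forest n q f"
proof -
  define P where "P = forest_rep f"
  have P: "P \<in> nforest_posets n" unfolding P_def by (rule forest_rep_in_nforest_posets[OF f])
  have PV: "forest_on P (verts P) = f"
    using forest_of_induced_verts[OF nforest_posetsD(1)[OF P]] by (simp add: P_def forest_rep)
  define b where "b s = (basis (forest_on P s) :: cforest \<Rightarrow>\<^sub>0 'k)" for s
  define F where "F s = S (b s)" for s
  define G where "G s = antipode_forest n q (forest_on P s)" for s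
  have fin: "finite (verts P)" by (rule finite_subset_verts[OF P order_refl])
  \<comment> \<open>The right inverse property of \<open>S\<close> is required on every subset,
    since the outer convolution with \<open>G\<close> runs over all of them.\<close>
  have bF: "conv q P b F A = conv_unit A" if A: "A \<subseteq> verts P" for A
  proof -
    have "b A \<in> ST n" unfolding b_def by (rule ST_closed(3)[OF forest_on_in_nforests[OF P A]])
    then have "convolution (coproduct n q) id S (b A) = scale (counit (b A)) 1"
      using S by (simp add: is_antipode_def)
    then have "conv q P b F A = scale (counit (b A)) 1"
      using convolution_basis[OF P A, of q id S] by (simp add: b_def[abs_def] F_def[abs_def])
    then show ?thesis
      using forest_on_eq_empty_iff[OF P A]
      by (auto simp: conv_unit_def b_def counit_def lookup_single when_def scale_simps)
  qed
  have Gb: "conv q P G b A = conv_unit A" if "A \<subseteq> verts P" for A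
    using conv_antipode_basis[OF P that, of q] by (simp add: G_def[abs_def] b_def[abs_def])
  have "F (verts P) = conv q P conv_unit F (verts P)" by (rule conv_unit_left[OF fin, symmetric])
  also have "\<dots> = conv q P (conv q P G b) F (verts P)" by (rule conv_cong) (simp_all add: Gb)
  also have "\<dots> = conv q P G (conv q P b F) (verts P)" by (rule conv_assoc[OF fin])
  also have "\<dots> = conv q P G conv_unit (verts P)" by (rule conv_cong) (simp_all add: bF)
  also have "\<dots> = G (verts P)" by (rule conv_unit_right[OF fin])
  finally show ?thesis by (simp add: F_def G_def b_def PV)
qed

lemma antipode_eq:
  fixes q :: "nat \<Rightarrow> nat \<Rightarrow> 'k::field_char_0"
  shows "antipode n q = restrict (lin (antipode_forest n q)) (ST n)"
  unfolding antipode_def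
proof (rule the_equality)
  show "is_antipode n q (restrict (lin (antipode_forest n q)) (ST n))" by (rule is_antipode_lin_antipode_forest)
  fix S assume S: "is_antipode n q S"
  show "S = restrict (lin (antipode_forest n q)) (ST n)"
  proof (rule extensionalityI[of _ "ST n :: (cforest \<Rightarrow>\<^sub>0 'k) set"])
    show "S \<in> extensional (ST n)" using S by (auto simp: is_antipode_def PiE_def)
    fix x :: "cforest \<Rightarrow>\<^sub>0 'k" assume x: "x \<in> ST n"
    then have "S x = lin (\<lambda>f. S (basis f)) x"
      using linear_map_on_eq_lin[of "nforests n" S x] S by (simp add: is_antipode_def ST_def)
    also have "\<dots> = lin (antipode_forest n q) x"
      by (rule lin_cong) (use x is_antipode_basis[OF S] in \<open>auto simp: ST_def\<close>)
    finally show "S x = restrict (lin (antipode_forest n q)) (ST n) x" using x by simp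
  qed simp
qed

text \<open>For a nonempty forest the term \<open>m = 0\<close> vanishes. The last block is its own
  ambient set, hence has factor 1, and the product over \<open>j < m\<close> shrinks to
  \<open>j < m - 1\<close>.\<close>

lemma antipode_forest_of:
  fixes q :: "nat \<Rightarrow> nat \<Rightarrow> 'k::field_char_0"
  assumes P: "P \<in> nforest_posets n" and ne: "verts P \<noteq> {}"
  shows "antipode n q (basis (forest_of P)) =
    (\<Sum>m=1..card (verts P). \<Sum>ss\<in>ordered_partitions (verts P) m.
      scale ((-1) ^ m * (\<Prod>j<m - 1. qcoeff n q (ss ! j) (induced P (\<Union>i\<in>{j..<m}. ss ! i))))
        (\<Prod>i<m. basis (forest_on P (ss ! i))))"
proof -
  let ?V = "verts P"
  have "antipode n q (basis (forest_of P)) = antipode_forest n q (forest_on P ?V)"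
    using forest_of_in_nforests[OF P] forest_of_induced_verts[OF nforest_posetsD(1)[OF P]]
    by (simp add: antipode_eq ST_closed lin_basis)
  also have "\<dots> = (\<Sum>m\<le>card ?V. antipode_part n q m (forest_on P ?V))"
    by (rule antipode_forest_on[OF P order_refl order_refl])
  also have "\<dots> = (\<Sum>m=1..card ?V. antipode_part n q m (forest_on P ?V))"
  proof (rule sum.mono_neutral_right)
    show "\<forall>m\<in>{..card ?V} - {1..card ?V}. antipode_part n q m (forest_on P ?V) = 0"
    proof
      fix m assume "m \<in> {..card ?V} - {1..card ?V}"
      then have "m = 0" by auto
      then show "antipode_part n q m (forest_on P ?V) = 0"
        using antipode_part_0[OF P order_refl, of q] ne by (simp add: conv_unit_def)
    qed
  qed auto
  also have "\<dots> = (\<Sum>m=1..card ?V. \<Sum>ss\<in>ordered_partitions ?V m.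
      scale ((-1) ^ m * (\<Prod>j<m - 1. qcoeff n q (ss ! j) (induced P (\<Union>i\<in>{j..<m}. ss ! i))))
        (\<Prod>i<m. basis (forest_on P (ss ! i))))"
    unfolding antipode_part_eq[OF P order_refl]
  proof (rule sum.cong[OF refl], rule sum.cong[OF refl])
    fix m ss assume m: "m \<in> {1..card ?V}" and ss: "ss \<in> ordered_partitions ?V m"
    then obtain k where k: "m = Suc k" by (cases m) auto
    have V: "(\<Union>i<m. ss ! i) = ?V" using ss by (simp add: ordered_partitions_def)
    have "(\<Prod>j<m. pair_prod q P (\<Union>i\<in>{j..<m}. ss ! i) (ss ! j)) =
        (\<Prod>j<k. pair_prod q P (\<Union>i\<in>{j..<m}. ss ! i) (ss ! j))"
      unfolding k by (simp add: pair_prod_trivial)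
    also have "\<dots> = (\<Prod>j<m - 1. qcoeff n q (ss ! j) (induced P (\<Union>i\<in>{j..<m}. ss ! i)))"
    proof (rule prod.cong)
      fix j assume "j \<in> {..<m - 1}"
      then have "j \<in> {j..<m}" by auto
      then have "ss ! j \<subseteq> (\<Union>i\<in>{j..<m}. ss ! i)" by blast
      moreover have "(\<Union>i\<in>{j..<m}. ss ! i) \<subseteq> ?V" unfolding V[symmetric] by auto
      ultimately show "pair_prod q P (\<Union>i\<in>{j..<m}. ss ! i) (ss ! j) =
          qcoeff n q (ss ! j) (induced P (\<Union>i\<in>{j..<m}. ss ! i))"
        using qcoeff_induced[OF P, of _ "ss ! j" q] by simp
    qed (simp add: k)
    finally show "scale ((-1) ^ m * (\<Prod>j<m. pair_prod q P (\<Union>i\<in>{j..<m}. ss ! i) (ss ! j)))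
        (\<Prod>i<m. basis (forest_on P (ss ! i))) =
      scale ((-1) ^ m * (\<Prod>j<m - 1. qcoeff n q (ss ! j) (induced P (\<Union>i\<in>{j..<m}. ss ! i))))
        (\<Prod>i<m. basis (forest_on P (ss ! i)))" by simp
  qed
  finally show ?thesis .
qed

text \<open>By \<open>forest_of_image\<close> the forest posets cover all \<open>n\<close>-coloured
  forests, and they provide the vertex set to which subsets and ordered partitions refer. Blocks are
  numbered from 0, so \<open>j < m - 1\<close> corresponds to the range \<open>1 \<le> j < m\<close>
  of the formula.\<close>

theorem theorem4p4:
  fixes n :: nat and q :: "nat \<Rightarrow> nat \<Rightarrow> 'k::field_char_0"
  shows "(\<forall>P\<in>nforest_posets n.
            coproduct n q (basis (forest_of P)) =
              (\<Sum>s\<in>Pow (verts P). scale (qcoeff n q s P)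
                 (basis (forest_of (induced P s), forest_of (induced P (verts P - s)))))) \<and>
         (\<forall>P\<in>nforest_posets n. verts P \<noteq> {} \<longrightarrow>
            antipode n q (basis (forest_of P)) =
              (\<Sum>m=1..card (verts P). \<Sum>ss\<in>ordered_partitions (verts P) m.
                 scale ((-1) ^ m *
                     (\<Prod>j<m - 1. qcoeff n q (ss ! j) (induced P (\<Union>i\<in>{j..<m}. ss ! i))))
                   (\<Prod>i<m. basis (forest_of (induced P (ss ! i))))))"
  using coproduct_forest_of antipode_forest_of unfolding delta_def by blast

end
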